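(* If $V$ is a uniformly bounded nontrivial irreducible module over the loop-Virasoro algebra $\mathcal{L}=\mathrm{Vir}\otimes\mathbb{C}[t^{\pm1}]$, then all weight spaces of $V$ are $1$-dimensional (that is, $\dim V_\lambda=1$ for every weight $\lambda$ with $V_\lambda\neq 0$).
   Context: The Virasoro algebra $\mathrm{Vir}$ is the complex Lie algebra with basis $\{c,d_i : i\in\mathbb{Z}\}$ and brackets $[d_m,d_n]=(n-m)d_{m+n}+\delta_{m,-n}\frac{m^3-m}{12}c$, $[d_m,c]=0$. The loop-Virasoro algebra is $\mathcal{L}=\mathrm{Vir}\otimes\mathbb{C}[t^{\pm1}]$ with brackets $[d_i\otimes t^j,d_k\otimes t^l]=(k-i)\,d_{i+k}\otimes t^{j+l}+\delta_{i+k,0}\frac{i^3-i}{12}\,c\otimes t^{j+l}$, and with $c\otimes t^l$ central. Write $d_0=d_0\otimes 1$. For a module $V$ and $\lambda\in\mathbb{C}$, the weight space is $V_\lambda=\{v\in V: d_0v=\lambda v\}$. $V$ is a weight module if it is the sum of its weight spaces. A weight module $V$ is uniformly bounded if there is $N\in\mathbb{N}$ with $\dim V_\lambda<N$ for all $\lambda$ with $V_\lambda\ne0$. A module is trivial if the Lie algebra acts by zero. *)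

theory Defs
  imports Complex_Main "HOL-Library.Poly_Mapping"
begin

locale lie_algebra = vector_space scale
  for scale :: "'k::field \<Rightarrow> 'l::ab_group_add \<Rightarrow> 'l" +
  fixes bracket :: "'l \<Rightarrow> 'l \<Rightarrow> 'l"
  assumes linear_bracket_left: "Vector_Spaces.linear scale scale (\<lambda>x. bracket x y)"
    and linear_bracket_right: "Vector_Spaces.linear scale scale (\<lambda>y. bracket x y)"
    and bracket_self: "bracket x x = 0"
    and jacobi: "bracket x (bracket y z) + bracket y (bracket z x) + bracket z (bracket x y) = 0"

text \<open>The underlying vector space of a module is the whole type \<^typ>\<open>'v\<close>; submodules are subsets of it.\<close>

locale lie_module = L: lie_algebra scaleL bracket + V: vector_space scale
  for scaleL :: "'k::field \<Rightarrow> 'l::ab_group_add \<Rightarrow> 'l"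
    and bracket :: "'l \<Rightarrow> 'l \<Rightarrow> 'l"
    and scale :: "'k \<Rightarrow> 'v::ab_group_add \<Rightarrow> 'v" +
  fixes act :: "'l \<Rightarrow> 'v \<Rightarrow> 'v"
  assumes linear_act_left: "Vector_Spaces.linear scaleL scale (\<lambda>x. act x v)"
    and linear_act_right: "Vector_Spaces.linear scale scale (\<lambda>v. act x v)"
    and act_bracket: "act (bracket x y) v = act x (act y v) - act y (act x v)"
begin

definition submodule :: "'v set \<Rightarrow> bool" where
  "submodule W \<longleftrightarrow> V.subspace W \<and> (\<forall>x. \<forall>w\<in>W. act x w \<in> W)"

definition irreducible :: bool where
  "irreducible \<longleftrightarrow> (UNIV :: 'v set) \<noteq> {0} \<and> (\<forall>W. submodule W \<longrightarrow> W = {0} \<or> W = UNIV)"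

definition trivial :: bool where
  "trivial \<longleftrightarrow> (\<forall>x v. act x v = 0)"

end


datatype vir_basis = VC | VD int

text \<open>
  \<open>Vir \<otimes> \<complex>[t, t\<^sup>-\<^sup>1]\<close> is represented by its basis \<open>b \<otimes> t^j\<close>, where \<open>b\<close> is \<open>c = VC\<close> or
  \<open>d_i = VD i\<close>, and \<open>j\<close> is an integer: an element is a finitely supported coefficient
  function on the pairs \<open>(b, j)\<close>.
\<close>

type_synonym loop_vir = "(vir_basis \<times> int) \<Rightarrow>\<^sub>0 complex"

definition loop_scale :: "complex \<Rightarrow> loop_vir \<Rightarrow> loop_vir" where
  "loop_scale a = Poly_Mapping.map ((*) a)"

fun basis_bracket :: "vir_basis \<times> int \<Rightarrow> vir_basis \<times> int \<Rightarrow> loop_vir" where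
  "basis_bracket (VD i, j) (VD k, l) =
     Poly_Mapping.single (VD (i + k), j + l) (of_int (k - i))
     + (if i + k = 0 then Poly_Mapping.single (VC, j + l) (of_int (i ^ 3 - i) / 12) else 0)"
| "basis_bracket (VC, j) b = 0"
| "basis_bracket a (VC, l) = 0"

definition loop_bracket :: "loop_vir \<Rightarrow> loop_vir \<Rightarrow> loop_vir" where
  "loop_bracket x y =
     (\<Sum>a\<in>Poly_Mapping.keys x. \<Sum>b\<in>Poly_Mapping.keys y.
        loop_scale (Poly_Mapping.lookup x a * Poly_Mapping.lookup y b) (basis_bracket a b))"

lemma lookup_loop_scale [simp]:
  "Poly_Mapping.lookup (loop_scale a x) k = a * Poly_Mapping.lookup x k"
  unfolding loop_scale_def by transfer (auto simp: when_def)

lemma loop_scale_0 [simp]: "loop_scale a 0 = 0" "loop_scale 0 x = 0"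
  by (auto intro!: poly_mapping_eqI)

lemma vector_space_loop_scale: "vector_space loop_scale"
  by unfold_locales (auto intro!: poly_mapping_eqI simp: lookup_add algebra_simps)

lemma keys_loop_scale: "Poly_Mapping.keys (loop_scale a x) \<subseteq> Poly_Mapping.keys x"
  by (auto simp: in_keys_iff)

lemma loop_bracket_superset:
  assumes "finite A" "finite B" "Poly_Mapping.keys x \<subseteq> A" "Poly_Mapping.keys y \<subseteq> B"
  shows "loop_bracket x y = (\<Sum>a\<in>A. \<Sum>b\<in>B.
    loop_scale (Poly_Mapping.lookup x a * Poly_Mapping.lookup y b) (basis_bracket a b))"
proof -
  have "(\<Sum>b\<in>Poly_Mapping.keys y.
        loop_scale (Poly_Mapping.lookup x a * Poly_Mapping.lookup y b) (basis_bracket a b)) =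
      (\<Sum>b\<in>B. loop_scale (Poly_Mapping.lookup x a * Poly_Mapping.lookup y b) (basis_bracket a b))"
    for a using assms by (intro sum.mono_neutral_left) (auto simp: in_keys_iff)
  then show ?thesis
    unfolding loop_bracket_def using assms
    by (simp, intro sum.mono_neutral_left) (auto simp: in_keys_iff intro!: sum.neutral)
qed

interpretation loop: vector_space loop_scale
  by (rule vector_space_loop_scale)

lemma loop_bracket_add_left: "loop_bracket (x + x') y = loop_bracket x y + loop_bracket x' y"
proof -
  let ?A = "Poly_Mapping.keys x \<union> Poly_Mapping.keys x'" and ?B = "Poly_Mapping.keys y"
  have k: "Poly_Mapping.keys (x + x') \<subseteq> ?A" by (rule Poly_Mapping.keys_add)
  show ?thesis
    using k by (subst (1 2 3) loop_bracket_superset[of ?A ?B])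
      (auto simp: lookup_add algebra_simps loop.scale_left_distrib sum.distrib)
qed

lemma loop_bracket_add_right: "loop_bracket x (y + y') = loop_bracket x y + loop_bracket x y'"
proof -
  let ?B = "Poly_Mapping.keys y \<union> Poly_Mapping.keys y'" and ?A = "Poly_Mapping.keys x"
  have k: "Poly_Mapping.keys (y + y') \<subseteq> ?B" by (rule Poly_Mapping.keys_add)
  show ?thesis
    using k by (subst (1 2 3) loop_bracket_superset[of ?A ?B])
      (auto simp: lookup_add algebra_simps loop.scale_left_distrib sum.distrib)
qed

lemma loop_bracket_scale_left: "loop_bracket (loop_scale r x) y = loop_scale r (loop_bracket x y)"
  by (subst (1 2) loop_bracket_superset[of "Poly_Mapping.keys x" "Poly_Mapping.keys y"])
     (use keys_loop_scale in \<open>auto simp: loop.scale_sum_right mult.assoc\<close>)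

lemma loop_bracket_scale_right: "loop_bracket x (loop_scale r y) = loop_scale r (loop_bracket x y)"
  by (subst (1 2) loop_bracket_superset[of "Poly_Mapping.keys x" "Poly_Mapping.keys y"])
     (use keys_loop_scale in \<open>auto simp: loop.scale_sum_right mult_ac\<close>)

lemma loop_bracket_0 [simp]: "loop_bracket 0 y = 0" "loop_bracket x 0 = 0"
  by (simp_all add: loop_bracket_def)

lemma loop_bracket_single:
  "loop_bracket (Poly_Mapping.single a r) (Poly_Mapping.single b s) = loop_scale (r * s) (basis_bracket a b)"
  by (simp add: loop_bracket_def)

lemma loop_vir_induct [case_names zero single add]:
  fixes x :: loop_vir
  assumes "P 0" and single: "\<And>a r. P (Poly_Mapping.single a r)"
    and add: "\<And>x y. P x \<Longrightarrow> P y \<Longrightarrow> P (x + y)"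
  shows "P x"
proof -
  have "P (\<Sum>a\<in>A. Poly_Mapping.single a (Poly_Mapping.lookup x a))" if "finite A" for A
    using that by induction (auto intro: assms)
  moreover have "x = (\<Sum>a\<in>Poly_Mapping.keys x. Poly_Mapping.single a (Poly_Mapping.lookup x a))"
    by (rule poly_mapping_eqI) (auto simp: lookup_sum lookup_single when_def in_keys_iff)
  ultimately show ?thesis by (metis finite_keys)
qed

lemma loop_scale_single: "loop_scale r (Poly_Mapping.single a s) = Poly_Mapping.single a (r * s)"
  by (auto intro!: poly_mapping_eqI simp: lookup_single when_def)

lemma basis_bracket_antisym: "basis_bracket b a = - basis_bracket a b"
proof (cases "(a, b)" rule: basis_bracket.cases)
  case (1 i j k l)
  show ?thesis
  proof (cases "i + k = 0")
    case True
    then have i: "i = - k" by simp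
    show ?thesis using 1 i
      by (auto intro!: poly_mapping_eqI
          simp: lookup_add lookup_minus lookup_single when_def power3_eq_cube add.commute diff_divide_distrib)
  next
    case False
    then have "k + i \<noteq> 0" by simp
    with False show ?thesis
      using 1 by (auto intro!: poly_mapping_eqI simp: lookup_single when_def add.commute)
  qed
next
  case (2 j b)
  then show ?thesis by (cases b; cases "fst b") auto
next
  case (3 v l)
  then show ?thesis by auto
qed

lemma basis_bracket_C [simp]: "basis_bracket b (VC, j) = 0"
  by (cases b; cases "fst b") auto

lemma loop_bracket_antisym: "loop_bracket y x = - loop_bracket x y"
proof (induction x rule: loop_vir_induct)
  case (single a r)
  show ?case
  proof (induction y rule: loop_vir_induct)
    case (single b s)
    show ?case
      unfolding loop_bracket_single by (subst basis_bracket_antisym) (simp add: mult.commute)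
  qed (simp_all add: loop_bracket_add_left loop_bracket_add_right)
qed (simp_all add: loop_bracket_add_left loop_bracket_add_right)

lemma loop_bracket_VD:
  "loop_bracket (Poly_Mapping.single (VD i, j) r) (Poly_Mapping.single (VD k, l) s) =
     Poly_Mapping.single (VD (i + k), j + l) (r * s * of_int (k - i))
     + Poly_Mapping.single (VC, j + l) (if i + k = 0 then r * s * (of_int (i ^ 3 - i) / 12) else 0)"
  by (simp add: loop_bracket_single loop.scale_right_distrib loop_scale_single)

lemma loop_bracket_C [simp]:
  "loop_bracket (Poly_Mapping.single (VC, j) r) (Poly_Mapping.single b s) = 0"
  "loop_bracket (Poly_Mapping.single b s) (Poly_Mapping.single (VC, j) r) = 0"
  by (simp_all add: loop_bracket_single)

lemma loop_bracket_C' [simp]: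
  "loop_bracket (Poly_Mapping.single (VC, j) r) y = 0"
  "loop_bracket y (Poly_Mapping.single (VC, j) r) = 0"
  by (induction y rule: loop_vir_induct; simp add: loop_bracket_add_left loop_bracket_add_right)+

lemma virasoro_cocycle:
  fixes i k m :: complex
  assumes "i + k + m = 0"
  shows "(m - k) * (i ^ 3 - i) + (i - m) * (k ^ 3 - k) + (k - i) * (m ^ 3 - m) = 0"
proof -
  have m: "m = - i - k" using assms by (simp add: algebra_simps eq_neg_iff_add_eq_0)
  show ?thesis unfolding m by (simp add: power3_eq_cube) algebra
qed

lemma loop_jacobi_VD:
  "loop_bracket (Poly_Mapping.single (VD i, j) r)
      (loop_bracket (Poly_Mapping.single (VD k, l) s) (Poly_Mapping.single (VD m, n) t)) =
    Poly_Mapping.single (VD (i + k + m), j + l + n)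
      (r * s * t * (of_int m - of_int k) * (of_int k + of_int m - of_int i))
    + Poly_Mapping.single (VC, j + l + n)
      (if i + k + m = 0 then r * s * t / 12 * ((of_int m - of_int k) * (of_int i ^ 3 - of_int i)) else 0)"
  by (simp add: loop_bracket_VD loop_bracket_add_right add.assoc mult_ac)

lemma loop_jacobi_single:
  fixes a b c :: "vir_basis \<times> int"
  shows "loop_bracket (Poly_Mapping.single a r) (loop_bracket (Poly_Mapping.single b s) (Poly_Mapping.single c t))
    + loop_bracket (Poly_Mapping.single b s) (loop_bracket (Poly_Mapping.single c t) (Poly_Mapping.single a r))
    + loop_bracket (Poly_Mapping.single c t) (loop_bracket (Poly_Mapping.single a r) (Poly_Mapping.single b s)) = 0"
proof (cases "fst a = VC \<or> fst b = VC \<or> fst c = VC")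
  case True
  then show ?thesis by (cases a; cases b; cases c) auto
next
  case False
  then obtain i j k l m n where abc: "a = (VD i, j)" "b = (VD k, l)" "c = (VD m, n)"
    by (metis prod.collapse vir_basis.exhaust)
  have e: "k + m + i = i + k + m" "m + i + k = i + k + m" "l + n + j = j + l + n" "n + j + l = j + l + n"
    by simp_all
  let ?i = "of_int i :: complex" and ?k = "of_int k :: complex" and ?m = "of_int m :: complex"
  have d: "r * s * t * (?m - ?k) * (?k + ?m - ?i) + s * t * r * (?i - ?m) * (?m + ?i - ?k)
      + t * r * s * (?k - ?i) * (?i + ?k - ?m) = 0"
    by (simp add: algebra_simps)
  have c: "r * s * t / 12 * ((?m - ?k) * (?i ^ 3 - ?i)) + s * t * r / 12 * ((?i - ?m) * (?k ^ 3 - ?k))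
      + t * r * s / 12 * ((?k - ?i) * (?m ^ 3 - ?m)) = 0" if "i + k + m = 0"
  proof -
    have "?i + ?k + ?m = 0" using arg_cong[OF that, of "of_int :: int \<Rightarrow> complex"] by simp
    then have "r * s * t / 12 * ((?m - ?k) * (?i ^ 3 - ?i) + (?i - ?m) * (?k ^ 3 - ?k)
       + (?k - ?i) * (?m ^ 3 - ?m)) = 0" by (simp only: virasoro_cocycle mult_zero_right)
    moreover have "u / 12 * (x + y + z) = u / 12 * x + u / 12 * y + u / 12 * z" for u x y z :: complex
      by (simp add: distrib_left)
    moreover have "s * t * r = r * s * t" "t * r * s = r * s * t" by (simp_all add: mult_ac)
    ultimately show ?thesis by (simp only:)
  qed
  let ?X = "\<lambda>f. Poly_Mapping.single (VD (i + k + m), j + l + n) f :: loop_vir"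
  let ?Y = "\<lambda>f. Poly_Mapping.single (VC, j + l + n) f :: loop_vir"
  have sum: "(?X x + ?Y u) + (?X y + ?Y v) + (?X z + ?Y w) = ?X (x + y + z) + ?Y (u + v + w)"
    for x y z u v w
    by (simp only: single_add add_ac)
  show ?thesis
  proof (cases "i + k + m = 0")
    case True
    show ?thesis
      unfolding abc loop_jacobi_VD e if_P[OF True] sum d c[OF True] by simp
  next
    case False
    show ?thesis
      unfolding abc loop_jacobi_VD e if_not_P[OF False] sum d by simp
  qed
qed

lemma loop_jacobi:
  "loop_bracket x (loop_bracket y z) + loop_bracket y (loop_bracket z x)
    + loop_bracket z (loop_bracket x y) = 0"
proof -
  let ?J = "\<lambda>x y z. loop_bracket x (loop_bracket y z) + loop_bracket y (loop_bracket z x)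
    + loop_bracket z (loop_bracket x y)"
  have add: "?J (x + x') y z = ?J x y z + ?J x' y z" "?J x (y + y') z = ?J x y z + ?J x y' z"
    "?J x y (z + z') = ?J x y z + ?J x y z'" for x x' y y' z z'
    by (simp_all add: loop_bracket_add_left loop_bracket_add_right)
  have z: "?J 0 y z = 0" "?J x 0 z = 0" "?J x y 0 = 0" for x y z
    by simp_all
  show ?thesis
  proof (induction x rule: loop_vir_induct)
    case (single a r)
    show ?case
    proof (induction y rule: loop_vir_induct)
      case (single b s)
      show ?case
      proof (induction z rule: loop_vir_induct)
        case (single c t)
        show ?case by (rule loop_jacobi_single)
      qed (simp_all only: z add add_0)
    qed (simp_all only: z add add_0)
  qed (simp_all only: z add add_0)
qed

theorem lie_algebra_loop_vir: "lie_algebra loop_scale loop_bracket"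
proof
  fix x :: loop_vir
  have "loop_bracket x x = - loop_bracket x x" by (rule loop_bracket_antisym)
  then have eq: "Poly_Mapping.lookup (loop_bracket x x) k = - Poly_Mapping.lookup (loop_bracket x x) k" for k
    by (metis lookup_uminus)
  then have "2 * Poly_Mapping.lookup (loop_bracket x x) k = 0" for k
    unfolding mult_2 by (subst (2) eq) simp
  then show "loop_bracket x x = 0" by (auto intro: poly_mapping_eqI)
qed (simp_all add: loop_bracket_add_left loop_bracket_add_right loop_bracket_scale_left
      loop_bracket_scale_right loop_jacobi)

definition d0 :: loop_vir where
  "d0 = Poly_Mapping.single (VD 0, 0) 1"

locale loop_vir_module = lie_module loop_scale loop_bracket scale act
  for scale :: "complex \<Rightarrow> 'v::ab_group_add \<Rightarrow> 'v"
    and act :: "loop_vir \<Rightarrow> 'v \<Rightarrow> 'v"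
begin

definition weight_space :: "complex \<Rightarrow> 'v set" where
  "weight_space \<mu> = {v. act d0 v = scale \<mu> v}"

definition weight_module :: bool where
  "weight_module \<longleftrightarrow> V.span (\<Union>\<mu>. weight_space \<mu>) = UNIV"

text \<open>
  Since \<open>V.dim\<close> is \<open>0\<close> on infinite-dimensional spaces, finite dimension
  is required separately.
\<close>

definition uniformly_bounded :: bool where
  "uniformly_bounded \<longleftrightarrow> weight_module \<and>
     (\<exists>N::nat. \<forall>\<mu>. weight_space \<mu> \<noteq> {0} \<longrightarrow>
        (\<exists>B. finite B \<and> weight_space \<mu> \<subseteq> V.span B) \<and> V.dim (weight_space \<mu>) < N)"

end

end

(*
  Write rho_k(p) for the action of d_k (x) p(t), V_n for the weight space of weight lam + n, and x for
  the eigenvalue of d_0.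

  Evaluation. Casimir eigenvalues show that d_1 : V_n -> V_(n+1) is bijective for |n| large, so by
  counting dimensions some p <> 0 has rho_1(p) = 0; then p C[t, 1/t] acts by zero. Let p be of minimal
  degree and p = (t - a) q. If q(a) = 0, the operators rho_k(q) commute and are nilpotent, and
  differentiating monomials in them by the d_l yields a common kernel vector, contradicting
  irreducibility. If q(a) <> 0 and q is not constant, q / q(a) is idempotent modulo p, so
  V is a module over two commuting copies of Vir, and each weight of one copy spreads over a half
  line; the multiplicities would be unbounded. Hence t acts by the scalar a.

  Irreducible Virasoro modules. Reindex (or replace d_k by - d_(-k)) so that d_1 identifies all V_n,
  n >= 0. In this identification d_(-1) = x (x - 1) + C and d_(-2) = x (x - 1) (x - 2) + 3 x C + b with
  constant operators C, b, which act irreducibly on V_0. Traces on V_n of words of weight 0 are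
  quasi-polynomials in n. For m in the ideal generated by [C, b] the trace of m d_2 / d_1^2 tends to 0,
  hence vanishes, and its leading coefficient is tr m = 0; an element of minimal rank would produce a
  nonzero idempotent of trace 0. So [C, b] = 0 and dim V_n = 1 for n >= 0. The relation for
  [d_(-2), d_2] becomes a polynomial identity in x that forces d_k w_n = (x_n + k beta) w_(n+k) for
  large indices. Finally a vector z of any weight is determined by d_l z for l large, and these are
  c (x + l beta) w with a single scalar c; so every weight space is a line.
*)

theory Submission
  imports Defs "HOL-Computational_Algebra.Fundamental_Theorem_Algebra"
begin

section \<open>Linear algebra\<close>

text \<open>On a tail where d_1 is bijective all weight spaces become one space, on which d_(-1) and
  d_(-2) are known through C and b, but d_2 has no formula. Its brackets with d_(-1) and d_(-2) give
  only recursions in n, and what is extracted from them is asymptotic: d_2 = d_1^2 / x up to lower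
  order. This suffices because traces are rigid. By cyclicity the trace of a word of weight 0
  satisfies a difference equation whose right side is the trace of a shorter word, so a decay
  statement about it becomes an exact one. The argument needs genuine words, and division by d_1^2
  is not a word; it applies to [C, b] because [C, b] = d_1^2 [C, d_(-2)] has the factor d_1^2 split
  off already. Characteristic 0 enters through the trace of an idempotent, which is its rank. The
  same recursions, read on an off-diagonal block, have no inhomogeneous term, so the block vanishes
  for large n: hence subspaces stable under C and b are eventually stable under d_2.\<close>

lemma increasing_degrees_kernel:
  fixes q :: "nat \<Rightarrow> complex poly" and \<phi> :: "complex poly \<Rightarrow> complex"
  assumes add: "\<And>p q. \<phi> (p + q) = \<phi> p + \<phi> q" and scale: "\<And>c p. \<phi> (smult c p) = c * \<phi> p"
    and q: "\<And>i. degree (q i) < degree (q (Suc i))" "\<And>i. q i \<noteq> 0"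
  shows "\<exists>q'. (\<forall>i. degree (q' i) < degree (q' (Suc i))) \<and> (\<forall>i. q' i \<noteq> 0 \<and> \<phi> (q' i) = 0) \<and>
    (\<forall>i. \<exists>a b j. q' i = smult a (q j) + smult b (q (Suc j)))"
proof -
  define r where "r j = (if \<phi> (q j) = 0 then q j
    else smult (\<phi> (q (Suc j))) (q j) + smult (- \<phi> (q j)) (q (Suc j)))" for j
  have deg: "degree (r j) = (if \<phi> (q j) = 0 then degree (q j) else degree (q (Suc j)))" for j
  proof (cases "\<phi> (q j) = 0")
    case False
    have "degree (smult (\<phi> (q (Suc j))) (q j)) < degree (smult (- \<phi> (q j)) (q (Suc j)))"
      using le_less_trans[OF degree_smult_le q(1)] False by simp
    then show ?thesis unfolding r_def using False by (simp only: if_False degree_add_eq_right) simp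
  qed (simp add: r_def)
  \<comment> \<open>\<open>r j\<close> has the degree of \<open>q j\<close> or of
    \<open>q (Suc j)\<close>, so neighbours may have equal degree; every second term is
    kept.\<close>
  have mono: "degree (r (2 * i)) < degree (r (2 * Suc i))" for i
    using q(1)[of "2 * i"] q(1)[of "Suc (2 * i)"] q(1)[of "Suc (Suc (2 * i))"]
    unfolding deg by simp
  have nz: "r j \<noteq> 0" for j
    using deg[of j] q(1)[of j] q(2)[of j] by (auto simp: r_def)
  have ker: "\<phi> (r j) = 0" for j
  proof (cases "\<phi> (q j) = 0")
    case False
    then show ?thesis
      by (simp only: r_def if_False add scale) (simp add: mult.commute)
  qed (simp add: r_def)
  have "\<exists>a b j'. r j = smult a (q j') + smult b (q (Suc j'))" for j
  proof (cases "\<phi> (q j) = 0")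
    case True
    then have "r j = smult 1 (q j) + smult 0 (q (Suc j))" by (simp add: r_def)
    then show ?thesis by blast
  next
    case False
    then show ?thesis unfolding r_def by (simp only: if_False) blast
  qed
  then show ?thesis
    using mono nz ker by (intro exI[of _ "\<lambda>i. r (2 * i)"]) auto
qed

text \<open>Replaces a count of codimensions in an infinite-dimensional space: the invariant is a
  sequence of strictly increasing degrees, rebuilt once for each functional. In the applications the
  functionals are coordinates of a vector that depends linearly on the polynomial.\<close>

lemma common_kernel_poly:
  fixes \<Phi> :: "(complex poly \<Rightarrow> complex) set"
  assumes "finite \<Phi>"
    and "\<And>\<phi> p q. \<phi> \<in> \<Phi> \<Longrightarrow> \<phi> (p + q) = \<phi> p + \<phi> q"
    and "\<And>\<phi> c p. \<phi> \<in> \<Phi> \<Longrightarrow> \<phi> (smult c p) = c * \<phi> p"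
  shows "\<exists>p. p \<noteq> 0 \<and> (\<forall>\<phi>\<in>\<Phi>. \<phi> p = 0)"
proof -
  have "\<exists>q :: nat \<Rightarrow> complex poly. (\<forall>i. degree (q i) < degree (q (Suc i))) \<and>
    (\<forall>i. q i \<noteq> 0) \<and> (\<forall>i. \<forall>\<phi>\<in>\<Phi>. \<phi> (q i) = 0)"
    using assms
  proof (induction \<Phi> rule: finite_induct)
    case empty
    show ?case
      by (intro exI[of _ "\<lambda>i. monom 1 i"]) (auto simp: degree_monom_eq monom_eq_0_iff)
  next
    case (insert \<phi> \<Phi>)
    then obtain q :: "nat \<Rightarrow> complex poly" where q: "\<And>i. degree (q i) < degree (q (Suc i))"
      "\<And>i. q i \<noteq> 0" "\<And>i \<psi>. \<psi> \<in> \<Phi> \<Longrightarrow> \<psi> (q i) = 0" by (metis insertCI)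
    obtain q' where q': "\<And>i. degree (q' i) < degree (q' (Suc i))" "\<And>i. q' i \<noteq> 0"
      "\<And>i. \<phi> (q' i) = 0" "\<And>i. \<exists>a b j. q' i = smult a (q j) + smult b (q (Suc j))"
      using increasing_degrees_kernel[of \<phi> q] insert.prems q(1,2) by (metis insertCI)
    have "\<psi> (q' i) = 0" if "\<psi> \<in> \<Phi>" for \<psi> i
      using q'(4)[of i] insert.prems that q(3) by (metis add_0 insertCI mult_zero_right)
    then show ?case using q' by (intro exI[of _ q']) auto
  qed
  then show ?thesis by metis
qed

locale complex_vector_space = vector_space scale
  for scale :: "complex \<Rightarrow> 'v::ab_group_add \<Rightarrow> 'v" (infixr "*s" 75)
begin

abbreviation lin :: "('v \<Rightarrow> 'v) \<Rightarrow> bool" where "lin \<equiv> Vector_Spaces.linear scale scale"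

lemma linI: "(\<And>x y. f (x + y) = f x + f y) \<Longrightarrow> (\<And>c x. f (c *s x) = c *s f x) \<Longrightarrow> lin f"
  by (simp add: Vector_Spaces.linear_iff vector_space_axioms)

lemma
  assumes "lin f"
  shows lin_add: "f (x + y) = f x + f y" and lin_scale: "f (c *s x) = c *s f x"
    and lin_0: "f 0 = 0" and lin_diff: "f (x - y) = f x - f y" and lin_minus: "f (- x) = - f x"
    and lin_sum: "f (\<Sum>i\<in>I. g i) = (\<Sum>i\<in>I. f (g i))"
proof -
  interpret f: Vector_Spaces.linear scale scale f by fact
  show "f (x + y) = f x + f y" "f (c *s x) = c *s f x" "f 0 = 0" "f (x - y) = f x - f y" "f (- x) = - f x"
    "f (\<Sum>i\<in>I. g i) = (\<Sum>i\<in>I. f (g i))"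
    by (rule f.add f.scale f.zero f.diff f.neg f.sum)+
qed

lemmas lin_simps = lin_add lin_scale lin_0 lin_diff lin_minus

lemma lin_comp: "lin f \<Longrightarrow> lin g \<Longrightarrow> lin (f \<circ> g)"
  by (rule linI) (simp_all add: lin_simps)

lemma lin_comp': "lin f \<Longrightarrow> lin g \<Longrightarrow> lin (\<lambda>v. f (g v))"
  by (rule linI) (simp_all add: lin_simps)

lemma lin_plus: "lin f \<Longrightarrow> lin g \<Longrightarrow> lin (\<lambda>v. f v + g v)"
  by (rule linI) (simp_all add: lin_simps algebra_simps)

lemma lin_minus': "lin f \<Longrightarrow> lin g \<Longrightarrow> lin (\<lambda>v. f v - g v)"
  by (rule linI) (simp_all add: lin_simps algebra_simps)

lemma lin_smult: "lin f \<Longrightarrow> lin (\<lambda>v. c *s f v)"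
  by (rule linI) (simp_all add: lin_simps algebra_simps)

lemma lin_id: "lin (\<lambda>v. v)"
  by (rule linI) simp_all

lemma lin_zero: "lin (\<lambda>v. 0)"
  by (rule linI) simp_all

lemma lin_funpow: "lin f \<Longrightarrow> lin (f ^^ n)"
  by (induction n) (auto simp: lin_id id_def intro: lin_comp)

lemma lin_eq_on_span: "lin f \<Longrightarrow> lin g \<Longrightarrow> (\<And>b. b \<in> B \<Longrightarrow> f b = g b) \<Longrightarrow> v \<in> span B \<Longrightarrow> f v = g v"
  using vector_space_pair.linear_eq_on[of scale scale f g v B]
  by (simp add: vector_space_pair_def vector_space_axioms)

lemma subspace_kernel: "lin f \<Longrightarrow> subspace {v. f v = 0}"
  by (auto simp: subspace_def lin_simps)

lemma lin_image_span: "lin f \<Longrightarrow> (\<And>b. b \<in> B \<Longrightarrow> f b \<in> W) \<Longrightarrow> subspace W \<Longrightarrow> v \<in> span B \<Longrightarrow> f v \<in> W"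
  by (rule span_induct_alt[where h = "\<lambda>v. f v \<in> W"])
     (auto simp: lin_simps subspace_0 subspace_add subspace_scale)

text \<open>Bounded by a spanning set rather than by \<open>dim\<close>, which is 0 on
  infinite-dimensional spaces; subspaces inherit the same \<open>N\<close>.\<close>

definition fdim :: "nat \<Rightarrow> 'v set \<Rightarrow> bool" where
  "fdim N W \<longleftrightarrow> subspace W \<and> (\<exists>B. finite B \<and> card B \<le> N \<and> W \<subseteq> span B)"

lemma fdim_subspace: "fdim N W \<Longrightarrow> subspace W"
  by (simp add: fdim_def)

lemma fdim_mono: "fdim N W \<Longrightarrow> subspace W' \<Longrightarrow> W' \<subseteq> W \<Longrightarrow> fdim N W'"
  by (auto simp: fdim_def)

lemma fdim_indep:
  assumes "fdim N W" "independent S" "S \<subseteq> W"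
  shows "finite S" "card S \<le> N"
proof -
  obtain B where "finite B" "card B \<le> N" "W \<subseteq> span B" using assms by (auto simp: fdim_def)
  moreover from this have "finite S \<and> card S \<le> card B"
    using independent_span_bound[of B S] assms by blast
  ultimately show "finite S" "card S \<le> N" by auto
qed

lemma fdim_basis:
  assumes "fdim N W"
  obtains B where "finite B" "card B \<le> N" "independent B" "B \<subseteq> W" "span B = W"
proof -
  obtain B where B: "B \<subseteq> W" "independent B" "W \<subseteq> span B"
    using maximal_independent_subset[of W] by blast
  then show ?thesis
    using that[of B] fdim_indep[OF assms, of B] span_minimal[of B W] fdim_subspace[OF assms] by auto
qed

lemma fdim_basis_extend:
  assumes "fdim N W" "independent A" "A \<subseteq> W"
  obtains B where "finite B" "card B \<le> N" "independent B" "A \<subseteq> B" "B \<subseteq> W" "span B = W"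
proof -
  obtain B where B: "A \<subseteq> B" "B \<subseteq> W" "independent B" "W \<subseteq> span B"
    using maximal_independent_subset_extend[OF assms(3,2)] by blast
  then show ?thesis
    using that[of B] fdim_indep[OF assms(1), of B] span_minimal[of B W] fdim_subspace[OF assms(1)] by auto
qed

lemma lin_independent_image:
  assumes "lin f" "independent B" "\<And>v. v \<in> span B \<Longrightarrow> f v = 0 \<Longrightarrow> v = 0"
  shows "independent (f ` B)" "inj_on f B"
proof -
  interpret f: Vector_Spaces.linear scale scale f by fact
  have inj: "inj_on f (span B)"
    using assms f.inj_on_iff_eq_0[of "span B"] by auto
  show "independent (f ` B)" by (rule f.independent_injective_image[OF assms(2) inj])
  show "inj_on f B" using inj by (rule inj_on_subset) (rule span_superset)
qed

lemma inj_imp_surj_on: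
  assumes "fdim N W" "lin f" "f ` W \<subseteq> W" "\<And>w. w \<in> W \<Longrightarrow> f w = 0 \<Longrightarrow> w = 0"
  shows "f ` W = W"
proof -
  obtain B where B: "finite B" "independent B" "B \<subseteq> W" "span B = W"
    using fdim_basis[OF assms(1)] by metis
  have ind: "independent (f ` B)" and inj: "inj_on f B"
    using lin_independent_image[OF assms(2) B(2)] assms(4) B(4) by auto
  have "W \<subseteq> span (f ` B)"
  proof
    fix w assume w: "w \<in> W"
    show "w \<in> span (f ` B)"
    proof (rule ccontr)
      assume n: "w \<notin> span (f ` B)"
      then have "independent (insert w (f ` B))" using ind by (simp add: independent_insertI)
      moreover have "insert w (f ` B) \<subseteq> span B" using w B assms(3) by auto
      ultimately have "card (insert w (f ` B)) \<le> card B"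
        using independent_span_bound[OF B(1)] by blast
      moreover have "w \<notin> f ` B" using n span_base by blast
      ultimately show False using B(1) card_image[OF inj] by simp
    qed
  qed
  also have "span (f ` B) = f ` W"
    using module_hom.span_image[of scale scale f B] assms(2) B(4)
    by (simp add: Vector_Spaces.linear_iff_module_hom)
  finally show ?thesis using assms(3) by blast
qed

lemma eigen_independent:
  assumes "finite A" "lin f" "\<And>\<alpha>. \<alpha> \<in> A \<Longrightarrow> v \<alpha> \<noteq> 0" "\<And>\<alpha>. \<alpha> \<in> A \<Longrightarrow> f (v \<alpha>) = \<alpha> *s v \<alpha>"
    and "(\<Sum>\<alpha>\<in>A. c \<alpha> *s v \<alpha>) = 0" "\<alpha> \<in> A"
  shows "c \<alpha> = 0"
  using assms
proof (induction A arbitrary: c \<alpha> rule: finite_induct)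
  case (insert \<beta> A)
  have s: "c \<beta> *s v \<beta> + (\<Sum>\<alpha>\<in>A. c \<alpha> *s v \<alpha>) = 0" using insert by simp
  then have "f (c \<beta> *s v \<beta> + (\<Sum>\<alpha>\<in>A. c \<alpha> *s v \<alpha>)) = 0" using lin_0[OF insert.prems(1)] by simp
  then have "c \<beta> *s \<beta> *s v \<beta> + (\<Sum>\<alpha>\<in>A. c \<alpha> *s \<alpha> *s v \<alpha>) = 0"
    using insert.prems by (simp add: lin_simps lin_sum)
  moreover have "\<beta> *s (c \<beta> *s v \<beta> + (\<Sum>\<alpha>\<in>A. c \<alpha> *s v \<alpha>)) = 0" using s by simp
  ultimately have "(\<Sum>\<alpha>\<in>A. c \<alpha> *s \<alpha> *s v \<alpha>) - (\<Sum>\<alpha>\<in>A. \<beta> *s c \<alpha> *s v \<alpha>) = 0"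
    by (simp add: algebra_simps scale_sum_right) (metis add_diff_cancel_left' diff_0 diff_self)
  then have "(\<Sum>\<alpha>\<in>A. (c \<alpha> * (\<alpha> - \<beta>)) *s v \<alpha>) = 0"
    by (simp add: sum_subtractf[symmetric] algebra_simps)
  then have z: "c \<alpha> * (\<alpha> - \<beta>) = 0" if "\<alpha> \<in> A" for \<alpha>
    by (intro insert.IH[of "\<lambda>\<alpha>. c \<alpha> * (\<alpha> - \<beta>)" \<alpha>]) (use insert.prems that in auto)
  then have zA: "c \<alpha> = 0" if "\<alpha> \<in> A" for \<alpha> using that insert.hyps(2) by force
  then have "c \<beta> *s v \<beta> = 0" using s by simp
  then show ?case using insert.prems zA by auto
qed simp

text \<open>Only the eigenvectors have to lie in \<open>W\<close>; \<open>f\<close> itself may leave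
  it. This turns a bound on the multiplicity of a weight into a bound on the number of eigenvalues
  found there.\<close>

lemma eigen_bound:
  assumes W: "fdim N W" and A: "finite A" and f: "lin f"
    and v: "\<And>\<alpha>. \<alpha> \<in> A \<Longrightarrow> v \<alpha> \<in> W" "\<And>\<alpha>. \<alpha> \<in> A \<Longrightarrow> v \<alpha> \<noteq> 0" "\<And>\<alpha>. \<alpha> \<in> A \<Longrightarrow> f (v \<alpha>) = \<alpha> *s v \<alpha>"
  shows "card A \<le> N"
proof -
  have inj: "inj_on v A"
    using v by (intro inj_onI) (metis scale_cancel_right)
  have "independent (v ` A)"
  proof (rule independent_if_scalars_zero)
    show "finite (v ` A)" using A by simp
    fix g x assume "(\<Sum>x\<in>v ` A. g x *s x) = 0" and x: "x \<in> v ` A"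
    then have "(\<Sum>\<alpha>\<in>A. g (v \<alpha>) *s v \<alpha>) = 0" by (simp add: sum.reindex[OF inj])
    then show "g x = 0"
      using eigen_independent[OF A f v(2,3), of "\<lambda>\<alpha>. g (v \<alpha>)"] x by auto
  qed
  then show ?thesis using fdim_indep[OF W, of "v ` A"] v card_image[OF inj] by auto
qed

section \<open>Polynomials in an operator: eigenvectors and nilpotency on finite-dimensional
  subspaces\<close>

definition pop :: "('v \<Rightarrow> 'v) \<Rightarrow> complex poly \<Rightarrow> 'v \<Rightarrow> 'v" where
  "pop f p v = (\<Sum>i\<le>degree p. coeff p i *s (f ^^ i) v)"

lemma pop_superset: "degree p \<le> n \<Longrightarrow> pop f p v = (\<Sum>i\<le>n. coeff p i *s (f ^^ i) v)"
  unfolding pop_def by (rule sum.mono_neutral_left) (auto simp: coeff_eq_0)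

lemma pop_add: "pop f (p + q) v = pop f p v + pop f q v"
  by (subst (1 2 3) pop_superset[where n = "max (degree p) (degree q)"])
     (auto simp: degree_add_le_max algebra_simps sum.distrib)

lemma pop_smult: "pop f (smult c p) v = c *s pop f p v"
  by (subst (1 2) pop_superset[where n = "degree p"]) (auto simp: scale_sum_right)

lemma pop_pCons: "lin f \<Longrightarrow> pop f (pCons a p) v = a *s v + f (pop f p v)"
  by (subst pop_superset[where n = "Suc (degree p)"], simp add: degree_pCons_le)
     (simp add: sum.atMost_Suc_shift pop_def lin_simps lin_sum del: sum.atMost_Suc)

lemma pop_in: "lin f \<Longrightarrow> subspace W \<Longrightarrow> f ` W \<subseteq> W \<Longrightarrow> v \<in> W \<Longrightarrow> pop f p v \<in> W"
proof (induction p)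
  case 0 then show ?case by (simp add: pop_def subspace_0)
next
  case (pCons a p)
  then have "f (pop f p v) \<in> W" by blast
  then show ?case using pCons by (simp add: pop_pCons subspace_add subspace_scale)
qed

lemma pop_linear_factor: "lin f \<Longrightarrow> pop f ([:- r, 1:] * q) v = f (pop f q v) - r *s pop f q v"
  by (simp only: mult_pCons_left mult_zero_left pCons_0_0 add_0_right pop_add pop_smult pop_pCons) (simp add: pop_smult)

text \<open>Some nonzero polynomial in \<open>f\<close> kills \<open>w\<close>, because the finitely
  many coordinates of the result are linear in the polynomial. Linear factors are split off one at a
  time; the first quotient that does not kill \<open>w\<close> produces the eigenvector.\<close>

lemma eigen_exists:
  assumes W: "fdim N W" and f: "lin f" "f ` W \<subseteq> W" and w: "w \<in> W" "w \<noteq> 0"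
  shows "\<exists>v\<in>W. v \<noteq> 0 \<and> (\<exists>r. f v = r *s v)"
proof -
  obtain B where B: "finite B" "independent B" "B \<subseteq> W" "span B = W"
    using fdim_basis[OF W] by metis
  have sW: "subspace W" using W by (rule fdim_subspace)
  have inW: "pop f p w \<in> span B" for p
    using pop_in[OF f(1) sW f(2) w(1)] B by simp
  have "\<exists>p. p \<noteq> 0 \<and> (\<forall>\<phi>\<in>(\<lambda>b p. representation B (pop f p w) b) ` B. \<phi> p = 0)"
    using B inW by (intro common_kernel_poly)
      (auto simp: pop_add pop_smult representation_add representation_scale)
  then obtain p where p: "p \<noteq> 0" "\<And>b. b \<in> B \<Longrightarrow> representation B (pop f p w) b = 0" by auto
  have p0: "pop f p w = 0"
    using sum_representation_eq[OF B(2) inW[of p] B(1), of] p(2) by simp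
  have "p \<noteq> 0 \<Longrightarrow> pop f p w = 0 \<Longrightarrow> ?thesis"
  proof (induction "degree p" arbitrary: p)
    case 0
    then obtain c where "p = [:c:]" "c \<noteq> 0" by (metis degree_eq_zeroE pCons_eq_0_iff)
    then show ?case using 0 w f by (simp add: pop_pCons lin_simps) (simp add: pop_def lin_simps)
  next
    case (Suc n)
    then have "\<not> constant (poly p)" using constant_degree[of p] by simp
    then obtain r where "poly p r = 0" using fundamental_theorem_of_algebra by blast
    then obtain q where q: "p = [:- r, 1:] * q" by (metis dvdE poly_eq_0_iff_dvd)
    then have "q \<noteq> 0" using Suc by auto
    then have "degree p = Suc (degree q)" unfolding q by (subst degree_mult_eq) auto
    show ?case
    proof (cases "pop f q w = 0")
      case True
      then show ?thesis using Suc \<open>q \<noteq> 0\<close> \<open>degree p = Suc (degree q)\<close> by auto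
    next
      case False
      then show ?thesis using Suc(4) pop_linear_factor[OF f(1), of r q w] q
          pop_in[OF f(1) sW f(2) w(1), of q] by auto
    qed
  qed
  then show ?thesis using p p0 by blast
qed

text \<open>Up to the first vanishing power the vectors \<open>(f ^^ i) w\<close> are independent,
  so there are at most \<open>N\<close> of them. The exponent thus depends neither on
  \<open>w\<close> nor on the weight space, which gives one exponent for the whole module.\<close>

lemma nilpotent_bound:
  assumes W: "fdim N W" and f: "lin f" "f ` W \<subseteq> W" and w: "w \<in> W" "(f ^^ j) w = 0"
  shows "(f ^^ N) w = 0"
proof -
  define m where "m = (LEAST j. (f ^^ j) w = 0)"
  have m: "(f ^^ m) w = 0" unfolding m_def using w(2) by (rule LeastI)
  have mm: "(f ^^ i) w \<noteq> 0" if "i < m" for i using not_less_Least[of i] that unfolding m_def by blast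
  have f0: "(f ^^ i) 0 = 0" for i using lin_0[OF lin_funpow[OF f(1)]] .
  have later: "(f ^^ i) w = 0" if "m \<le> i" for i
    using m f0[of "i - m"] that by (metis comp_apply funpow_add le_add_diff_inverse2)
  have z: "\<forall>i<m. c i = 0" if s: "(\<Sum>i<m. c i *s (f ^^ i) w) = 0" for c :: "nat \<Rightarrow> complex"
  proof (rule ccontr)
    assume "\<not> (\<forall>i<m. c i = 0)"
    then have ex: "\<exists>i. i < m \<and> c i \<noteq> 0" by auto
    define i where "i = (LEAST i. i < m \<and> c i \<noteq> 0)"
    have i: "i < m" "c i \<noteq> 0" "\<And>k. k < i \<Longrightarrow> c k = 0"
      using LeastI_ex[OF ex] not_less_Least[of _ "\<lambda>i. i < m \<and> c i \<noteq> 0"] unfolding i_def[symmetric]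
      by (auto dest: less_trans)
    \<comment> \<open>\<open>i\<close> is the lowest index with a nonzero coefficient; this power
      moves its term to the last nonzero vector and kills all later terms.\<close>
    have "(f ^^ (m - 1 - i)) (\<Sum>i<m. c i *s (f ^^ i) w) = (\<Sum>k<m. c k *s (f ^^ (m - 1 - i + k)) w)"
      using f by (simp add: lin_sum[OF lin_funpow] lin_scale[OF lin_funpow] funpow_add)
    also have "\<dots> = (\<Sum>k\<in>{i}. c k *s (f ^^ (m - 1 - i + k)) w)"
    proof (rule sum.mono_neutral_right)
      show "\<forall>k\<in>{..<m} - {i}. c k *s (f ^^ (m - 1 - i + k)) w = 0"
      proof
        fix k assume "k \<in> {..<m} - {i}"
        then have "k < i \<or> m \<le> m - 1 - i + k" by auto
        then show "c k *s (f ^^ (m - 1 - i + k)) w = 0" using i(3) later by auto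
      qed
    qed (use i in auto)
    also have "\<dots> = c i *s (f ^^ (m - 1)) w" using i by simp
    finally have "c i *s (f ^^ (m - 1)) w = 0" using s f0 by simp
    then show False using i mm[of "m - 1"] by simp
  qed
  have inj: "inj_on (\<lambda>i. (f ^^ i) w) {..<m}"
  proof (rule inj_onI)
    fix i k assume ik: "i \<in> {..<m}" "k \<in> {..<m}" "(f ^^ i) w = (f ^^ k) w"
    show "i = k"
    proof (rule ccontr)
      assume ne: "i \<noteq> k"
      define c :: "nat \<Rightarrow> complex" where "c l = (if l = i then 1 else if l = k then - 1 else 0)" for l
      have "(\<Sum>l<m. c l *s (f ^^ l) w) = (\<Sum>l\<in>{i,k}. c l *s (f ^^ l) w)"
        using ik by (intro sum.mono_neutral_right) (auto simp: c_def)
      also have "\<dots> = 0" using ne ik by (simp add: c_def)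
      finally show False using z[of c] ik by (auto simp: c_def)
    qed
  qed
  have inW: "(f ^^ i) w \<in> W" for i using w(1) f(2) by (induction i) auto
  have "independent ((\<lambda>i. (f ^^ i) w) ` {..<m})"
  proof (rule independent_if_scalars_zero)
    fix g x assume "(\<Sum>x\<in>(\<lambda>i. (f ^^ i) w) ` {..<m}. g x *s x) = 0" "x \<in> (\<lambda>i. (f ^^ i) w) ` {..<m}"
    then show "g x = 0" using z[of "\<lambda>i. g ((f ^^ i) w)"] by (auto simp: sum.reindex[OF inj])
  qed simp
  then have "m \<le> N" using fdim_indep[OF W] inW card_image[OF inj] by fastforce
  then show ?thesis by (rule later)
qed

end

section \<open>Recurrences and quasi-polynomials\<close>

text \<open>Eventual quasi-polynomials: after finitely many differences, with steps that may vary,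
  the sequence vanishes for large \<open>n\<close>. They are encoded by differences because the
  traces in question come with a difference equation and not with a formula.\<close>

inductive quasi_poly :: "(nat \<Rightarrow> complex) \<Rightarrow> bool" where
  zero: "\<forall>\<^sub>F n in sequentially. f n = 0 \<Longrightarrow> quasi_poly f"
| step: "q > 0 \<Longrightarrow> quasi_poly (\<lambda>n. f (n + q) - f n) \<Longrightarrow> quasi_poly f"

lemma eventually_shift: "\<forall>\<^sub>F n in sequentially. P n \<Longrightarrow> \<forall>\<^sub>F n in sequentially. P (n + (k::nat))"
  unfolding eventually_sequentially by (meson trans_le_add1)

lemma quasi_poly_cong:
  assumes "quasi_poly f" "\<forall>\<^sub>F n in sequentially. f n = g n"
  shows "quasi_poly g"
  using assms
proof (induction arbitrary: g)
  case (zero f)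
  then have "\<forall>\<^sub>F n in sequentially. g n = 0" by eventually_elim simp
  then show ?case by (rule quasi_poly.zero)
next
  case (step q f)
  have "\<forall>\<^sub>F n in sequentially. f (n + q) - f n = g (n + q) - g n"
    using eventually_shift[OF step.prems, of q] step.prems by eventually_elim simp
  then show ?case by (rule quasi_poly.step[OF step.hyps(1) step.IH])
qed

text \<open>Prepares sums: the step \<open>q\<close> that reduces \<open>f\<close> is applied to
  \<open>g\<close> as well and must not lead \<open>g\<close> out of the class. It does not, since
  differences with different steps commute.\<close>

lemma quasi_poly_diff_shift: "quasi_poly f \<Longrightarrow> quasi_poly (\<lambda>n. f (n + k) - f n)"
proof (induction rule: quasi_poly.induct)
  case (zero f)
  have "\<forall>\<^sub>F n in sequentially. f (n + k) - f n = 0"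
    using eventually_shift[OF zero, of k] zero by eventually_elim simp
  then show ?case by (rule quasi_poly.zero)
next
  case (step q f)
  have "(\<lambda>n. f (n + q + k) - f (n + q) - (f (n + k) - f n)) =
      (\<lambda>n. f (n + k + q) - f (n + k) - (f (n + q) - f n))"
    by (simp add: fun_eq_iff add.assoc add.commute[of q k])
  then show ?case
    using step.IH by - (rule quasi_poly.step[OF step.hyps(1)], simp only:)
qed

lemma quasi_poly_add: "quasi_poly f \<Longrightarrow> quasi_poly g \<Longrightarrow> quasi_poly (\<lambda>n. f n + g n)"
proof (induction arbitrary: g rule: quasi_poly.induct)
  case (zero f)
  have "\<forall>\<^sub>F n in sequentially. g n = f n + g n" using zero(1) by eventually_elim simp
  then show ?case by (rule quasi_poly_cong[OF zero(2)])
next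
  case (step q f)
  have "quasi_poly (\<lambda>n. (f (n + q) - f n) + (g (n + q) - g n))"
    by (rule step.IH) (rule quasi_poly_diff_shift[OF step.prems])
  then show ?case
    by - (rule quasi_poly.step[OF step.hyps(1)], simp only: add_diff_add)
qed

lemma quasi_poly_cmult: "quasi_poly f \<Longrightarrow> quasi_poly (\<lambda>n. c * f n)"
proof (induction rule: quasi_poly.induct)
  case (zero f)
  then have "\<forall>\<^sub>F n in sequentially. c * f n = 0" by eventually_elim simp
  then show ?case by (rule quasi_poly.zero)
next
  case (step q f)
  then show ?case by - (rule quasi_poly.step[OF step.hyps(1)], simp add: right_diff_distrib)
qed

lemma quasi_poly_shift: "quasi_poly f \<Longrightarrow> quasi_poly (\<lambda>n. f (n + k))"
  using quasi_poly_add[OF quasi_poly_diff_shift, of f f k] by simp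

lemma quasi_poly_linear_mult: "quasi_poly f \<Longrightarrow> quasi_poly (\<lambda>n. (c + of_nat n) * f n)"
proof (induction rule: quasi_poly.induct)
  case (zero f)
  then have "\<forall>\<^sub>F n in sequentially. (c + of_nat n) * f n = 0" by eventually_elim simp
  then show ?case by (rule quasi_poly.zero)
next
  case (step q f)
  have "quasi_poly (\<lambda>n. (c + of_nat n) * (f (n + q) - f n) + of_nat q * f (n + q))"
    by (rule quasi_poly_add[OF step.IH quasi_poly_cmult[OF quasi_poly_shift[OF quasi_poly.step[OF step.hyps(1,2)]]]])
  moreover have "(c + of_nat n) * (f (n + q) - f n) + of_nat q * f (n + q) =
      (c + of_nat (n + q)) * f (n + q) - (c + of_nat n) * f n" for n
    by (simp add: algebra_simps)
  ultimately show ?case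
    by - (rule quasi_poly.step[OF step.hyps(1)], simp)
qed

text \<open>By induction the difference is eventually zero, so \<open>f\<close> is eventually
  periodic, and a periodic sequence with limit 0 is zero.\<close>

lemma quasi_poly_decay:
  assumes "quasi_poly f" "f \<longlonglongrightarrow> 0"
  shows "\<forall>\<^sub>F n in sequentially. f n = 0"
  using assms
proof (induction rule: quasi_poly.induct)
  case (step q f)
  have "(\<lambda>n. f (n + q) - f n) \<longlonglongrightarrow> 0 - 0"
    by (intro tendsto_diff LIMSEQ_ignore_initial_segment step.prems)
  then have "\<forall>\<^sub>F n in sequentially. f (n + q) - f n = 0" using step.IH by simp
  then obtain M where M: "\<And>n. n \<ge> M \<Longrightarrow> f (n + q) = f n"
    unfolding eventually_sequentially right_minus_eq by blast
  have z: "f n = 0" if "n \<ge> M" for n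
  proof -
    have c: "f (n + k * q) = f n" for k
    proof (induction k)
      case (Suc k)
      have "f (n + Suc k * q) = f ((n + k * q) + q)" by (rule arg_cong[of _ _ f]) simp
      also have "\<dots> = f (n + k * q)" by (rule M) (rule trans_le_add1[OF that])
      also have "\<dots> = f n" by (rule Suc)
      finally show ?case .
    qed simp
    have lim: "(\<lambda>k. f (n + k * q)) \<longlonglongrightarrow> 0"
    proof -
      have "strict_mono (\<lambda>k. n + k * q)" using step.hyps(1) by (simp add: strict_mono_Suc_iff)
      from LIMSEQ_subseq_LIMSEQ[OF step.prems this] show ?thesis by (simp only: comp_def)
    qed
    have e: "(\<lambda>k. f (n + k * q)) = (\<lambda>k. f n)" by (rule ext) (rule c)
    show ?thesis by (rule LIMSEQ_unique[OF tendsto_const lim[unfolded e]])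
  qed
  show ?case using z by (rule eventually_sequentiallyI)
qed

text \<open>Rows and columns have separate index sets because an off-diagonal block of
  \<open>d 2\<close> is estimated as well as the full matrix.\<close>

definition nrm :: "'i set \<Rightarrow> 'j set \<Rightarrow> ('i \<Rightarrow> 'j \<Rightarrow> complex) \<Rightarrow> real" where
  "nrm I J F = (\<Sum>i\<in>I. \<Sum>j\<in>J. cmod (F i j))"

lemma nrm_nonneg [simp]: "0 \<le> nrm I J F"
  by (simp add: nrm_def sum_nonneg)

lemma nrm_add: "nrm I J (\<lambda>i j. F i j + G i j) \<le> nrm I J F + nrm I J G"
  unfolding nrm_def sum.distrib[symmetric] by (intro sum_mono norm_triangle_ineq)

lemma nrm_diff: "nrm I J (\<lambda>i j. F i j - G i j) \<le> nrm I J F + nrm I J G"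
  unfolding nrm_def sum.distrib[symmetric] by (intro sum_mono norm_triangle_ineq4)

lemma nrm_scale: "nrm I J (\<lambda>i j. c * F i j) = cmod c * nrm I J F"
  by (simp add: nrm_def norm_mult sum_distrib_left)

lemma nrm_cong: "(\<And>i j. i \<in> I \<Longrightarrow> j \<in> J \<Longrightarrow> F i j = G i j) \<Longrightarrow> nrm I J F = nrm I J G"
  by (simp add: nrm_def)

lemma nrm_entry: "finite I \<Longrightarrow> finite J \<Longrightarrow> i \<in> I \<Longrightarrow> j \<in> J \<Longrightarrow> cmod (F i j) \<le> nrm I J F"
  unfolding nrm_def
  by (rule order_trans[OF member_le_sum[of j J] member_le_sum[of i I]]) (auto intro: sum_nonneg)

lemma nrm_left:
  assumes "finite I" "finite J"
  shows "nrm I J (\<lambda>i j. \<Sum>k\<in>I. A i k * F k j) \<le> nrm I I A * nrm I J F"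
proof -
  have "nrm I J (\<lambda>i j. \<Sum>k\<in>I. A i k * F k j) \<le> (\<Sum>i\<in>I. \<Sum>j\<in>J. \<Sum>k\<in>I. cmod (A i k) * cmod (F k j))"
    unfolding nrm_def by (intro sum_mono order_trans[OF norm_sum]) (simp add: norm_mult)
  also have "\<dots> = (\<Sum>i\<in>I. \<Sum>k\<in>I. cmod (A i k) * (\<Sum>j\<in>J. cmod (F k j)))"
    by (intro sum.cong refl, subst sum.swap) (simp add: sum_distrib_left)
  also have "\<dots> \<le> (\<Sum>i\<in>I. \<Sum>k\<in>I. cmod (A i k) * nrm I J F)"
    unfolding nrm_def using assms
    by (intro sum_mono mult_left_mono member_le_sum[of _ I "\<lambda>k. \<Sum>j\<in>J. cmod (F k j)"]) (auto intro: sum_nonneg)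
  also have "\<dots> = nrm I I A * nrm I J F"
    by (simp add: nrm_def[of I I] sum_distrib_right)
  finally show ?thesis .
qed

lemma nrm_right:
  assumes "finite I" "finite J"
  shows "nrm I J (\<lambda>i j. \<Sum>k\<in>J. F i k * A k j) \<le> nrm I J F * nrm J J A"
proof -
  have t: "nrm I J F = nrm J I (\<lambda>j i. F i j)" for F :: "'a \<Rightarrow> 'b \<Rightarrow> complex" and I J
    unfolding nrm_def by (rule sum.swap)
  have t': "nrm J J A = nrm J J (\<lambda>j i. A i j)"
    unfolding nrm_def by (rule sum.swap)
  show ?thesis
    using nrm_left[of J I "\<lambda>j i. A i j" "\<lambda>j i. F i j"] assms
    by (simp add: t[of I J] t' mult.commute)
qed

text \<open>\<open>S0\<close>, \<open>S1\<close>, \<open>S2\<close> are entries of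
  \<open>d 2\<close> at consecutive weights; \<open>LA\<close>, \<open>RA\<close>,
  \<open>LB\<close>, \<open>RB\<close> are left and right products with \<open>C\<close> and
  \<open>b\<close>. The third equation times \<open>x + 1\<close>, minus the second times
  \<open>(x + 2) * (x + 3)\<close>, minus the first times \<open>(x + 1) * (x + 2)\<close>, is free
  of \<open>S0\<close> and \<open>S1\<close>. In it \<open>S2\<close> has the coefficient
  \<open>- 2 * (x + 2) * (x + 3) * (x + 4)\<close> and \<open>T\<close> a quadratic one; their lower
  terms are the numerical constants on the right.\<close>

lemma two_step_elimination:
  fixes x :: complex
  assumes "(x + 3) * (x + 2) * S1 + LA1 = (x + 1) * x * S0 + RA0 + 3 * T"
    and "(x + 4) * (x + 3) * S2 + LA2 = (x + 2) * (x + 1) * S1 + RA1 + 3 * T"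
    and "(x + 4) * (x + 3) * (x + 2) * S2 + 3 * (x + 4) * LA2 + LB2 =
      (x + 2) * (x + 1) * x * S0 + 3 * (x + 2) * RA0 + RB0 + (4 * x + k) * T"
  shows "2 * x\<^sup>2 * (x * S2 - T) =
    ((x + 1) * (3 * (x + 4) * LA2 + LB2 - (3 * (x + 2) * RA0 + RB0)) - (x + 2) * (x + 3) * (LA2 - RA1))
    - ((x + 1) * (x + 2) * (LA1 - RA0) + ((x * (k - 20) + k - 24) * T + (18 * x\<^sup>2 + 52 * x + 48) * S2))"
  using assms by algebra

text \<open>
  The hypotheses are \<open>[d\<^sub>-\<^sub>1, d\<^sub>2] = 3 d\<^sub>1\<close> and \<open>[d\<^sub>-\<^sub>2, d\<^sub>2] = 4 d\<^sub>0 + \<dots>\<close> in a trivialisation where \<open>d\<^sub>1\<close> is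
  the identity. To leading order they read \<open>E n = (1 + 4 / x) E (n + 1)\<close> and
  \<open>(1 + 3 / x) E (n + 2) = (1 - 3 / x) E n + 4 T / x\<^sup>2\<close>, and these are incompatible unless \<open>x E \<rightarrow> T\<close>.
\<close>

lemma two_step_recursion_asymptotics:
  fixes E :: "nat \<Rightarrow> 'i \<Rightarrow> 'j \<Rightarrow> complex" and \<mu> \<kappa> :: complex
  defines "x \<equiv> \<lambda>n::nat. \<mu> + of_nat n"
  assumes fin: "finite I" "finite J"
    and e1: "\<And>n i j. i \<in> I \<Longrightarrow> j \<in> J \<Longrightarrow>
      (x n + 3) * (x n + 2) * E (n + 1) i j + (\<Sum>k\<in>I. A i k * E (n + 1) k j) =
      (x n + 1) * x n * E n i j + (\<Sum>k\<in>J. E n i k * A' k j) + 3 * T i j"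
    and e2: "\<And>n i j. i \<in> I \<Longrightarrow> j \<in> J \<Longrightarrow>
      (x n + 4) * (x n + 3) * (x n + 2) * E (n + 2) i j + 3 * (x n + 4) * (\<Sum>k\<in>I. A i k * E (n + 2) k j)
        + (\<Sum>k\<in>I. B i k * E (n + 2) k j) =
      (x n + 2) * (x n + 1) * x n * E n i j + 3 * (x n + 2) * (\<Sum>k\<in>J. E n i k * A' k j)
        + (\<Sum>k\<in>J. E n i k * B' k j) + (4 * x n + \<kappa>) * T i j"
  shows "\<exists>K. \<forall>\<^sub>F n in sequentially.
    cmod (x n) * nrm I J (\<lambda>i j. x n * E (n + 2) i j - T i j) \<le> K * (nrm I J (\<lambda>i j. x n * E (n + 2) i j) + nrm I J T)"
proof -
  define M where "M n = nrm I J (E n)" for n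
  define t where "t = nrm I J T"
  define a where "a = nrm I I A + nrm J J A' + nrm I I B + nrm J J B' + cmod \<kappa> + 1"
  have a1: "a \<ge> 1" "nrm I I A \<le> a" "nrm J J A' \<le> a" "nrm I I B \<le> a" "nrm J J B' \<le> a" "cmod \<kappa> \<le> a"
    by (auto simp: a_def add_nonneg_nonneg add_increasing2)
  define LA where "LA n i j = (\<Sum>k\<in>I. A i k * E n k j)" for n i j
  define RA where "RA n i j = (\<Sum>k\<in>J. E n i k * A' k j)" for n i j
  define LB where "LB n i j = (\<Sum>k\<in>I. B i k * E n k j)" for n i j
  define RB where "RB n i j = (\<Sum>k\<in>J. E n i k * B' k j)" for n i j
  have nM: "0 \<le> M n" for n by (simp add: M_def)
  have nt: "0 \<le> t" by (simp add: t_def)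
  have bLA: "nrm I J (LA n) \<le> a * M n" for n
    unfolding LA_def M_def by (rule order_trans[OF nrm_left[OF fin]]) (simp add: a1 mult_right_mono)
  have bLB: "nrm I J (LB n) \<le> a * M n" for n
    unfolding LB_def M_def by (rule order_trans[OF nrm_left[OF fin]]) (simp add: a1 mult_right_mono)
  have bRA: "nrm I J (RA n) \<le> a * M n" for n
    unfolding RA_def M_def by (rule order_trans[OF nrm_right[OF fin]]) (simp add: a1 mult_right_mono mult.commute)
  have bRB: "nrm I J (RB n) \<le> a * M n" for n
    unfolding RB_def M_def by (rule order_trans[OF nrm_right[OF fin]]) (simp add: a1 mult_right_mono mult.commute)
  have e1': "(x n + 3) * (x n + 2) * E (n + 1) i j + LA (n + 1) i j = (x n + 1) * x n * E n i j + RA n i j + 3 * T i j"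
    if "i \<in> I" "j \<in> J" for n i j using e1[OF that] by (simp add: LA_def RA_def)
  have e2': "(x n + 4) * (x n + 3) * (x n + 2) * E (n + 2) i j + 3 * (x n + 4) * LA (n + 2) i j + LB (n + 2) i j
      = (x n + 2) * (x n + 1) * x n * E n i j + 3 * (x n + 2) * RA n i j + RB n i j + (4 * x n + \<kappa>) * T i j"
    if "i \<in> I" "j \<in> J" for n i j using e2[OF that] by (simp add: LA_def RA_def LB_def RB_def)
  have xS: "x (n + 1) = x n + 1" for n by (simp add: x_def)
  \<comment> \<open>for large \<open>n\<close> consecutive norms are comparable\<close>
  have x_large: "\<forall>\<^sub>F n in sequentially. R \<le> cmod (x n)" for R
  proof -
    have "R \<le> cmod (x n)" if "nat \<lceil>R + cmod \<mu>\<rceil> \<le> n" for n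
    proof -
      have "R + cmod \<mu> \<le> real n" using that by linarith
      moreover have "real n \<le> cmod (x n) + cmod \<mu>"
        using norm_triangle_ineq4[of "x n" \<mu>] by (simp add: x_def)
      ultimately show ?thesis by linarith
    qed
    then show ?thesis unfolding eventually_sequentially by blast
  qed
  \<comment> \<open>For \<open>r \<ge> 100 * a\<close> the products with \<open>A\<close> and
    \<open>A'\<close> contribute at most \<open>r^2 / 100\<close> times the norm of
    \<open>E\<close>, against leading coefficients of order \<open>r^2\<close>.\<close>
  define R where "R = 100 * a"
  have cmp: "M n \<le> 9 * M (n + 1) + 9 * t / (cmod (x n))\<^sup>2" if n: "R \<le> cmod (x n)" for n
  proof -
    define r where "r = cmod (x n)"
    have r: "r \<ge> 100 * a" "r \<ge> 100" using n a1(1) by (auto simp: r_def R_def)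
    have lo: "r / 2 \<le> cmod (x n + 1)" and up: "cmod (x n + 3) \<le> 2 * r" "cmod (x n + 2) \<le> 2 * r"
      using norm_triangle_ineq4[of "x n + 1" 1] norm_triangle_ineq[of "x n" 3] norm_triangle_ineq[of "x n" 2] r
      by (auto simp: r_def[symmetric])
    have "nrm I J (\<lambda>i j. (x n + 1) * x n * E n i j) =
        nrm I J (\<lambda>i j. ((x n + 3) * (x n + 2) * E (n + 1) i j + LA (n + 1) i j) - (RA n i j + 3 * T i j))"
      by (rule nrm_cong) (use e1' in \<open>simp add: algebra_simps\<close>)
    also have "\<dots> \<le> (nrm I J (\<lambda>i j. (x n + 3) * (x n + 2) * E (n + 1) i j) + nrm I J (LA (n + 1)))
        + (nrm I J (RA n) + nrm I J (\<lambda>i j. 3 * T i j))"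
      by (intro order_trans[OF nrm_diff] add_mono nrm_add)
    also have "\<dots> \<le> (cmod (x n + 3) * cmod (x n + 2) * M (n + 1) + a * M (n + 1)) + (a * M n + 3 * t)"
      using bLA[of "n + 1"] bRA[of n] by (simp add: nrm_scale norm_mult M_def t_def)
    also have "\<dots> \<le> ((2 * r) * (2 * r) * M (n + 1) + a * M (n + 1)) + (a * M n + 3 * t)"
      by (intro add_mono mult_mono up order_refl mult_nonneg_nonneg) (use nM r in auto)
    finally have "cmod (x n + 1) * r * M n \<le> 4 * r\<^sup>2 * M (n + 1) + a * M (n + 1) + a * M n + 3 * t"
      by (simp add: nrm_scale norm_mult M_def r_def power2_eq_square)
    moreover have "(r / 2) * r * M n \<le> cmod (x n + 1) * r * M n"
      by (intro mult_right_mono lo) (use nM r in auto)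
    moreover have "a * M n \<le> r\<^sup>2 / 100 * M n" "a * M (n + 1) \<le> r\<^sup>2 / 100 * M (n + 1)"
    proof -
      have "a * 1 \<le> (r / 100) * r" using r a1 by (intro mult_mono) auto
      then have "a \<le> r\<^sup>2 / 100" by (simp add: power2_eq_square)
      then show "a * M n \<le> r\<^sup>2 / 100 * M n" "a * M (n + 1) \<le> r\<^sup>2 / 100 * M (n + 1)"
        by (rule mult_right_mono[OF _ nM])+
    qed
    ultimately have "r\<^sup>2 * (M n * 49 / 100) \<le> r\<^sup>2 * (M (n + 1) * 401 / 100) + 3 * t"
      by (simp add: power2_eq_square algebra_simps)
    also have "\<dots> \<le> r\<^sup>2 * (M (n + 1) * 49 / 100 * 8 + M (n + 1) * 9 / 100 + 49 / 100 * 8 * t / r\<^sup>2)"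
      using nt r by (simp add: field_simps)
    finally have "M n * 49 / 100 \<le> M (n + 1) * 49 / 100 * 8 + M (n + 1) * 9 / 100 + 49 / 100 * 8 * t / r\<^sup>2"
      using r by (simp add: mult_le_cancel_left)
    moreover have "0 \<le> t / r\<^sup>2" using nt by simp
    ultimately show ?thesis using nM[of "n + 1"] unfolding r_def[symmetric] by simp
  qed
  \<comment> \<open>Half of the factor \<open>7000 * a\<close> in the last estimate, whose left side
    carries \<open>2 * r\<close>.\<close>
  define K where "K = 3500 * a"
  have "cmod (x n) * nrm I J (\<lambda>i j. x n * E (n + 2) i j - T i j) \<le> K * (nrm I J (\<lambda>i j. x n * E (n + 2) i j) + nrm I J T)"
    if n: "2 * R \<le> cmod (x n)" for n
  proof -
    let ?x = "x n"
    define r where "r = cmod (x n)"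
    have r: "r \<ge> 200 * a" "r \<ge> 200" using n a1(1) by (auto simp: r_def R_def)
    have up: "cmod (?x + 4) \<le> 2 * r" "cmod (?x + 3) \<le> 2 * r" "cmod (?x + 2) \<le> 2 * r" "cmod (?x + 1) \<le> 2 * r"
      using norm_triangle_ineq[of ?x 4] norm_triangle_ineq[of ?x 3] norm_triangle_ineq[of ?x 2]
        norm_triangle_ineq[of ?x 1] r by (auto simp: r_def[symmetric])
    have r1: "r / 2 \<le> cmod (x (n + 1))" using norm_triangle_ineq4[of "?x + 1" 1] r unfolding xS by (simp add: r_def[symmetric])
    \<comment> \<open>The threshold \<open>2 * R\<close> lets \<open>cmp\<close> be applied both at
      \<open>n\<close> and at \<open>n + 1\<close>, as the modulus of \<open>x (n + 1)\<close> is at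
      least \<open>r / 2\<close>.\<close>
    have R1: "R \<le> cmod (x n)" "R \<le> cmod (x (n + 1))" using r r1 unfolding R_def r_def[symmetric] by linarith+
    have "t / (cmod (x (n + 1)))\<^sup>2 \<le> t / (r / 2)\<^sup>2"
      using r1 r nt by (intro divide_left_mono power_mono mult_pos_pos zero_less_power) auto
    then have m1: "M (n + 1) \<le> 9 * M (n + 2) + 36 * t / r\<^sup>2"
      using cmp[OF R1(2)] by (simp add: power_divide)
    \<comment> \<open>\<open>cmp\<close> is used twice, whence \<open>81 = 9 * 9\<close> and
      \<open>333 = 9 * 36 + 9\<close>.\<close>
    have m0: "M n \<le> 81 * M (n + 2) + 333 * t / r\<^sup>2"
      using cmp[OF R1(1)] m1 by (simp add: r_def[symmetric])
    define Z where "Z = M (n + 2) + t / r\<^sup>2"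
    have Z: "M (n + 2) \<le> Z" "M (n + 1) \<le> 36 * Z" "M n \<le> 333 * Z" "0 \<le> Z"
      using m0 m1 nM[of "n + 2"] nt by (auto simp: Z_def add_nonneg_nonneg)
    define V1 where "V1 i j = (3 * (?x + 4)) * LA (n + 2) i j + LB (n + 2) i j - ((3 * (?x + 2)) * RA n i j + RB n i j)" for i j
    define V2 where "V2 i j = LA (n + 2) i j - RA (n + 1) i j" for i j
    define V3 where "V3 i j = LA (n + 1) i j - RA n i j" for i j
    define V4 where "V4 i j = (?x * (\<kappa> - 20) + \<kappa> - 24) * T i j + (18 * ?x\<^sup>2 + 52 * ?x + 48) * E (n + 2) i j" for i j
    define W where "W i j = ((?x + 1) * V1 i j - ((?x + 2) * (?x + 3)) * V2 i j) - (((?x + 1) * (?x + 2)) * V3 i j + V4 i j)" for i j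
    have key: "2 * ?x\<^sup>2 * (?x * E (n + 2) i j - T i j) = W i j" if "i \<in> I" "j \<in> J" for i j
      unfolding W_def V1_def V2_def V3_def V4_def
      by (rule two_step_elimination[OF e1'[OF that, of n] _ e2'[OF that, of n], of "RA (n + 1) i j"])
         (use e1'[OF that, of "n + 1"] in \<open>simp add: xS[simplified] add.assoc\<close>)
    have ra: "r * a \<ge> a" "r * a \<ge> 0" "r\<^sup>2 * a \<ge> r * a" using r a1 by (auto simp: power2_eq_square)
    have b1: "nrm I J V1 \<le> 7 * (r * a) * (M (n + 2) + M n)"
    proof -
      have "nrm I J V1 \<le> (nrm I J (\<lambda>i j. (3 * (?x + 4)) * LA (n + 2) i j) + nrm I J (LB (n + 2)))
          + (nrm I J (\<lambda>i j. (3 * (?x + 2)) * RA n i j) + nrm I J (RB n))"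
        unfolding V1_def by (intro order_trans[OF nrm_diff] add_mono nrm_add)
      also have "\<dots> \<le> ((3 * (2 * r)) * (a * M (n + 2)) + a * M (n + 2)) + ((3 * (2 * r)) * (a * M n) + a * M n)"
        unfolding nrm_scale norm_mult using up r by (intro add_mono mult_mono bLA bLB bRA bRB) auto
      also have "\<dots> \<le> 7 * (r * a) * (M (n + 2) + M n)"
        using mult_right_mono[OF ra(1) nM[of n]] mult_right_mono[OF ra(1) nM[of "n + 2"]]
        by (simp add: algebra_simps)
      finally show ?thesis .
    qed
    have b2: "nrm I J V2 \<le> a * M (n + 2) + a * M (n + 1)" "nrm I J V3 \<le> a * M (n + 1) + a * M n"
      unfolding V2_def V3_def by (intro order_trans[OF nrm_diff] add_mono bLA bRA)+
    have b4: "nrm I J V4 \<le> 46 * (r * a) * t + 20 * r\<^sup>2 * M (n + 2)"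
    proof -
      have "cmod (?x * (\<kappa> - 20) + \<kappa> - 24) \<le> r * (a + 20) + (a + 24)"
      proof -
        have "cmod (\<kappa> - 20) \<le> a + 20" "cmod (\<kappa> - 24) \<le> a + 24"
          using norm_triangle_ineq4[of \<kappa> 24] norm_triangle_ineq4[of \<kappa> 20] a1(6) by auto
        moreover from this(1) have "r * cmod (\<kappa> - 20) \<le> r * (a + 20)"
          using r by (intro mult_left_mono) auto
        ultimately show ?thesis
          using norm_triangle_ineq[of "?x * (\<kappa> - 20)" "\<kappa> - 24"]
          by (simp only: norm_mult r_def[symmetric] add_diff_eq)
      qed
      also have "\<dots> \<le> 46 * (r * a)"
      proof -
        have "r \<le> r * a" "1 \<le> r * a" using r a1(1) mult_mono[of 1 r 1 a] by (auto simp: mult_le_cancel_left1)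
        then show ?thesis using ra(1) by (simp add: algebra_simps)
      qed
      finally have c1: "cmod (?x * (\<kappa> - 20) + \<kappa> - 24) \<le> 46 * (r * a)" .
      have "cmod (18 * ?x\<^sup>2 + 52 * ?x + 48) \<le> 18 * r\<^sup>2 + 52 * r + 48"
        by (rule order_trans[OF norm_triangle_ineq] add_mono norm_triangle_ineq[THEN order_trans])+
           (simp_all add: norm_mult norm_power r_def[symmetric])
      also have "\<dots> \<le> 20 * r\<^sup>2"
      proof -
        have "52 * r \<le> r * r" "48 \<le> r * r" using r mult_mono[of 52 r r r] mult_mono[of 48 r 1 r] by auto
        then show ?thesis by (simp add: power2_eq_square)
      qed
      finally have c2: "cmod (18 * ?x\<^sup>2 + 52 * ?x + 48) \<le> 20 * r\<^sup>2" .
      show ?thesis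
        unfolding V4_def
        by (rule order_trans[OF nrm_add])
           (auto simp: nrm_scale t_def[symmetric] M_def[symmetric] intro!: add_mono mult_right_mono c1 c2 nM nt)
    qed
    have "2 * r\<^sup>2 * nrm I J (\<lambda>i j. ?x * E (n + 2) i j - T i j) = nrm I J W"
    proof -
      have "nrm I J (\<lambda>i j. 2 * ?x\<^sup>2 * (?x * E (n + 2) i j - T i j)) = nrm I J W"
        by (rule nrm_cong) (rule key)
      then show ?thesis
        using nrm_scale[of I J "2 * ?x\<^sup>2" "\<lambda>i j. ?x * E (n + 2) i j - T i j"]
        by (simp add: norm_mult norm_power r_def[symmetric])
    qed
    also have "\<dots> \<le> (cmod (?x + 1) * nrm I J V1 + cmod ((?x + 2) * (?x + 3)) * nrm I J V2)
        + (cmod ((?x + 1) * (?x + 2)) * nrm I J V3 + nrm I J V4)"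
      unfolding W_def nrm_scale[symmetric] by (intro order_trans[OF nrm_diff] add_mono nrm_add nrm_diff) auto
    also have "\<dots> \<le> ((2 * r) * (7 * (r * a) * (M (n + 2) + M n)) + ((2 * r) * (2 * r)) * (a * M (n + 2) + a * M (n + 1)))
        + (((2 * r) * (2 * r)) * (a * M (n + 1) + a * M n) + (46 * (r * a) * t + 20 * r\<^sup>2 * M (n + 2)))"
      unfolding norm_mult using r a1 nM
      by (intro add_mono mult_mono up b1 b2 b4) auto
    also have "\<dots> = r\<^sup>2 * a * (18 * M (n + 2) + 18 * M n + 8 * M (n + 1)) + 20 * r\<^sup>2 * M (n + 2) + 46 * (r * a) * t"
      by (simp add: power2_eq_square algebra_simps)
    also have "\<dots> \<le> r\<^sup>2 * a * (6300 * Z) + 20 * (r\<^sup>2 * a) * Z + 46 * (r * a) * t"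
    proof -
      have "r\<^sup>2 * M (n + 2) \<le> (r\<^sup>2 * a) * Z" using Z a1(1) r nM[of "n + 2"] by (intro mult_mono) (auto simp: mult_le_cancel_left1)
      moreover have "r\<^sup>2 * a * (18 * M (n + 2) + 18 * M n + 8 * M (n + 1)) \<le> r\<^sup>2 * a * (6300 * Z)"
        using Z a1(1) by (intro mult_left_mono) auto
      ultimately show ?thesis by (simp add: algebra_simps)
    qed
    also have "\<dots> = a * (6320 * (r\<^sup>2 * M (n + 2) + t) + 46 * r * t)"
      using r by (simp add: Z_def field_simps)
    also have "\<dots> \<le> a * (7000 * r * (r * M (n + 2) + t))"
    proof -
      have "6320 * t \<le> 200 * r * t" using r nt by (intro mult_right_mono) auto
      moreover have "0 \<le> r\<^sup>2 * M (n + 2)" "0 \<le> r * t" using nM nt r by auto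
      ultimately have "6320 * (r\<^sup>2 * M (n + 2) + t) + 46 * r * t \<le> 7000 * r * (r * M (n + 2) + t)"
        by (simp add: power2_eq_square algebra_simps)
      then show ?thesis using a1(1) by (intro mult_left_mono) auto
    qed
    finally have "(2 * r) * (r * nrm I J (\<lambda>i j. ?x * E (n + 2) i j - T i j)) \<le> (2 * r) * (K * (r * M (n + 2) + t))"
      by (simp add: K_def power2_eq_square algebra_simps)
    then have "r * nrm I J (\<lambda>i j. ?x * E (n + 2) i j - T i j) \<le> K * (r * M (n + 2) + t)"
      using r by (simp only: mult_le_cancel_left_pos)
    then show ?thesis by (simp add: nrm_scale M_def t_def r_def)
  qed
  then show ?thesis
    by (intro exI[of _ K], rule eventually_mono[OF x_large[of "2 * R"]])
qed

lemma eventually_norm_shift_gt: "\<forall>\<^sub>F n in sequentially. (R::real) < cmod (\<mu> + of_nat n)"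
proof (rule eventually_sequentiallyI)
  fix n assume "nat \<lceil>R + cmod \<mu> + 1\<rceil> \<le> n"
  then have "R + cmod \<mu> + 1 \<le> real n" by linarith
  moreover have "real n \<le> cmod (\<mu> + of_nat n) + cmod \<mu>"
    using norm_triangle_ineq4[of "\<mu> + of_nat n" \<mu>] by simp
  ultimately show "R < cmod (\<mu> + of_nat n)" by linarith
qed

lemma inverse_shift_tendsto: "(\<lambda>n. 1 / (\<mu> + of_nat n :: complex)) \<longlonglongrightarrow> 0"
proof (rule tendstoI)
  fix e :: real assume e: "e > 0"
  show "\<forall>\<^sub>F n in sequentially. dist (1 / (\<mu> + of_nat n)) 0 < e"
    using eventually_norm_shift_gt[of "1 / e" \<mu>]
  proof eventually_elim
    case (elim n)
    have "0 < 1 / e" using e by simp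
    then have "0 < cmod (\<mu> + of_nat n)" using elim by linarith
    then have "1 / cmod (\<mu> + of_nat n) < e" using elim e by (simp add: field_simps)
    then show ?case by (simp add: norm_divide)
  qed
qed

text \<open>Once the modulus of \<open>\<mu> + of_nat n\<close> exceeds twice that of
  \<open>K\<close>, the term with \<open>D n\<close> on the right is absorbed in half of the left
  side, which leaves a bound for \<open>D n\<close> of order 1 / n.\<close>

lemma growing_factor_decay:
  fixes D :: "nat \<Rightarrow> real"
  assumes K: "\<forall>\<^sub>F n in sequentially. cmod (\<mu> + of_nat n) * D n \<le> \<bar>K\<bar> * (D n + t)" and D: "\<And>n. 0 \<le> D n"
  shows "D \<longlonglongrightarrow> 0"
proof -
  have "(\<lambda>n. (2 * \<bar>K\<bar> * t) * cmod (1 / (\<mu> + of_nat n))) \<longlonglongrightarrow> (2 * \<bar>K\<bar> * t) * cmod 0"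
    by (intro tendsto_mult tendsto_norm tendsto_const inverse_shift_tendsto)
  then have "(\<lambda>n. (2 * \<bar>K\<bar> * t) * cmod (1 / (\<mu> + of_nat n))) \<longlonglongrightarrow> 0" by simp
  then show ?thesis
  proof (rule tendsto_0_le[where K = 1])
    show "\<forall>\<^sub>F n in sequentially. norm (D n) \<le> norm ((2 * \<bar>K\<bar> * t) * cmod (1 / (\<mu> + of_nat n))) * 1"
      using K eventually_norm_shift_gt[of "2 * \<bar>K\<bar>" \<mu>]
    proof eventually_elim
      case (elim n)
      define r where "r = cmod (\<mu> + of_nat n)"
      have r: "r * D n \<le> \<bar>K\<bar> * D n + \<bar>K\<bar> * t" "2 * \<bar>K\<bar> < r" using elim by (simp_all add: r_def distrib_left)
      have "(2 * \<bar>K\<bar>) * D n \<le> r * D n" using r(2) D by (intro mult_right_mono) auto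
      then have "r * D n \<le> 2 * \<bar>K\<bar> * t" using r(1) by linarith
      moreover have "0 < r" using r(2) by linarith
      ultimately have "D n \<le> (2 * \<bar>K\<bar> * t) / r" by (simp add: pos_le_divide_eq mult.commute)
      then have "D n \<le> \<bar>(2 * \<bar>K\<bar> * t) / r\<bar>" by linarith
      then show ?case using D by (simp add: norm_divide r_def)
    qed
  qed
qed

section \<open>Representations of \<open>sl\<^sub>2\<close>\<close>

context complex_vector_space
begin

text \<open>Vectors killed by \<open>E\<close> at different weights have different Casimir
  eigenvalues, apart from one symmetry. Powers of \<open>F\<close> bring them into a single weight
  space, where they are independent; so at most \<open>N\<close> weights can occur on either
  side.\<close>

lemma sl2_finite_kernel:
  fixes X :: "int \<Rightarrow> 'v set" and \<mu> :: complex
  assumes E: "lin E" and F: "lin F" and X: "\<And>m. fdim N (X m)"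
    and FX: "\<And>m v. v \<in> X m \<Longrightarrow> F v \<in> X (m - 1)"
    and comm: "\<And>m v. v \<in> X m \<Longrightarrow> E (F v) - F (E v) = (- 2 * (\<mu> + of_int m)) *s v"
  shows "\<exists>M. \<forall>m v. \<bar>m\<bar> \<ge> M \<longrightarrow> v \<in> X m \<longrightarrow> E v = 0 \<longrightarrow> v = 0"
proof -
  define x where "x m = \<mu> + of_int m" for m
  define c where "c m = - (x m * (x m + 1))" for m
  have xm: "x (m + k) = x m + of_int k" "x (m - k) = x m - of_int k" for m k by (simp_all add: x_def)
  \<comment> \<open>the Casimir eigenvalue of a vector killed by \<open>E\<close> persists along its \<open>F\<close>-orbit\<close>
  have casimir: "(F ^^ j) v \<in> X (m - int j) \<and>
      E (F ((F ^^ j) v)) = (c m + x (m - int j) * (x (m - int j) - 1)) *s (F ^^ j) v"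
    if v: "v \<in> X m" "E v = 0" for m v j
  proof (induction j)
    case 0
    have "E (F v) = (- 2 * x m) *s v" using comm[OF v(1)] v(2) lin_0[OF F] by (simp add: x_def)
    moreover have "c m + x m * (x m - 1) = - 2 * x m" by (simp add: c_def algebra_simps)
    ultimately show ?case using v by simp
  next
    case (Suc j)
    let ?w = "(F ^^ j) v"
    have w: "F ?w \<in> X (m - int j - 1)" using FX Suc by blast
    have "E (F (F ?w)) = F (E (F ?w)) + (- 2 * x (m - int j - 1)) *s F ?w"
      using comm[OF w] by (simp add: x_def algebra_simps)
    also have "\<dots> = (c m + x (m - int j) * (x (m - int j) - 1) - 2 * x (m - int j - 1)) *s F ?w"
      using Suc by (simp add: lin_simps[OF F] scale_left_diff_distrib scale_left_distrib)
    also have "c m + x (m - int j) * (x (m - int j) - 1) - 2 * x (m - int j - 1) =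
        c m + x (m - int (Suc j)) * (x (m - int (Suc j)) - 1)"
      by (simp add: xm algebra_simps)
    finally show ?case using w by (simp add: algebra_simps)
  qed
  have factor: "c m + x (m - int j) * (x (m - int j) - 1) = (- of_nat j - 1) * (2 * x m - of_nat j)" for m j
    by (simp add: c_def xm algebra_simps)
  have orbit: "(F ^^ k) v \<noteq> 0"
    if v: "v \<in> X m" "E v = 0" "v \<noteq> 0" and k: "\<And>j. j < k \<Longrightarrow> 2 * x m \<noteq> of_nat j" for m v k
    using k
  proof (induction k)
    case (Suc j)
    then have n: "(F ^^ j) v \<noteq> 0" by simp
    have "- of_nat j - 1 = - (of_nat (Suc j) :: complex)" by simp
    also have "\<dots> \<noteq> 0" by (simp only: neg_equal_0_iff_equal of_nat_eq_0_iff)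
    finally have "(- of_nat j - 1) * (2 * x m - of_nat j) \<noteq> (0::complex)"
      using Suc.prems[of j] by (simp only: mult_eq_0_iff right_minus_eq) simp
    then have "E (F ((F ^^ j) v)) \<noteq> 0"
      using casimir[OF v(1,2), of j] n factor[of m j] by simp
    then show ?case using lin_0[OF E] by auto
  qed (use v in simp)
  have eigen: "(\<lambda>w. E (F w) - (x l * (x l - 1)) *s w) ((F ^^ nat (m - l)) v) = c m *s (F ^^ nat (m - l)) v"
    "(F ^^ nat (m - l)) v \<in> X l"
    if "v \<in> X m" "E v = 0" "l \<le> m" for m l v
    using casimir[OF that(1,2), of "nat (m - l)"] that(3) by (auto simp: algebra_simps)
  define S where "S = {m. \<exists>v\<in>X m. v \<noteq> 0 \<and> E v = 0}"
  \<comment> \<open>\<open>c\<close> takes equal values at \<open>x\<close> and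
    \<open>- 1 - x\<close>, so it is injective on each side of real part - 1/2. For \<open>F\<close>
    not to kill the vector on its way down to \<open>l\<close>, no \<open>2 * x m\<close> may be a
    natural number below \<open>m - l\<close>; on the positive side this is ensured by
    \<open>Re (x l) > 0\<close>. The strip left out contains finitely many weights.\<close>
  have bound: "card T \<le> N"
    if T: "finite T" "T \<subseteq> S"
      and pos: "(\<forall>m\<in>T. Re (x m) > 0) \<or> (\<forall>m\<in>T. Re (x m) < -1/2)" for T
  proof (cases "T = {}")
    case False
    define l where "l = Min T"
    have l: "l \<in> T" "\<And>m. m \<in> T \<Longrightarrow> l \<le> m" using T False by (auto simp: l_def)
    have "\<forall>m\<in>T. \<exists>v. v \<in> X m \<and> v \<noteq> 0 \<and> E v = 0" using T(2) unfolding S_def by blast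
    from bchoice[OF this] obtain v where v: "\<And>m. m \<in> T \<Longrightarrow> v m \<in> X m \<and> v m \<noteq> 0 \<and> E (v m) = 0" by blast
    have inj: "inj_on c T"
    proof (rule inj_onI)
      fix m m' assume m: "m \<in> T" "m' \<in> T" "c m = c m'"
      then have "(x m - x m') * (x m + x m' + 1) = 0" by (simp add: c_def algebra_simps)
      moreover have "x m + x m' + 1 \<noteq> 0"
      proof
        assume "x m + x m' + 1 = 0"
        from arg_cong[OF this, of Re] have "Re (x m) + Re (x m') + 1 = 0" by simp
        moreover have "(Re (x m) > 0 \<and> Re (x m') > 0) \<or> (Re (x m) < -1/2 \<and> Re (x m') < -1/2)"
          using pos m by blast
        ultimately show False by linarith
      qed
      ultimately show "m = m'" by (auto simp: x_def)
    qed
    define u where "u = (\<lambda>\<alpha>. (F ^^ nat (the_inv_into T c \<alpha> - l)) (v (the_inv_into T c \<alpha>)))"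
    have nz: "(F ^^ nat (m - l)) (v m) \<noteq> 0" if m: "m \<in> T" for m
    proof (rule orbit)
      fix j assume j: "j < nat (m - l)"
      show "2 * x m \<noteq> of_nat j"
      proof
        assume eq: "2 * x m = of_nat j"
        from arg_cong[OF this, of Re] have r: "2 * Re (x m) = real j" by simp
        have "Re (x l) = Re (x m) - real_of_int (m - l)" by (simp add: x_def)
        moreover have "real j < real_of_int (m - l)" using j by linarith
        ultimately have "Re (x l) < - Re (x m)" using r by linarith
        moreover have "(Re (x m) > 0 \<and> Re (x l) > 0) \<or> (Re (x m) < -1/2 \<and> Re (x l) < -1/2)"
          using pos m l(1) by blast
        ultimately show False using r by linarith
      qed
    qed (use v m in auto)
    have ti: "the_inv_into T c (c m) = m" if "m \<in> T" for m
      using the_inv_into_f_f[OF inj that] .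
    have u: "u (c m) \<noteq> 0" "u (c m) \<in> X l"
        "E (F (u (c m))) - (x l * (x l - 1)) *s u (c m) = c m *s u (c m)" if m: "m \<in> T" for m
    proof -
      have w: "u (c m) = (F ^^ nat (m - l)) (v m)" by (simp only: u_def ti[OF m])
      have vm: "v m \<in> X m" "E (v m) = 0" "l \<le> m" using v[OF m] l(2)[OF m] by auto
      show "u (c m) \<noteq> 0" unfolding w by (rule nz[OF m])
      show "u (c m) \<in> X l" unfolding w by (rule eigen(2)[OF vm])
      show "E (F (u (c m))) - (x l * (x l - 1)) *s u (c m) = c m *s u (c m)"
        unfolding w by (rule eigen(1)[OF vm])
    qed
    have "card (c ` T) \<le> N"
    proof (rule eigen_bound[OF X[of l]])
      show "finite (c ` T)" using T(1) by simp
      show "lin (\<lambda>w. E (F w) - (x l * (x l - 1)) *s w)" by (intro lin_minus' lin_comp'[OF E F] lin_smult lin_id)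
    next
      fix \<alpha> assume "\<alpha> \<in> c ` T"
      then obtain m where m: "m \<in> T" "\<alpha> = c m" by blast
      show "u \<alpha> \<in> X l" "u \<alpha> \<noteq> 0" "E (F (u \<alpha>)) - (x l * (x l - 1)) *s u \<alpha> = \<alpha> *s u \<alpha>"
        unfolding m(2) by (rule u[OF m(1)])+
    qed
    then show ?thesis using card_image[OF inj] by simp
  qed simp
  have fin: "finite {m\<in>S. P (Re (x m))}"
    if "P = (\<lambda>r. r > 0) \<or> P = (\<lambda>r. r < -1/2)" for P
  proof (rule ccontr)
    assume "infinite {m\<in>S. P (Re (x m))}"
    then obtain T where "T \<subseteq> {m\<in>S. P (Re (x m))}" "finite T" "card T = Suc N"
      using infinite_arbitrarily_large by blast
    then show False using bound[of T] that by fastforce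
  qed
  have "S \<subseteq> {m\<in>S. Re (x m) > 0} \<union> {m\<in>S. Re (x m) < -1/2} \<union> {- \<lceil>Re \<mu>\<rceil> - 1 .. - \<lfloor>Re \<mu>\<rfloor>}"
  proof
    fix m assume "m \<in> S"
    moreover have "m \<le> - \<lfloor>Re \<mu>\<rfloor>" if "Re (x m) \<le> 0"
      using that unfolding x_def by simp linarith
    moreover have "- \<lceil>Re \<mu>\<rceil> - 1 \<le> m" if "Re (x m) \<ge> - 1 / 2"
      using that unfolding x_def by simp linarith
    ultimately show "m \<in> {m\<in>S. Re (x m) > 0} \<union> {m\<in>S. Re (x m) < -1/2} \<union> {- \<lceil>Re \<mu>\<rceil> - 1 .. - \<lfloor>Re \<mu>\<rfloor>}"
      by fastforce
  qed
  then have "finite S"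
    by (rule finite_subset) (intro finite_UnI fin[of "\<lambda>r. r > 0"] fin[of "\<lambda>r. r < -1/2"] finite_atLeastAtMost_int disjI1 disjI2 refl)
  define M where "M = Max (insert 0 (abs ` S)) + 1"
  have "\<bar>m\<bar> < M" if "m \<in> S" for m
    using Max_ge[of "insert 0 (abs ` S)" "\<bar>m\<bar>"] that \<open>finite S\<close> by (simp add: M_def)
  then have "\<forall>m v. \<bar>m\<bar> \<ge> M \<longrightarrow> v \<in> X m \<longrightarrow> E v = 0 \<longrightarrow> v = 0"
    unfolding S_def by (auto simp: linorder_not_less[symmetric])
  then show ?thesis by blast
qed

text \<open>Exchanging \<open>E\<close> and \<open>F\<close> and negating the weights shows that
  \<open>F\<close> too is injective far out. So \<open>E\<close> after \<open>F\<close> is an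
  injective, hence surjective, endomorphism of the finite-dimensional \<open>X (m + 1)\<close>, and
  \<open>E\<close> maps \<open>X m\<close> onto it. \<open>M2 + 1\<close> appears because
  \<open>F\<close> is used at \<open>m + 1\<close>.\<close>

lemma sl2_bijective:
  fixes X :: "int \<Rightarrow> 'v set" and \<mu> :: complex
  assumes E: "lin E" and F: "lin F" and X: "\<And>m. fdim N (X m)"
    and EX: "\<And>m v. v \<in> X m \<Longrightarrow> E v \<in> X (m + 1)" and FX: "\<And>m v. v \<in> X m \<Longrightarrow> F v \<in> X (m - 1)"
    and comm: "\<And>m v. v \<in> X m \<Longrightarrow> E (F v) - F (E v) = (- 2 * (\<mu> + of_int m)) *s v"
  shows "\<exists>M. \<forall>m. \<bar>m\<bar> \<ge> M \<longrightarrow> bij_betw E (X m) (X (m + 1))"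
proof -
  obtain M1 where M1: "\<And>m v. \<bar>m\<bar> \<ge> M1 \<Longrightarrow> v \<in> X m \<Longrightarrow> E v = 0 \<Longrightarrow> v = 0"
    using sl2_finite_kernel[where X = X and E = E and F = F and \<mu> = \<mu>, OF E F X FX comm] by blast
  have "\<exists>M. \<forall>m v. \<bar>m\<bar> \<ge> M \<longrightarrow> v \<in> X (- m) \<longrightarrow> F v = 0 \<longrightarrow> v = 0"
  proof (rule sl2_finite_kernel[OF F E, where \<mu> = "- \<mu>" and X = "\<lambda>m. X (- m)"])
    fix m v assume v: "v \<in> X (- m)"
    have "- (m - 1) = - m + 1" by simp
    then show "E v \<in> X (- (m - 1))" using EX[OF v] by (simp only:)
    have "F (E v) - E (F v) = - (E (F v) - F (E v))" by simp
    also have "\<dots> = (- 2 * (- \<mu> + of_int m)) *s v"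
      unfolding comm[OF v] scale_minus_left[symmetric] by (simp add: algebra_simps)
    finally show "F (E v) - E (F v) = (- 2 * (- \<mu> + of_int m)) *s v" .
  qed (rule X)
  then obtain M2 where M2: "\<And>m v. \<bar>m\<bar> \<ge> M2 \<Longrightarrow> v \<in> X (- m) \<Longrightarrow> F v = 0 \<Longrightarrow> v = 0" by blast
  have "bij_betw E (X m) (X (m + 1))" if m: "\<bar>m\<bar> \<ge> max M1 (M2 + 1)" for m
  proof -
    have inj: "inj_on E (X m)"
    proof (rule inj_onI)
      fix v w assume vw: "v \<in> X m" "w \<in> X m" "E v = E w"
      then have "v - w \<in> X m" "E (v - w) = 0"
        using fdim_subspace[OF X[of m]] by (simp_all add: subspace_diff lin_simps[OF E])
      then show "v = w" using M1[of m "v - w"] m by simp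
    qed
    have "(\<lambda>v. E (F v)) ` X (m + 1) = X (m + 1)"
    proof (rule inj_imp_surj_on[OF X])
      show "lin (\<lambda>v. E (F v))" by (rule lin_comp'[OF E F])
      show "(\<lambda>v. E (F v)) ` X (m + 1) \<subseteq> X (m + 1)" using FX[of _ "m + 1"] EX[of _ m] by auto
      fix w assume w: "w \<in> X (m + 1)" "E (F w) = 0"
      then have "F w = 0" using M1[of m "F w"] FX[OF w(1)] m by simp
      moreover have "M2 \<le> \<bar>- (m + 1)\<bar>" using m by linarith
      moreover have "w \<in> X (- (- (m + 1)))" using w(1) by (simp only: minus_minus)
      ultimately show "w = 0" using M2 by blast
    qed
    moreover have "F v \<in> X m" if "v \<in> X (m + 1)" for v using FX[OF that] by simp
    ultimately have "X (m + 1) \<subseteq> E ` X m" by blast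
    then have "E ` X m = X (m + 1)" using EX[of _ m] by blast
    then show ?thesis using inj by (simp add: bij_betw_def)
  qed
  then show ?thesis by blast
qed

end

section \<open>Reduction to an evaluation module\<close>

context complex_vector_space
begin

lemma derivation_power:
  assumes D: "lin D" and y: "lin y" and z: "lin z"
    and Dy: "\<And>v. D (y v) = y (D v) + z v" and zy: "\<And>v. z (y v) = y (z v)"
  shows "D ((y ^^ Suc a) v) = (y ^^ Suc a) (D v) + of_nat (Suc a) *s (y ^^ a) (z v)"
proof (induction a)
  case (Suc a)
  have c: "z ((y ^^ n) v) = (y ^^ n) (z v)" for n by (induction n) (simp_all add: zy)
  have "D ((y ^^ Suc (Suc a)) v) = y (D ((y ^^ Suc a) v)) + z ((y ^^ Suc a) v)" by (simp add: Dy)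
  also have "\<dots> = y ((y ^^ Suc a) (D v) + of_nat (Suc a) *s (y ^^ a) (z v)) + (y ^^ Suc a) (z v)"
    by (simp only: Suc c)
  also have "\<dots> = (y ^^ Suc (Suc a)) (D v) + (of_nat (Suc a) *s (y ^^ Suc a) (z v) + (y ^^ Suc a) (z v))"
    by (simp add: lin_simps[OF y])
  also have "of_nat (Suc a) *s (y ^^ Suc a) (z v) + (y ^^ Suc a) (z v) = of_nat (Suc (Suc a)) *s (y ^^ Suc a) (z v)"
    by (simp only: of_nat_Suc[of "Suc a"] scale_left_distrib scale_one add.commute)
  finally show ?case .
qed (simp add: Dy)

text \<open>The radical of a differential ideal in characteristic \<open>0\<close> is again differential.\<close>

lemma nilpotent_derivative:
  assumes D: "lin D" and y: "lin y" and z: "lin z" and w: "lin w"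
    and Dy: "\<And>v. D (y v) = y (D v) + z v" and Dz: "\<And>v. D (z v) = z (D v) + w v"
    and zy: "\<And>v. z (y v) = y (z v)" and wz: "\<And>v. w (z v) = z (w v)"
    and nil: "\<And>v. (y ^^ n) v = 0"
  shows "(z ^^ (2 * n)) v = 0"
proof -
  \<comment> \<open>One factor \<open>y\<close> is traded for two factors \<open>z\<close>.
    \<open>D\<close> is applied to a vanishing product that contains one more \<open>z\<close> than
    necessary, so that the terms in which \<open>D\<close> falls on the powers of \<open>z\<close>
    still vanish.\<close>
  have "i \<le> n \<Longrightarrow> (y ^^ (n - i)) ((z ^^ (2 * i)) v) = 0" for i v
  proof (induction i arbitrary: v)
    case (Suc i)
    obtain a where a: "n - i = Suc a" "n - Suc i = a" using Suc.prems by (cases "n - i") auto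
    define b where "b = 2 * i"
    have IH: "(y ^^ Suc a) ((z ^^ b) v) = 0" for v using Suc a b_def by simp
    have ly: "lin (y ^^ k)" for k by (rule lin_funpow[OF y])
    have "0 = D ((y ^^ Suc a) ((z ^^ b) (z v)))" using IH[of "z v"] lin_0[OF D] by simp
    also have "\<dots> = (y ^^ Suc a) (D ((z ^^ Suc b) v)) + of_nat (Suc a) *s (y ^^ a) (z ((z ^^ b) (z v)))"
      by (subst derivation_power[OF D y z Dy zy]) (simp add: funpow_swap1)
    also have "D ((z ^^ Suc b) v) = (z ^^ Suc b) (D v) + of_nat (Suc b) *s (z ^^ b) (w v)"
      by (rule derivation_power[OF D z w Dz wz])
    also have "(y ^^ Suc a) ((z ^^ Suc b) (D v) + of_nat (Suc b) *s (z ^^ b) (w v)) = 0"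
      unfolding lin_add[OF ly] lin_scale[OF ly] IH using IH[of "z (D v)"] by (simp add: funpow_swap1)
    finally have "of_nat (Suc a) *s (y ^^ a) (z ((z ^^ b) (z v))) = 0" by simp
    then have "(y ^^ a) (z ((z ^^ b) (z v))) = 0" by (simp only: scale_eq_0_iff of_nat_eq_0_iff) simp
    moreover have "(z ^^ (2 * Suc i)) v = z ((z ^^ b) (z v))" by (simp add: b_def funpow_swap1)
    ultimately show ?case unfolding a(2) by (simp only:)
  qed (simp add: nil)
  from this[of n v] show ?thesis by simp
qed

lemma nilpotent_kernel:
  fixes f :: "'v \<Rightarrow> 'v" and u :: 'v
  assumes "\<And>v. (f ^^ n) v = 0" "u \<noteq> 0"
  shows "\<exists>v. v \<noteq> 0 \<and> f v = (0::'v)"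
proof -
  have "\<exists>j. (f ^^ j) u \<noteq> 0 \<and> f ((f ^^ j) u) = 0"
  proof (rule ccontr)
    assume "\<nexists>j. (f ^^ j) u \<noteq> 0 \<and> f ((f ^^ j) u) = 0"
    then have "(f ^^ j) u \<noteq> 0" for j using assms(2) by (induction j) auto
    then show False using assms(1) by blast
  qed
  then show ?thesis by blast
qed

end

text \<open>Only polynomials in t are used here, so that degrees and roots are at hand. Negative
  powers of t are recovered later from an annihilating polynomial with nonzero constant
  term.\<close>

locale poly_vir = complex_vector_space scale
  for scale :: "complex \<Rightarrow> 'v::ab_group_add \<Rightarrow> 'v" (infixr "*s" 75) +
  fixes rho :: "int \<Rightarrow> complex poly \<Rightarrow> 'v \<Rightarrow> 'v" and zeta :: "complex poly \<Rightarrow> 'v \<Rightarrow> 'v"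
    and lam :: complex and N :: nat
  assumes lin_rho: "lin (rho k p)" and lin_zeta: "lin (zeta p)"
    and rho_add: "rho k (p + q) v = rho k p v + rho k q v"
    and rho_smult: "rho k (smult c p) v = c *s rho k p v"
    and zeta_add: "zeta (p + q) v = zeta p v + zeta q v"
    and zeta_smult: "zeta (smult c p) v = c *s zeta p v"
    and bracket: "rho k p (rho l q v) - rho l q (rho k p v) = of_int (l - k) *s rho (k + l) (p * q) v
      + (if k + l = 0 then (of_int (k ^ 3 - k) / 12) *s zeta (p * q) v else 0)"
    and zeta_comm: "zeta p (rho k q v) = rho k q (zeta p v)"
    and fdim_weight: "fdim N {v. rho 0 1 v = (lam + of_int n) *s v}"
    and span_weight: "span (\<Union>n. {v. rho 0 1 v = (lam + of_int n) *s v}) = UNIV"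
begin

definition "V n = {v. rho 0 1 v = (lam + of_int n) *s v}"

lemmas fdim_V = fdim_weight[folded V_def]
lemmas span_V = span_weight[folded V_def]

definition "null p \<longleftrightarrow> (\<forall>v. rho 1 p v = 0)"

lemma rho_weight: "v \<in> V n \<Longrightarrow> rho k p v \<in> V (n + k)"
proof -
  assume v: "v \<in> V n"
  have "rho 0 1 (rho k p v) = rho k p (rho 0 1 v) + of_int k *s rho k p v"
    using bracket[of 0 1 k p v] by (cases "k = 0") (simp_all add: algebra_simps)
  also have "\<dots> = (lam + of_int (n + k)) *s rho k p v"
    using v by (simp add: V_def lin_simps[OF lin_rho] algebra_simps)
  finally show ?thesis by (simp add: V_def)
qed

text \<open>The bracket of d_0 h and d_1 p gives multiples of \<open>p\<close> in degree 1; d_(k-1)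
  and d_1 p give (2 - k) d_k p, that is every degree except 2, which comes from d_3 and d_(-1). The
  central part is then isolated by d_2 and d_(-2).\<close>

lemma null_ideal:
  assumes "null p"
  shows "rho k (p * h) v = 0" "zeta (p * h) v = 0"
proof -
  have one: "rho 1 (p * h) v = 0" for v h
    using bracket[of 0 h 1 p v] assms lin_0[OF lin_rho] by (simp add: null_def mult.commute)
  have ne2: "rho k (p * h) v = 0" if "k \<noteq> 2" for k v h
  proof -
    have "of_int (2 - k) *s rho k (p * h) v = 0"
      using bracket[of "k - 1" 1 1 "p * h" v] one lin_0[OF lin_rho] by (auto split: if_splits)
    then show ?thesis using that by (simp add: scale_eq_0_iff flip: of_int_diff)
  qed
  have two: "rho 2 (p * h) v = 0" for v h
    using bracket[of 3 1 "- 1" "p * h" v] ne2 lin_0[OF lin_rho] by simp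
  show "rho k (p * h) v = 0" using ne2 two by (cases "k = 2") auto
  show "zeta (p * h) v = 0"
    using bracket[of 2 1 "- 2" "p * h" v] ne2 two lin_0[OF lin_rho] by simp
qed

lemma bij_large: "\<exists>M. \<forall>m. \<bar>m\<bar> \<ge> M \<longrightarrow> bij_betw (rho 1 1) (V m) (V (m + 1))"
proof (rule sl2_bijective[where E = "rho 1 1" and F = "rho (- 1) 1" and X = V and \<mu> = lam, OF lin_rho lin_rho fdim_V])
  fix m v assume v: "v \<in> V m"
  show "rho 1 1 v \<in> V (m + 1)" "rho (- 1) 1 v \<in> V (m - 1)" using rho_weight[OF v, of 1 1] rho_weight[OF v, of "- 1" 1] by simp_all
  show "rho 1 1 (rho (- 1) 1 v) - rho (- 1) 1 (rho 1 1 v) = (- 2 * (lam + of_int m)) *s v"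
  proof -
    have "rho 1 1 (rho (- 1) 1 v) - rho (- 1) 1 (rho 1 1 v) = (- 2) *s rho 0 1 v"
      using bracket[of 1 1 "- 1" 1 v] by simp
    also have "rho 0 1 v = (lam + of_int m) *s v" using v by (simp add: V_def)
    finally show ?thesis by (simp only: scale_scale)
  qed
qed

text \<open>On one weight space the matrix entries of \<open>rho 1 p\<close> are finitely many
  functionals of \<open>p\<close>, so some \<open>P n\<close> annihilates it. As
  \<open>rho 1 p\<close> commutes with \<open>rho 1 1\<close>, surjectivity of the latter carries
  \<open>P M\<close> to all higher weights and injectivity carries \<open>P (- M)\<close> to all
  lower ones; a finite product then serves for all weights.\<close>

lemma annihilator_exists: "\<exists>p. p \<noteq> 0 \<and> null p"
proof -
  have loc: "\<exists>p. p \<noteq> 0 \<and> (\<forall>h. \<forall>v\<in>V n. rho 1 (p * h) v = 0)" for n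
  proof -
    obtain B where B: "finite B" "independent B" "B \<subseteq> V n" "span B = V n" using fdim_basis[OF fdim_V] by metis
    obtain C where C: "finite C" "independent C" "span C = V (n + 1)" using fdim_basis[OF fdim_V] by metis
    have inC: "rho 1 p b \<in> span C" if "b \<in> B" for p b using rho_weight[of b n 1 p] that B(3) C(3) by auto
    have "\<exists>p. p \<noteq> 0 \<and> (\<forall>\<phi>\<in>(\<lambda>(b, c) p. representation C (rho 1 p b) c) ` (B \<times> C). \<phi> p = 0)"
      using B(1) C(1,2) inC
      by (intro common_kernel_poly) (auto simp: rho_add rho_smult representation_add representation_scale)
    then obtain p where p: "p \<noteq> 0" "\<And>b c. b \<in> B \<Longrightarrow> c \<in> C \<Longrightarrow> representation C (rho 1 p b) c = 0" by auto
    have "rho 1 p b = 0" if "b \<in> B" for b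
      using sum_representation_eq[OF C(2) inC[OF that, of p] C(1) subset_refl] p(2)[OF that] by simp
    then have z: "rho 1 p v = 0" if "v \<in> V n" for v
      using lin_eq_on_span[OF lin_rho lin_zero, of B 1 p v] that B(4) by simp
    have "rho 1 (p * h) v = 0" if v: "v \<in> V n" for h v
      using bracket[of 0 h 1 p v] z v rho_weight[OF v, of 0 h] lin_0[OF lin_rho] by (simp add: mult.commute)
    then show ?thesis using p(1) by blast
  qed
  then obtain P where P: "\<And>n. P n \<noteq> 0" "\<And>n h v. v \<in> V n \<Longrightarrow> rho 1 (P n * h) v = 0" by metis
  obtain M0 where M0: "\<And>m. \<bar>m\<bar> \<ge> M0 \<Longrightarrow> bij_betw (rho 1 1) (V m) (V (m + 1))" using bij_large by blast
  define M where "M = max M0 0"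
  have bij: "bij_betw (rho 1 1) (V m) (V (m + 1))" if "M \<le> \<bar>m\<bar>" for m using M0 that by (simp add: M_def)
  have comm: "rho 1 p (rho 1 1 v) = rho 1 1 (rho 1 p v)" for p v
    using bracket[of 1 p 1 1 v] by simp
  have up: "rho 1 (P M * h) v = 0" if "v \<in> V (M + int j)" for h v j
    using that
  proof (induction j arbitrary: v)
    case (Suc j)
    have "bij_betw (rho 1 1) (V (M + int j)) (V (M + int (Suc j)))"
      using bij[of "M + int j"] by (simp add: M_def algebra_simps)
    then obtain u where "u \<in> V (M + int j)" "v = rho 1 1 u"
      using Suc.prems by (auto simp: bij_betw_def)
    then show ?case using Suc.IH comm lin_0[OF lin_rho] by simp
  qed (use P(2) in simp)
  have down: "rho 1 (P (- M) * h) v = 0" if "v \<in> V (- M - int j)" for h v j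
    using that
  proof (induction j arbitrary: v)
    case (Suc j)
    let ?m = "- M - int (Suc j)"
    have m: "?m + 1 = - M - int j" by simp
    have b1: "inj_on (rho 1 1) (V (?m + 1))" if "j \<noteq> 0 \<or> M \<noteq> 0 \<or> True"
      using bij[of "?m + 1"] unfolding bij_betw_def by (simp add: M_def)
    have "rho 1 1 v \<in> V (- M - int j)" using rho_weight[OF Suc.prems, of 1 1] m by simp
    then have "rho 1 1 (rho 1 (P (- M) * h) v) = 0" using Suc.IH comm by metis
    moreover have "rho 1 (P (- M) * h) v \<in> V (?m + 1)" using rho_weight[OF Suc.prems] .
    ultimately show ?case
      using b1 inj_onD[of "rho 1 1" "V (?m + 1)" "rho 1 (P (- M) * h) v" 0] lin_0[OF lin_rho]
        subspace_0[OF fdim_subspace[OF fdim_V]] by simp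
  qed (use P(2) in simp)
  define Q where "Q = (\<Prod>n\<in>{- M .. M}. P n)"
  have Q: "rho 1 Q v = 0" if v: "v \<in> V n" for n v
  proof -
    define l where "l = (if n < - M then - M else if n > M then M else n)"
    have l: "l \<in> {- M .. M}" by (auto simp: l_def M_def)
    have "Q = P l * (\<Prod>n\<in>{- M .. M} - {l}. P n)" unfolding Q_def by (rule prod.remove[OF _ l]) simp
    moreover have "rho 1 (P l * h) v = 0" for h
      using up[of v "nat (n - M)" h] down[of v "nat (- M - n)" h] P(2)[OF v, of h] v by (auto simp: l_def)
    ultimately show ?thesis by simp
  qed
  have "null Q"
    unfolding null_def
  proof
    fix v show "rho 1 Q v = 0"
      using lin_eq_on_span[OF lin_rho lin_zero, of "\<Union>n. V n" 1 Q v] Q span_V by auto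
  qed
  moreover have "Q \<noteq> 0" using P(1) by (simp add: Q_def)
  ultimately show ?thesis by blast
qed

end

section \<open>Irreducible modules: excluding nilpotent and idempotent parts of the quotient by the
  annihilator\<close>

locale irreducible_poly_vir = poly_vir scale rho zeta lam N
  for scale :: "complex \<Rightarrow> 'v::ab_group_add \<Rightarrow> 'v" (infixr "*s" 75) and rho zeta lam N +
  assumes irred: "subspace W \<Longrightarrow> (\<And>k p w. w \<in> W \<Longrightarrow> rho k p w \<in> W) \<Longrightarrow> W = {0} \<or> W = UNIV"
    and nonzero: "\<exists>v :: 'v. v \<noteq> 0"
begin

lemma V_nonzero: "\<exists>n. \<exists>v\<in>V n. v \<noteq> 0"
proof (rule ccontr)
  assume "\<nexists>n. \<exists>v\<in>V n. v \<noteq> 0"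
  then have "(\<Union>n. V n) \<subseteq> {0}" by blast
  then have "span (\<Union>n. V n) \<subseteq> span {0}" by (rule span_mono)
  also have "span {0} = {0}" by simp
  finally show False using nonzero span_V by auto
qed

lemma schur:
  assumes f: "lin f" and fV: "\<And>n v. v \<in> V n \<Longrightarrow> f v \<in> V n" and comm: "\<And>k p v. f (rho k p v) = rho k p (f v)"
  shows "\<exists>c. \<forall>v. f v = c *s v"
proof -
  obtain n w where w: "w \<in> V n" "w \<noteq> 0" using V_nonzero by blast
  obtain v c where v: "v \<noteq> 0" "f v = c *s v"
    using eigen_exists[OF fdim_V f _ w] fV by blast
  have "{v. f v = c *s v} = {0} \<or> {v. f v = c *s v} = UNIV"
  proof (rule irred)
    show "subspace {v. f v = c *s v}"
      using subspace_kernel[OF lin_minus'[OF f lin_smult[OF lin_id, of c]]] by simp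
  qed (simp add: comm lin_simps[OF lin_rho])
  then show ?thesis using v by blast
qed

text \<open>\<open>h\<close> minus its value at \<open>a\<close> is a multiple of t - a, so modulo
  the annihilator \<open>q * h\<close> is that value times \<open>q\<close>.\<close>

lemma null_root_scalar:
  assumes n: "null ([:- a, 1:] * q)"
  shows "rho k (q * h) v = poly h a *s rho k q v" "zeta (q * h) v = poly h a *s zeta q v"
proof -
  have "poly (h - [:poly h a:]) a = 0" by simp
  then obtain s where "h - [:poly h a:] = [:- a, 1:] * s" by (metis dvdE poly_eq_0_iff_dvd)
  then have h: "h = [:poly h a:] + [:- a, 1:] * s" by (metis add.commute diff_add_cancel)
  have "q * h = q * [:poly h a:] + q * ([:- a, 1:] * s)" by (subst h) (rule distrib_left)
  also have "q * [:poly h a:] = smult (poly h a) q" by simp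
  also have "q * ([:- a, 1:] * s) = ([:- a, 1:] * q) * s" by (simp only: mult_ac)
  finally have e: "q * h = smult (poly h a) q + ([:- a, 1:] * q) * s" .
  show "rho k (q * h) v = poly h a *s rho k q v" "zeta (q * h) v = poly h a *s zeta q v"
    unfolding e using null_ideal[OF n] by (simp_all only: rho_add rho_smult zeta_add zeta_smult add_0_right)
qed

text \<open>The operators \<open>x k\<close> commute because \<open>q * q\<close> acts as
  \<open>poly q a\<close> times \<open>q\<close>, that is as 0. The aim is one nonzero vector killed
  by all of them: once \<open>zeta q\<close> is known to vanish, such vectors form a
  submodule.\<close>

lemma nilpotent_component_null:
  assumes n: "null ([:- a, 1:] * q)" and q: "poly q a = 0"
  shows "null q"
proof -
  define x where "x k = rho k q" for k
  define d where "d k = rho k 1" for k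
  have lx: "lin (x k)" and ld: "lin (d k)" for k by (simp_all add: x_def d_def lin_rho)
  have xr: "x k (rho l h v) = rho l h (x k v) + (of_int (l - k) * poly h a) *s x (k + l) v
      + (if k + l = 0 then (of_int (k ^ 3 - k) / 12 * poly h a) *s zeta q v else 0)" for k l h v
    using bracket[of k q l h v] unfolding null_root_scalar[OF n] by (simp add: x_def algebra_simps split: if_splits)
  have xx: "x k (x l v) = x l (x k v)" for k l v
    using xr[of k l q v] q by (simp add: x_def)
  have dx: "d l (x k v) = x k (d l v) + of_int (k - l) *s x (k + l) v
      - (if k + l = 0 then (of_int (k ^ 3 - k) / 12) *s zeta q v else 0)" for k l v
    using xr[of k l 1 v] by (simp add: d_def scale_left_diff_distrib algebra_simps split: if_splits)
  have xV: "v \<in> V n \<Longrightarrow> x 0 v \<in> V n" for v n using rho_weight[of v n 0 q] by (simp add: x_def)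
  obtain \<gamma> where \<gamma>: "((\<lambda>v. x 0 v - \<gamma> *s v) ^^ N) v = 0" for v
  proof -
    obtain m w where w: "w \<in> V m" "w \<noteq> 0" using V_nonzero by blast
    have "x 0 ` V m \<subseteq> V m" using xV by blast
    then obtain u g where u: "u \<noteq> 0" "x 0 u = g *s u"
      using eigen_exists[OF fdim_V lx _ w] by blast
    define y where "y v = x 0 v - g *s v" for v
    have ly: "lin y" unfolding y_def by (intro lin_minus' lx lin_smult lin_id)
    have yx: "y (x l v) = x l (y v)" for l v by (simp add: y_def xx lin_simps[OF lx])
    have yr: "y (rho l h v) = rho l h (y v) + (of_int l * poly h a) *s x l v" for l h v
      using xr[of 0 l h v] by (simp add: y_def lin_simps[OF lin_rho])
    have yxn: "(y ^^ j) (x l v) = x l ((y ^^ j) v)" for j l v by (induction j) (simp_all add: yx)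
    have step: "(y ^^ j) v = 0 \<Longrightarrow> (y ^^ Suc j) (rho l h v) = 0" for j l h v
    proof (induction j arbitrary: v)
      case 0
      then show ?case by (simp add: lin_0[OF lin_rho] lin_0[OF ly])
    next
      case (Suc j)
      have "(y ^^ Suc (Suc j)) (rho l h v) = (y ^^ Suc j) (y (rho l h v))" by (simp add: funpow_swap1)
      also have "\<dots> = (y ^^ Suc j) (rho l h (y v)) + (of_int l * poly h a) *s (y ^^ Suc j) (x l v)"
        unfolding yr lin_add[OF lin_funpow[OF ly]] lin_scale[OF lin_funpow[OF ly]] by (rule refl)
      also have "(y ^^ Suc j) (rho l h (y v)) = 0"
        by (rule Suc.IH) (use Suc.prems in \<open>simp add: funpow_swap1\<close>)
      also have "(y ^^ Suc j) (x l v) = 0" unfolding yxn Suc.prems by (rule lin_0[OF lx])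
      finally show ?case by simp
    qed
    have mono: "(y ^^ i) v = 0" if "(y ^^ j) v = 0" "j \<le> i" for i j v
      using funpow_add[of "i - j" j y] that lin_0[OF lin_funpow[OF ly]] by simp
    have "{v. \<exists>j. (y ^^ j) v = 0} = {0} \<or> {v. \<exists>j. (y ^^ j) v = 0} = UNIV"
    proof (rule irred)
      show "subspace {v. \<exists>j. (y ^^ j) v = 0}"
      proof (rule subspaceI)
        show "0 \<in> {v. \<exists>j. (y ^^ j) v = 0}" by (auto intro: exI[of _ 0])
        fix v w assume "v \<in> {v. \<exists>j. (y ^^ j) v = 0}" "w \<in> {v. \<exists>j. (y ^^ j) v = 0}"
        then obtain i j where ij: "(y ^^ i) v = 0" "(y ^^ j) w = 0" by blast
        have "(y ^^ max i j) (v + w) = 0"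
          using mono[OF ij(1), of "max i j"] mono[OF ij(2), of "max i j"] by (simp add: lin_add[OF lin_funpow[OF ly]])
        then show "v + w \<in> {v. \<exists>j. (y ^^ j) v = 0}" by blast
      next
        fix c v assume "v \<in> {v. \<exists>j. (y ^^ j) v = 0}"
        then show "c *s v \<in> {v. \<exists>j. (y ^^ j) v = 0}" by (auto simp: lin_scale[OF lin_funpow[OF ly]])
      qed
      fix k p w assume "w \<in> {v. \<exists>j. (y ^^ j) v = 0}"
      then show "rho k p w \<in> {v. \<exists>j. (y ^^ j) v = 0}" using step by blast
    qed
    moreover have "y u = 0" using u by (simp add: y_def)
    then have "u \<in> {v. \<exists>j. (y ^^ j) v = 0}" by (auto intro: exI[of _ 1])
    ultimately have all: "\<exists>j. (y ^^ j) v = 0" for v using u(1) by blast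
    have yV: "y ` V m \<subseteq> V m" for m
    proof
      fix z assume "z \<in> y ` V m"
      then obtain v where "v \<in> V m" "z = x 0 v - g *s v" by (auto simp: y_def)
      then show "z \<in> V m" using xV fdim_subspace[OF fdim_V[of m]] by (simp add: subspace_diff subspace_scale)
    qed
    have "(y ^^ N) v = 0" if "v \<in> (\<Union>n. V n)" for v
      using nilpotent_bound[OF fdim_V ly yV] all that by blast
    then have "(y ^^ N) v = 0" for v
      using lin_eq_on_span[OF lin_funpow[OF ly] lin_zero, of "\<Union>n. V n" N v] span_V by blast
    then show ?thesis using that[of g] unfolding y_def by simp
  qed
  have zd: "zeta q (d k v) = d k (zeta q v)" for k v by (simp add: d_def zeta_comm)
  have zx: "zeta q (x k v) = x k (zeta q v)" for k v by (simp add: x_def zeta_comm)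
  have lneg: "lin f \<Longrightarrow> lin (\<lambda>v. - f v)" for f
    using lin_smult[of f "- 1"] by simp
  \<comment> \<open>A chain of brackets: \<open>d 1\<close> turns \<open>x 0 - \<gamma>\<close> into
    \<open>- x 1\<close>, \<open>d (- 1)\<close> turns this into \<open>- 2 x 0\<close>, so
    \<open>x 0\<close> itself is nilpotent; \<open>d 2\<close> then gives \<open>4 x 2\<close>, and
    \<open>d (- 2)\<close> brings in the central operator \<open>zeta q\<close>.\<close>
  have n1: "((\<lambda>v. (- 1) *s x 1 v) ^^ (2 * N)) v = 0" for v
    by (rule nilpotent_derivative[where D = "d 1" and w = "\<lambda>v. 0" and y = "\<lambda>v. x 0 v - \<gamma> *s v", OF _ _ _ _ _ _ _ _ \<gamma>])
       (auto intro!: lneg ld lin_smult lin_minus' lx lin_zero lin_id simp: dx xx lin_simps[OF lx] lin_simps[OF ld] algebra_simps)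
  have n2: "((\<lambda>v. (- 2) *s x 0 v) ^^ (2 * (2 * N))) v = 0" for v
    by (rule nilpotent_derivative[where D = "d (- 1)" and w = "\<lambda>v. (- 2) *s x (- 1) v" and y = "\<lambda>v. (- 1) *s x 1 v", OF _ _ _ _ _ _ _ _ n1])
       (auto intro!: lneg ld lin_smult lx simp: dx xx lin_simps[OF lx] lin_simps[OF ld] algebra_simps)
  have n3: "((\<lambda>v. 4 *s x 2 v) ^^ (2 * (2 * (2 * N)))) v = 0" for v
    by (rule nilpotent_derivative[where D = "d 2" and w = "\<lambda>v. 0" and y = "\<lambda>v. (- 2) *s x 0 v", OF _ _ _ _ _ _ _ _ n2])
       (auto intro!: lneg ld lin_smult lx lin_zero simp: dx xx lin_simps[OF lx] lin_simps[OF ld] algebra_simps)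
  have n4: "((\<lambda>v. 16 *s x 0 v - 2 *s zeta q v) ^^ (2 * (2 * (2 * (2 * N))))) v = 0" for v
    by (rule nilpotent_derivative[where D = "d (- 2)" and w = "\<lambda>v. 32 *s x (- 2) v" and y = "\<lambda>v. 4 *s x 2 v", OF _ _ _ _ _ _ _ _ n3])
       (auto intro!: lneg ld lin_smult lx lin_minus' lin_zeta
         simp: dx xx zd zx lin_simps[OF lx] lin_simps[OF ld] lin_simps[OF lin_zeta] algebra_simps)
  obtain u0 :: 'v where u0: "u0 \<noteq> 0" using nonzero by blast
  obtain c where c: "\<And>v. zeta q v = c *s v"
  proof -
    have "zeta q v \<in> V m" if "v \<in> V m" for v m
      using that by (simp add: V_def lin_simps[OF lin_zeta] flip: zeta_comm)
    then show ?thesis using schur[OF lin_zeta, of q] zeta_comm that by blast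
  qed
  \<comment> \<open>On a kernel vector of \<open>x 0\<close> the nilpotent operator of
    \<open>n4\<close> acts by the scalar \<open>- 2 * c\<close>.\<close>
  have c0: "c = 0"
  proof (rule ccontr)
    assume "c \<noteq> 0"
    obtain v where v: "v \<noteq> 0" "(- 2) *s x 0 v = 0" using nilpotent_kernel[OF n2 u0] by blast
    then have "x 0 v = 0" by simp
    then have "((\<lambda>v. 16 *s x 0 v - 2 *s zeta q v) ^^ j) v = ((- 2 * c) ^ j) *s v" for j
      by (induction j) (simp_all add: c lin_simps[OF lx])
    then show False using n4[of v] v(1) \<open>c \<noteq> 0\<close> by simp
  qed
  have dx': "d l (x k v) = x k (d l v) + of_int (k - l) *s x (k + l) v" for k l v
    using dx[of l k v] by (simp add: c c0)
  define r where "r = 2 * (2 * N)"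
  have x0r: "(x 0 ^^ r) v = 0" for v
  proof -
    have "((\<lambda>v. (- 2) *s x 0 v) ^^ j) v = ((- 2) ^ j) *s (x 0 ^^ j) v" for j
      by (induction j) (simp_all add: lin_simps[OF lx])
    then show ?thesis using n2[of v] by (simp add: r_def)
  qed
  define X where "X ks v = foldr x ks v" for ks v
  have lX: "lin (X ks)" for ks unfolding X_def
    by (induction ks) (simp_all add: lin_id lin_comp'[OF lx])
  have Xcons: "X (k # ks) v = x k (X ks v)" for k ks v by (simp add: X_def)
  have dX: "d l (X ks v) - X ks (d l v) \<in> span ((\<lambda>ks'. X ks' v) ` {ks'. length ks' = length ks})" for l ks v
  proof (induction ks)
    case Nil
    then show ?case by (simp add: X_def span_zero)
  next
    case (Cons k ks)
    let ?S = "\<lambda>m. span ((\<lambda>ks'. X ks' v) ` {ks'. length ks' = m})"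
    have "x k (d l (X ks v) - X ks (d l v)) \<in> ?S (Suc (length ks))"
    proof (rule lin_image_span[OF lx _ subspace_span Cons])
      fix b assume "b \<in> (\<lambda>ks'. X ks' v) ` {ks'. length ks' = length ks}"
      then obtain ks' where "length ks' = length ks" "b = X ks' v" by blast
      then show "x k b \<in> ?S (Suc (length ks))"
        by (intro span_base image_eqI[of _ _ "k # ks'"]) (auto simp: Xcons)
    qed
    moreover have "x (k + l) (X ks v) \<in> ?S (Suc (length ks))"
      by (intro span_base image_eqI[of _ _ "(k + l) # ks"]) (auto simp: Xcons)
    ultimately have "x k (d l (X ks v) - X ks (d l v)) + of_int (k - l) *s x (k + l) (X ks v) \<in> ?S (Suc (length ks))"
      by (intro span_add span_scale)
    moreover have "d l (X (k # ks) v) - X (k # ks) (d l v) =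
        x k (d l (X ks v) - X ks (d l v)) + of_int (k - l) *s x (k + l) (X ks v)"
      by (simp only: Xcons dx' lin_diff[OF lx]) simp
    ultimately show ?case by (simp only: length_Cons)
  qed
  \<comment> \<open>differentiating a vanishing monomial with \<open>j\<close> free factors frees one more factor of \<open>x 0\<close>\<close>
  have mono: "j \<le> r \<Longrightarrow> length ks = j \<Longrightarrow> X ks ((x 0 ^^ (r - j)) v) = 0" for j ks v
  proof (induction j arbitrary: ks v)
    case 0
    then show ?case using x0r by (simp add: X_def)
  next
    case (Suc j)
    obtain ks' l where ks: "ks = ks' @ [l]" using Suc.prems(2) by (metis length_Suc_conv_rev)
    have len: "length ks' = j" using ks Suc.prems by simp
    obtain m where m: "r - j = Suc m" "r - Suc j = m" using Suc.prems by (cases "r - j") auto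
    have IH: "X ls ((x 0 ^^ Suc m) v) = 0" if "length ls = j" for ls v
      using Suc.IH[OF _ that, of v] Suc.prems m by simp
    have Xks: "X ks u = X ks' (x l u)" for u by (simp add: ks X_def)
    show ?case
    proof (cases "l = 0")
      case True
      then show ?thesis unfolding Xks m using IH[OF len, of v] by simp
    next
      case False
      let ?u = "(x 0 ^^ Suc m) v"
      have "(\<lambda>ls. X ls ?u) ` {ls. length ls = length ks'} \<subseteq> {0}" using IH len by auto
      then have "span ((\<lambda>ls. X ls ?u) ` {ls. length ls = length ks'}) \<subseteq> {0}"
        using span_mono[of _ "{0}"] by simp
      then have "d l (X ks' ?u) - X ks' (d l ?u) = 0" using dX[of l ks' ?u] by blast
      then have "X ks' (d l ?u) = 0" using IH[OF len, of v] lin_0[OF ld] by simp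
      also have "d l ?u = (x 0 ^^ Suc m) (d l v) + of_nat (Suc m) *s (x 0 ^^ m) (of_int (- l) *s x l v)"
        by (rule derivation_power[OF ld lx lin_smult[OF lx]]) (simp_all add: dx' xx lin_simps[OF lx])
      finally have "of_nat (Suc m) *s of_int (- l) *s X ks' ((x 0 ^^ m) (x l v)) = 0"
        unfolding lin_add[OF lX] lin_scale[OF lX] lin_scale[OF lin_funpow[OF lx]] IH[OF len] by (simp only: add_0)
      then have "X ks' ((x 0 ^^ m) (x l v)) = 0"
        using False by (simp only: scale_eq_0_iff of_nat_eq_0_iff of_int_eq_0_iff) simp
      moreover have "(x 0 ^^ m) (x l v) = x l ((x 0 ^^ m) v)" by (induction m) (simp_all add: xx)
      ultimately show ?thesis unfolding Xks m(2) by simp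
    qed
  qed
  define P where "P s \<longleftrightarrow> (\<forall>ks. length ks = s \<longrightarrow> (\<forall>v. X ks v = 0))" for s
  have "X ks v = 0" if "length ks = r" for ks v
    using mono[OF order_refl that, of v] by simp
  then have Pr: "P r" unfolding P_def by blast
  define s where "s = (LEAST s. P s)"
  have s: "P s" unfolding s_def using Pr by (rule LeastI)
  have "s \<noteq> 0"
  proof
    assume "s = 0"
    then have "X [] u0 = 0" using s unfolding P_def by blast
    then show False using u0 by (simp add: X_def)
  qed
  then obtain s' where s': "s = Suc s'" by (cases s) auto
  then have "\<not> P s'" using not_less_Least[of s' P] unfolding s_def by simp
  then obtain ks v where ks: "length ks = s'" "X ks v \<noteq> 0" unfolding P_def by blast
  have "X (k # ks) v = 0" for k using s s' ks(1) unfolding P_def by simp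
  then have ker: "x k (X ks v) = 0" for k unfolding Xcons .
  have "{u. \<forall>k. x k u = 0} = {0} \<or> {u. \<forall>k. x k u = 0} = UNIV"
  proof (rule irred)
    show "subspace {u. \<forall>k. x k u = 0}"
      by (rule subspaceI) (auto simp: lin_simps[OF lx])
  qed (simp add: xr c c0 lin_simps[OF lin_rho])
  then have "x 1 u = 0" for u using ker ks(2) by blast
  then show ?thesis by (simp add: null_def x_def)
qed

text \<open>If \<open>g\<close> is idempotent modulo the annihilator, \<open>Vir \<otimes> g\<close> is a copy of \<open>Vir\<close>.\<close>

context
  fixes g g' p :: "complex poly"
  assumes p: "null p" and idem: "\<exists>u. g * g = g + p * u" and orth: "\<exists>u. g' * g = p * u"
    and g: "\<not> null g" and sum: "g + g' = 1"
begin

lemma idem_rho: "rho k (g * (g * h)) v = rho k (g * h) v" "zeta (g * (g * h)) v = zeta (g * h) v"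
proof -
  obtain u where u: "g * g = g + p * u" using idem by blast
  have e: "g * (g * h) = g * h + p * (u * h)" by (simp add: mult.assoc[symmetric] u distrib_right)
  show "rho k (g * (g * h)) v = rho k (g * h) v" "zeta (g * (g * h)) v = zeta (g * h) v"
    unfolding e by (simp_all add: rho_add zeta_add null_ideal[OF p])
qed

lemma orth_rho: "rho k (g' * (g * h)) v = 0"
proof -
  obtain u where u: "g' * g = p * u" using orth by blast
  have e: "g' * (g * h) = p * (u * h)" by (simp add: mult.assoc[symmetric] u)
  show ?thesis unfolding e by (rule null_ideal[OF p])
qed

text \<open>The common kernel of an ideal of the Lie algebra is a submodule. The central part
  vanishes on it too, since the bracket of d_2 and d_(-2) in this copy expresses
  \<open>zeta (g * h)\<close> by the operators \<open>rho k (g * h)\<close>.\<close>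

lemma idem_kernel:
  assumes v: "\<And>k h. rho k (g * h) v = 0"
  shows "v = 0"
proof -
  have zg: "zeta (g * h) w = 0" if "\<And>k h. rho k (g * h) w = 0" for h w
    using bracket[of 2 g "- 2" "g * h" w] that that[of _ 1] lin_0[OF lin_rho] by (simp add: idem_rho)
  have "{w. \<forall>k h. rho k (g * h) w = 0} = {0} \<or> {w. \<forall>k h. rho k (g * h) w = 0} = UNIV"
  proof (rule irred)
    show "subspace {w. \<forall>k h. rho k (g * h) w = 0}"
      by (rule subspaceI) (auto simp: lin_simps[OF lin_rho])
    fix l f w assume w: "w \<in> {w. \<forall>k h. rho k (g * h) w = 0}"
    have "rho k (g * h) (rho l f w) = 0" for k h
      using bracket[of k "g * h" l f w] w zg[of w "h * f"] lin_0[OF lin_rho] by (simp add: mult.assoc)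
    then show "rho l f w \<in> {w. \<forall>k h. rho k (g * h) w = 0}" by simp
  qed
  moreover have "{w. \<forall>k h. rho k (g * h) w = 0} \<noteq> UNIV"
  proof
    assume "{w. \<forall>k h. rho k (g * h) w = 0} = UNIV"
    then have "rho 1 (g * 1) w = 0" for w by blast
    then show False using g by (simp add: null_def)
  qed
  ultimately show ?thesis using v by blast
qed

text \<open>sl_2 theory for the copy of Vir given by \<open>g\<close> makes all \<open>W m\<close>
  with \<open>m \<ge> M\<close> isomorphic, and likewise those far below. If both ends were zero,
  each \<open>rho k (g * h)\<close> would kill \<open>u\<close>, because it can be obtained from
  brackets of two operators that move \<open>u\<close> far out.\<close>

lemma half_line_support:
  assumes st: "\<sigma> + \<tau> = lam + of_int n" and u: "rho 0 g u = \<sigma> *s u" "rho 0 g' u = \<tau> *s u" "u \<noteq> 0"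
  defines "W \<equiv> \<lambda>m::int. {v. rho 0 g v = (\<sigma> + of_int m) *s v \<and> rho 0 g' v = \<tau> *s v}"
  shows "\<exists>M. (\<forall>m\<ge>M. \<exists>v\<in>W m. v \<noteq> 0) \<or> (\<forall>m\<ge>M. \<exists>v\<in>W (- m). v \<noteq> 0)"
proof -
  have sW: "subspace (W m)" for m
    unfolding W_def by (rule subspaceI) (auto simp: lin_simps[OF lin_rho] algebra_simps)
  have WV: "W m \<subseteq> V (n + m)" for m
  proof
    fix v assume v: "v \<in> W m"
    have "rho 0 1 v = rho 0 g v + rho 0 g' v" by (simp only: sum[symmetric] rho_add)
    also have "\<dots> = ((\<sigma> + \<tau>) + of_int m) *s v" using v by (simp add: W_def algebra_simps)
    finally show "v \<in> V (n + m)" unfolding V_def st by (simp add: add.assoc)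
  qed
  have fW: "fdim N (W m)" for m using fdim_mono[OF fdim_V sW WV] .
  have step: "rho k (g * h) v \<in> W (m + k)" if v: "v \<in> W m" for k h v m
  proof -
    have "rho 0 g (rho k (g * h) v) = rho k (g * h) (rho 0 g v) + of_int k *s rho k (g * h) v"
      using bracket[of 0 g k "g * h" v] by (cases "k = 0") (simp_all add: idem_rho algebra_simps)
    moreover have "rho 0 g' (rho k (g * h) v) = rho k (g * h) (rho 0 g' v)"
      using bracket[of 0 g' k "g * h" v] unfolding orth_rho by (cases "k = 0") simp_all
    ultimately show ?thesis using v by (simp add: W_def lin_simps[OF lin_rho] algebra_simps)
  qed
  have step1: "rho k g v \<in> W (m + k)" if "v \<in> W m" for k v m using step[OF that, of k 1] by simp
  have "\<exists>M. \<forall>m. \<bar>m\<bar> \<ge> M \<longrightarrow> bij_betw (rho 1 g) (W m) (W (m + 1))"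
  proof (rule sl2_bijective[where E = "rho 1 g" and F = "rho (- 1) g" and X = W and \<mu> = \<sigma>, OF lin_rho lin_rho fW])
    fix m v assume v: "v \<in> W m"
    show "rho 1 g v \<in> W (m + 1)" "rho (- 1) g v \<in> W (m - 1)" using step1[OF v, of 1] step1[OF v, of "- 1"] by simp_all
    have "rho 1 g (rho (- 1) g v) - rho (- 1) g (rho 1 g v) = (- 2) *s rho 0 (g * (g * 1)) v"
      using bracket[of 1 g "- 1" g v] by simp
    also have "rho 0 (g * (g * 1)) v = (\<sigma> + of_int m) *s v" unfolding idem_rho using v by (simp add: W_def)
    finally show "rho 1 g (rho (- 1) g v) - rho (- 1) g (rho 1 g v) = (- 2 * (\<sigma> + of_int m)) *s v"
      by (simp only: scale_scale)
  qed
  then obtain M0 where M0: "\<And>m. \<bar>m\<bar> \<ge> M0 \<Longrightarrow> bij_betw (rho 1 g) (W m) (W (m + 1))" by blast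
  define M where "M = max M0 1"
  have bij: "bij_betw (rho 1 g) (W m) (W (m + 1))" if "M \<le> \<bar>m\<bar>" for m using M0 that by (simp add: M_def)
  have W0: "0 \<in> W m" for m using subspace_0[OF sW] .
  have iff: "(\<exists>v\<in>W m. v \<noteq> 0) \<longleftrightarrow> (\<exists>v\<in>W (m + 1). v \<noteq> 0)" if mM: "M \<le> \<bar>m\<bar>" for m
  proof
    assume "\<exists>v\<in>W m. v \<noteq> 0"
    then obtain v where v: "v \<in> W m" "v \<noteq> 0" by blast
    then have "rho 1 g v \<noteq> 0"
      using bij[OF mM] inj_onD[of "rho 1 g" "W m" v 0] W0 lin_0[OF lin_rho] by (auto simp: bij_betw_def)
    then show "\<exists>v\<in>W (m + 1). v \<noteq> 0" using step1[OF v(1), of 1] by blast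
  next
    assume "\<exists>v\<in>W (m + 1). v \<noteq> 0"
    then obtain v where v: "v \<in> W (m + 1)" "v \<noteq> 0" by blast
    then obtain w where "w \<in> W m" "v = rho 1 g w" using bij[OF mM] by (auto simp: bij_betw_def)
    then have "w \<in> W m" "w \<noteq> 0" using v(2) lin_0[OF lin_rho[of 1 g]] by auto
    then show "\<exists>v\<in>W m. v \<noteq> 0" by blast
  qed
  have up: "(\<exists>v\<in>W (M + int j). v \<noteq> 0) \<longleftrightarrow> (\<exists>v\<in>W M. v \<noteq> 0)" for j
  proof (induction j)
    case (Suc j)
    have "M + int (Suc j) = M + int j + 1" by simp
    moreover have "M \<le> \<bar>M + int j\<bar>" by (simp add: M_def)
    ultimately show ?case using iff[of "M + int j"] Suc by (simp only:)
  qed simp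
  have down: "(\<exists>v\<in>W (- M - int j). v \<noteq> 0) \<longleftrightarrow> (\<exists>v\<in>W (- M). v \<noteq> 0)" for j
  proof (induction j)
    case (Suc j)
    have "- M - int j = (- M - int (Suc j)) + 1" by simp
    moreover have "M \<le> \<bar>- M - int (Suc j)\<bar>" by (simp add: M_def)
    ultimately show ?case using iff[of "- M - int (Suc j)"] Suc by argo
  qed simp
  have "(\<exists>v\<in>W M. v \<noteq> 0) \<or> (\<exists>v\<in>W (- M). v \<noteq> 0)"
  proof (rule ccontr)
    assume a: "\<not> ((\<exists>v\<in>W M. v \<noteq> 0) \<or> (\<exists>v\<in>W (- M). v \<noteq> 0))"
    have zero: "v = 0" if vm: "v \<in> W m" "M \<le> \<bar>m\<bar>" for v m
    proof (cases "m \<ge> 0")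
      case True
      then obtain j where "m = M + int j" using zle_iff_zadd[of M m] vm(2) by auto
      then show ?thesis using up[of j] a vm(1) by blast
    next
      case False
      then obtain j where "- M = m + int j" using zle_iff_zadd[of m "- M"] vm(2) by auto
      then have "m = - M - int j" by simp
      then show ?thesis using down[of j] a vm(1) by blast
    qed
    have u0: "u \<in> W 0" using u by (simp add: W_def)
    \<comment> \<open>\<open>rho (k - l) g\<close> and \<open>rho l (g * h)\<close> both send
      \<open>u\<close> into zero spaces; the left side is, up to sign, what their bracket does to
      \<open>u\<close>.\<close>
    have key: "of_int (2 * l - k) *s rho k (g * h) u
        + (if k = 0 then (of_int (l - l ^ 3) / 12) *s zeta (g * h) u else 0) = 0"
      if l: "l \<ge> M + \<bar>k\<bar>" for k l h
    proof -
      have "rho (k - l) g u = 0" using zero[OF step1[OF u0, of "k - l"]] l by simp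
      moreover have "rho l (g * h) u = 0" using zero[OF step[OF u0, of l h]] l by simp
      ultimately show ?thesis
        using bracket[of "k - l" g l "g * h" u] lin_0[OF lin_rho] unfolding idem_rho
        by (cases "k = 0") (auto simp: algebra_simps power3_eq_cube dest: sym)
    qed
    have "rho k (g * h) u = 0" for k h
    proof (cases "k = 0")
      case False
      have "2 * (M + \<bar>k\<bar>) - k \<noteq> 0" by (auto simp: M_def)
      then have "of_int (2 * (M + \<bar>k\<bar>) - k) \<noteq> (0::complex)" by (simp only: of_int_eq_0_iff) simp
      then show ?thesis using key[of k "M + \<bar>k\<bar>" h] False by (simp only: if_False add_0_right scale_eq_0_iff) simp
    next
      case True
      \<comment> \<open>For \<open>k = 0\<close> the central term interferes. Two consecutive values
        of \<open>l\<close> give two equations in \<open>A\<close> and \<open>Z\<close> with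
        determinant \<open>l * (l + 1) * (2 * l + 1) / 6\<close>, nonzero because \<open>M\<close>
        was chosen to be at least 1.\<close>
      define A Z where "A = rho 0 (g * h) u" and "Z = zeta (g * h) u"
      define c :: "int \<Rightarrow> complex" where "c l = of_int (l - l ^ 3) / 12" for l
      have e: "(2 * of_int l) *s A + c l *s Z = 0" if "l \<ge> M" for l
        using key[of 0 l h] that by (simp add: A_def Z_def c_def)
      define l where "l = M"
      have l: "l \<ge> 1" by (simp add: l_def M_def)
      have e1: "(2 * of_int l) *s A + c l *s Z = 0" and e2: "(2 * of_int (l + 1)) *s A + c (l + 1) *s Z = 0"
        using e[of l] e[of "l + 1"] by (simp_all add: l_def)
      have "(2 * of_int (l + 1)) *s ((2 * of_int l) *s A + c l *s Z) - (2 * of_int l) *s ((2 * of_int (l + 1)) *s A + c (l + 1) *s Z) = 0"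
        unfolding e1 e2 by simp
      then have "(2 * of_int (l + 1) * c l - 2 * of_int l * c (l + 1)) *s Z = 0"
        by (simp add: scale_right_distrib scale_left_diff_distrib mult_ac)
      moreover have "2 * of_int (l + 1) * c l - 2 * of_int l * c (l + 1) = of_int (l * (l + 1) * (2 * l + 1)) / 6"
        by (simp add: c_def field_simps power3_eq_cube)
      moreover have "of_int (l * (l + 1) * (2 * l + 1)) / 6 \<noteq> (0::complex)"
        using l by (simp only: divide_eq_0_iff of_int_eq_0_iff) simp
      ultimately have "Z = 0" by (simp only: scale_eq_0_iff) simp
      then have "(2 * of_int l) *s A = 0" using e1 by simp
      moreover have "2 * of_int l \<noteq> (0::complex)" using l by simp
      ultimately have "A = 0" by (simp only: scale_eq_0_iff) simp
      then show ?thesis using True by (simp add: A_def)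
    qed
    then show False using idem_kernel u(3) by blast
  qed
  then show ?thesis
  proof
    assume a: "\<exists>v\<in>W M. v \<noteq> 0"
    have "\<exists>v\<in>W m. v \<noteq> 0" if mM: "m \<ge> M" for m
    proof -
      obtain j where "m = M + int j" using zle_iff_zadd[of M m] mM by auto
      then show ?thesis using up[of j] a by blast
    qed
    then show ?thesis by blast
  next
    assume a: "\<exists>v\<in>W (- M). v \<noteq> 0"
    have "\<exists>v\<in>W (- m). v \<noteq> 0" if mM: "m \<ge> M" for m
    proof -
      obtain j where "m = M + int j" using zle_iff_zadd[of M m] mM by auto
      then have "- m = - M - int j" by simp
      then show ?thesis using down[of j] a by (simp only:)
    qed
    then show ?thesis by blast
  qed
qed

end

text \<open>\<open>W\<close> lists the joint weight spaces of the two commuting copies of Vir.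
  Infinitely many columns \<open>\<sigma> + of_int m\<close> occur, each contains a half line in the
  direction of \<open>\<tau>\<close>, and infinitely many of these point the same way.
  \<open>N + 1\<close> of them meet one common weight space of \<open>rho 0 1\<close>, where
  \<open>rho 0 e\<close> would have \<open>N + 1\<close> distinct eigenvalues.\<close>

lemma idempotent_trivial:
  assumes p: "null p" and e: "\<exists>u. e * e = e + p * u" and ne: "\<not> null e" "\<not> null (1 - e)"
  shows False
proof -
  obtain u where u: "e * e = e + p * u" using e by blast
  have i1: "\<exists>u. e * e = e + p * u" "\<exists>u. (1 - e) * (1 - e) = (1 - e) + p * u" "\<exists>u. (1 - e) * e = p * u" "\<exists>u. e * (1 - e) = p * u"
  proof -
    show "\<exists>u. e * e = e + p * u" by (rule e)
    have "(1 - e) * (1 - e) = (1 - e) + p * u" using u by (simp add: algebra_simps)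
    then show "\<exists>u. (1 - e) * (1 - e) = (1 - e) + p * u" by blast
    have "(1 - e) * e = p * (- u)" "e * (1 - e) = p * (- u)" using u by (simp_all add: algebra_simps)
    then show "\<exists>u. (1 - e) * e = p * u" "\<exists>u. e * (1 - e) = p * u" by blast+
  qed
  define W where "W \<sigma> \<tau> = {v. rho 0 e v = \<sigma> *s v \<and> rho 0 (1 - e) v = \<tau> *s v}" for \<sigma> \<tau>
  have supp1: "\<exists>M::int. (\<forall>m\<ge>M. \<exists>v\<in>W (\<sigma> + of_int m) \<tau>. v \<noteq> 0) \<or> (\<forall>m\<ge>M. \<exists>v\<in>W (\<sigma> + of_int (- m)) \<tau>. v \<noteq> 0)"
    if "\<sigma> + \<tau> = lam + of_int n" "v \<in> W \<sigma> \<tau>" "v \<noteq> 0" for \<sigma> \<tau> v and n :: int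
    using half_line_support[OF p i1(1,3) ne(1) _ that(1), of v] that(2,3) by (simp add: W_def)
  have supp2: "\<exists>M::int. (\<forall>m\<ge>M. \<exists>v\<in>W \<sigma> (\<tau> + of_int m). v \<noteq> 0) \<or> (\<forall>m\<ge>M. \<exists>v\<in>W \<sigma> (\<tau> + of_int (- m)). v \<noteq> 0)"
    if "\<sigma> + \<tau> = lam + of_int n" "v \<in> W \<sigma> \<tau>" "v \<noteq> 0" for \<sigma> \<tau> v and n :: int
    using half_line_support[OF p i1(2,4) ne(2) _ , of \<tau> \<sigma> n v] that by (simp add: W_def conj_commute add.commute)
  obtain n w where w: "w \<in> V n" "w \<noteq> 0" using V_nonzero by blast
  have "rho 0 e ` V n \<subseteq> V n" using rho_weight[of _ n 0 e] by auto
  from eigen_exists[OF fdim_V lin_rho this w] obtain v \<sigma> where v: "v \<in> V n" "v \<noteq> 0" "rho 0 e v = \<sigma> *s v" by blast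
  define \<tau> where "\<tau> = lam + of_int n - \<sigma>"
  have "rho 0 1 v = rho 0 e v + rho 0 (1 - e) v" by (simp flip: rho_add)
  then have vW: "v \<in> W \<sigma> \<tau>" using v by (simp add: W_def \<tau>_def V_def algebra_simps)
  have st: "\<sigma> + \<tau> = lam + of_int n" by (simp add: \<tau>_def)
  define S where "S = {m::int. \<exists>v\<in>W (\<sigma> + of_int m) \<tau>. v \<noteq> 0}"
  have "infinite S"
  proof -
    obtain M where "{M..} \<subseteq> S \<or> {.. - M} \<subseteq> S"
    proof -
      obtain M where "(\<forall>m\<ge>M. \<exists>v\<in>W (\<sigma> + of_int m) \<tau>. v \<noteq> 0) \<or> (\<forall>m\<ge>M. \<exists>v\<in>W (\<sigma> + of_int (- m)) \<tau>. v \<noteq> 0)"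
        using supp1[OF st vW v(2)] by blast
      then have "{M..} \<subseteq> S \<or> {.. - M} \<subseteq> S"
      proof
        assume a: "\<forall>m\<ge>M. \<exists>v\<in>W (\<sigma> + of_int (- m)) \<tau>. v \<noteq> 0"
        have "m \<in> S" if "m \<le> - M" for m using a[rule_format, of "- m"] that by (simp add: S_def)
        then show ?thesis by blast
      qed (auto simp: S_def)
      then show ?thesis using that by blast
    qed
    then show ?thesis using infinite_Ici[of M] infinite_Iic[of "- M"] finite_subset by blast
  qed
  define sgn where "sgn m s M \<longleftrightarrow> (\<forall>j\<ge>M. \<exists>v\<in>W (\<sigma> + of_int m) (\<tau> + of_int (s * j)). v \<noteq> 0)" for m s M :: int
  have col: "\<exists>M. sgn m 1 M \<or> sgn m (- 1) M" if "m \<in> S" for m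
  proof -
    obtain v where "v \<in> W (\<sigma> + of_int m) \<tau>" "v \<noteq> 0" using \<open>m \<in> S\<close> by (auto simp: S_def)
    moreover have "\<sigma> + of_int m + \<tau> = lam + of_int (n + m)" using st by simp
    ultimately show ?thesis using supp2[of "\<sigma> + of_int m" \<tau> "n + m" v] by (simp add: sgn_def)
  qed
  have fin: "finite {m\<in>S. \<exists>M. sgn m s M}" if s: "s = 1 \<or> s = - 1" for s
  proof (rule ccontr)
    assume "infinite {m\<in>S. \<exists>M. sgn m s M}"
    then obtain T where T: "T \<subseteq> {m\<in>S. \<exists>M. sgn m s M}" "finite T" "card T = Suc N"
      using infinite_arbitrarily_large by blast
    then have "\<forall>m\<in>T. \<exists>M. sgn m s M" by blast
    from bchoice[OF this] obtain M where M: "\<And>m. m \<in> T \<Longrightarrow> sgn m s (M m)" by blast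
    \<comment> \<open>So large that, on the antidiagonal of total weight index
      \<open>n + s * L\<close>, each chosen column is already inside its half line.\<close>
    define L where "L = Max (insert 0 ((\<lambda>m. \<bar>m\<bar> + \<bar>M m\<bar>) ` T))"
    have L: "\<bar>m\<bar> + \<bar>M m\<bar> \<le> L" if "m \<in> T" for m
      unfolding L_def using that T(2) by (intro Max_ge) auto
    have "\<forall>m\<in>T. \<exists>v. v \<in> W (\<sigma> + of_int m) (\<tau> + of_int (s * L - m)) \<and> v \<noteq> 0"
    proof
      fix m assume m: "m \<in> T"
      have "s * (L - s * m) = s * L - m" using s by (auto simp: algebra_simps)
      moreover have "M m \<le> L - s * m" using L[OF m] s by auto
      ultimately show "\<exists>v. v \<in> W (\<sigma> + of_int m) (\<tau> + of_int (s * L - m)) \<and> v \<noteq> 0"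
        using M[OF m, unfolded sgn_def, rule_format, of "L - s * m"] by auto
    qed
    from bchoice[OF this] obtain v where v: "\<And>m. m \<in> T \<Longrightarrow> v m \<in> W (\<sigma> + of_int m) (\<tau> + of_int (s * L - m)) \<and> v m \<noteq> 0"
      by blast
    have inj: "inj_on (\<lambda>m. \<sigma> + of_int m) T" by (rule inj_onI) simp
    have "card ((\<lambda>m. \<sigma> + of_int m) ` T) \<le> N"
    proof (rule eigen_bound[OF fdim_V[of "n + s * L"] _ lin_rho[of 0 e]])
      show "finite ((\<lambda>m. \<sigma> + of_int m) ` T)" using T(2) by simp
      fix \<alpha> assume "\<alpha> \<in> (\<lambda>m. \<sigma> + of_int m) ` T"
      then obtain m where m: "m \<in> T" "\<alpha> = \<sigma> + of_int m" by blast
      define x where "x = v (the_inv_into T (\<lambda>m. \<sigma> + of_int m) \<alpha>)"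
      have x: "x = v m" unfolding x_def m(2) by (simp add: the_inv_into_f_f[OF inj m(1)])
      have xW: "rho 0 e x = \<alpha> *s x" "rho 0 (1 - e) x = (\<tau> + of_int (s * L - m)) *s x" "x \<noteq> 0"
        using v[OF m(1)] by (simp_all add: x m(2) W_def)
      have "rho 0 1 x = rho 0 e x + rho 0 (1 - e) x" by (simp flip: rho_add)
      also have "\<dots> = (\<alpha> + (\<tau> + of_int (s * L - m))) *s x" by (simp only: xW scale_left_distrib)
      also have "\<alpha> + (\<tau> + of_int (s * L - m)) = lam + of_int (n + s * L)" using st by (simp add: m(2) algebra_simps)
      finally show "v (the_inv_into T (\<lambda>m. \<sigma> + of_int m) \<alpha>) \<in> V (n + s * L)" by (simp add: V_def x_def)
      show "v (the_inv_into T (\<lambda>m. \<sigma> + of_int m) \<alpha>) \<noteq> 0"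
        "rho 0 e (v (the_inv_into T (\<lambda>m. \<sigma> + of_int m) \<alpha>)) = \<alpha> *s v (the_inv_into T (\<lambda>m. \<sigma> + of_int m) \<alpha>)"
        using xW by (simp_all add: x_def)
    qed
    then show False using card_image[OF inj] T(3) by simp
  qed
  have "S \<subseteq> {m\<in>S. \<exists>M. sgn m 1 M} \<union> {m\<in>S. \<exists>M. sgn m (- 1) M}" using col by blast
  moreover have "finite ({m\<in>S. \<exists>M. sgn m 1 M} \<union> {m\<in>S. \<exists>M. sgn m (- 1) M})"
    by (rule finite_UnI[OF fin fin]) simp_all
  ultimately have "finite S" by (rule finite_subset)
  then show False using \<open>infinite S\<close> by contradiction
qed

theorem evaluation_point:
  assumes nt: "\<not> null 1"
  shows "\<exists>a. null [:- a, 1:]"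
proof -
  define d where "d = (LEAST d. \<exists>p. p \<noteq> 0 \<and> null p \<and> degree p = d)"
  have "\<exists>d p. p \<noteq> 0 \<and> null p \<and> degree p = d" using annihilator_exists by blast
  from LeastI_ex[OF this] obtain p where p: "p \<noteq> 0" "null p" "degree p = d" unfolding d_def by blast
  have min: "\<not> null q" if "q \<noteq> 0" "degree q < d" for q
    using not_less_Least[of "degree q" "\<lambda>d. \<exists>p. p \<noteq> 0 \<and> null p \<and> degree p = d"] that unfolding d_def by blast
  have "d \<noteq> 0"
  proof
    assume "d = 0"
    then obtain c where c: "p = [:c:]" using p(3) degree_eq_zeroE by blast
    then have "c \<noteq> 0" using p(1) by simp
    have "1 = p * [:1 / c:]" using c \<open>c \<noteq> 0\<close> by (simp add: one_pCons)
    then have "null 1" using null_ideal(1)[OF p(2), of 1 "[:1 / c:]"] by (simp add: null_def)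
    then show False using nt by simp
  qed
  then have "\<not> constant (poly p)" using constant_degree[of p] p(3) by simp
  then obtain a where "poly p a = 0" using fundamental_theorem_of_algebra by blast
  then obtain q where q: "p = [:- a, 1:] * q" by (metis dvdE poly_eq_0_iff_dvd)
  have "q \<noteq> 0" using p(1) q by auto
  have deg: "d = Suc (degree q)" unfolding p(3)[symmetric] q by (subst degree_mult_eq) (use \<open>q \<noteq> 0\<close> in auto)
  have nq: "\<not> null q" using min \<open>q \<noteq> 0\<close> deg by simp
  have n: "null ([:- a, 1:] * q)" using p(2) q by simp
  have qa: "poly q a \<noteq> 0" using nilpotent_component_null[OF n] nq by blast
  show ?thesis
  proof (cases "degree q = 0")
    case True
    then obtain c where c: "q = [:c:]" using degree_eq_zeroE by blast
    then have "c \<noteq> 0" using \<open>q \<noteq> 0\<close> by simp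
    have "[:- a, 1:] = p * [:1 / c:]" unfolding q c using \<open>c \<noteq> 0\<close> by simp
    then have "null [:- a, 1:]" using null_ideal(1)[OF p(2), of 1 "[:1 / c:]"] by (simp only: null_def) simp
    then show ?thesis by blast
  next
    case False
    \<comment> \<open>Normalised so that \<open>e - 1\<close> vanishes at \<open>a\<close>, whence
      \<open>e * (e - 1)\<close> is a multiple of \<open>p\<close>. Both \<open>e\<close> and
      \<open>1 - e\<close> are nonzero of degree below \<open>d\<close>, hence not null by
      minimality.\<close>
    define e where "e = smult (1 / poly q a) q"
    have "poly (e - 1) a = 0" using qa by (simp add: e_def)
    then obtain s where s: "e - 1 = [:- a, 1:] * s" by (metis dvdE poly_eq_0_iff_dvd)
    have "e * e = e + e * (e - 1)" by (simp add: algebra_simps)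
    also have "e * (e - 1) = e * ([:- a, 1:] * s)" by (simp only: s)
    also have "\<dots> = p * smult (1 / poly q a) s"
      unfolding q e_def by (simp only: mult_smult_left mult_smult_right mult_ac)
    finally have "\<exists>u. e * e = e + p * u" by blast
    moreover have "\<not> null e"
    proof (rule min)
      show "e \<noteq> 0" "degree e < d" using \<open>q \<noteq> 0\<close> qa deg by (simp_all add: e_def)
    qed
    moreover have "\<not> null (1 - e)"
    proof (rule min)
      have "degree e = degree q" using qa by (simp add: e_def)
      then show "1 - e \<noteq> 0" using False by auto
      show "degree (1 - e) < d" using degree_diff_le[of 1 "degree q" e] \<open>degree e = degree q\<close> deg by simp
    qed
    ultimately show ?thesis using idempotent_trivial[OF p(2)] by blast
  qed
qed

end

section \<open>Virasoro modules: trivialising the first raising operator\<close>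

locale vir_module = complex_vector_space scale
  for scale :: "complex \<Rightarrow> 'v::ab_group_add \<Rightarrow> 'v" (infixr "*s" 75) +
  fixes d :: "int \<Rightarrow> 'v \<Rightarrow> 'v" and lam kap :: complex and N :: nat
  assumes lin_d: "lin (d k)"
    and bracket: "d m (d n v) - d n (d m v) = of_int (n - m) *s d (m + n) v
      + (if m + n = 0 then (of_int (m ^ 3 - m) / 12 * kap) *s v else 0)"
    and fdim_weight: "fdim N {v. d 0 v = (lam + of_int n) *s v}"
    and span_weight: "span (\<Union>n. {v. d 0 v = (lam + of_int n) *s v}) = UNIV"
    and irred: "subspace W \<Longrightarrow> (\<And>k w. w \<in> W \<Longrightarrow> d k w \<in> W) \<Longrightarrow> W = {0} \<or> W = UNIV"
begin

definition x :: "int \<Rightarrow> complex" where "x n = lam + of_int n"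

definition V :: "int \<Rightarrow> 'v set" where "V n = {v. d 0 v = x n *s v}"

lemma x_add: "x (n + k) = x n + of_int k" "x (n - k) = x n - of_int k"
  by (simp_all add: x_def)

lemma fdim_V: "fdim N (V n)"
  using fdim_weight by (simp add: V_def x_def)

lemma span_V: "span (\<Union>n. V n) = UNIV"
  using span_weight by (simp add: V_def x_def)

lemma subspace_V: "subspace (V n)"
  using fdim_V by (rule fdim_subspace)

lemma d0_V: "v \<in> V n \<Longrightarrow> d 0 v = x n *s v"
  by (simp add: V_def)

lemmas d_simps = lin_simps[OF lin_d]

lemma d_V: "v \<in> V n \<Longrightarrow> d k v \<in> V (n + k)"
proof -
  assume v: "v \<in> V n"
  have "d 0 (d k v) = d k (d 0 v) + of_int k *s d k v"
    using bracket[of 0 k v] by (cases "k = 0") (simp_all add: algebra_simps)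
  also have "\<dots> = x (n + k) *s d k v"
    by (simp add: d0_V[OF v] d_simps x_add scale_left_distrib)
  finally show ?thesis by (simp add: V_def)
qed

lemma weight_separation:
  assumes "finite A" "\<And>m. m \<in> A \<Longrightarrow> f m \<in> V m" "v \<in> V n" "n \<notin> A" "v = (\<Sum>m\<in>A. f m)"
  shows "v = 0"
  using assms
proof (induction A arbitrary: v f rule: finite_induct)
  case (insert m0 A)
  define c where "c m = x m - x m0" for m
  have f0: "f m0 \<in> V m0" using insert.prems by simp
  have "c n *s v = d 0 v - x m0 *s v"
    using d0_V[OF insert.prems(2)] by (simp add: c_def scale_left_diff_distrib)
  also have "\<dots> = (d 0 (f m0) - x m0 *s f m0) + (\<Sum>m\<in>A. d 0 (f m) - x m0 *s f m)"
    unfolding insert.prems(4) using insert.hyps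
    by (simp add: d_simps lin_sum[OF lin_d] scale_right_distrib scale_sum_right sum_subtractf)
  also have "\<dots> = (\<Sum>m\<in>A. c m *s f m)"
  proof -
    have "d 0 (f m) - x m0 *s f m = c m *s f m" if "m \<in> A" for m
      using d0_V[of "f m" m] insert.prems(1)[of m] that by (simp add: c_def scale_left_diff_distrib)
    then show ?thesis by (simp add: d0_V[OF f0])
  qed
  finally have "c n *s v = (\<Sum>m\<in>A. c m *s f m)" .
  then have "c n *s v = 0"
    by (intro insert.IH[of "\<lambda>m. c m *s f m"] subspace_scale[OF subspace_V] insert.prems)
       (use insert.prems in auto)
  moreover have "c n \<noteq> 0" using insert.prems(3) by (auto simp: c_def x_def)
  ultimately show ?case by simp
qed simp

lemma span_weights_sum:
  assumes "v \<in> span (\<Union>m\<in>M. V m)"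
  shows "\<exists>A f. finite A \<and> A \<subseteq> M \<and> (\<forall>m\<in>A. f m \<in> V m) \<and> v = (\<Sum>m\<in>A. f m)"
  using assms
proof (induction rule: span_induct_alt)
  case base
  show ?case by (intro exI[of _ "{}"]) simp
next
  case (step c w v)
  then obtain A f m where A: "finite A" "A \<subseteq> M" "\<forall>m\<in>A. f m \<in> V m" "v = (\<Sum>m\<in>A. f m)"
    and m: "m \<in> M" "w \<in> V m" by blast
  define g where "g k = (if k = m then c *s w else 0) + (if k \<in> A then f k else 0)" for k
  have "(\<Sum>k\<in>insert m A. g k) = (\<Sum>k\<in>insert m A. if k = m then c *s w else 0) + (\<Sum>k\<in>insert m A. if k \<in> A then f k else 0)"
    unfolding g_def by (rule sum.distrib)
  also have "(\<Sum>k\<in>insert m A. if k = m then c *s w else 0) = c *s w" using A(1) by simp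
  also have "(\<Sum>k\<in>insert m A. if k \<in> A then f k else 0) = v"
    unfolding A(4) using A(1) by (intro sum.mono_neutral_cong_right) auto
  finally have "c *s w + v = (\<Sum>k\<in>insert m A. g k)" by simp
  moreover have "g k \<in> V k" if "k \<in> insert m A" for k
    using A(3) m(2) subspace_V[of k] by (auto simp: g_def intro!: subspace_add subspace_scale subspace_0)
  ultimately show ?case using A(1,2) m(1) by (intro exI[of _ "insert m A"] exI[of _ g]) auto
qed

lemma V_inter_other:
  assumes "v \<in> V n" "v \<in> span (\<Union>m\<in>- {n}. V m)"
  shows "v = 0"
proof -
  obtain A f where A: "finite A" "A \<subseteq> - {n}" "\<forall>m\<in>A. f m \<in> V m" "v = (\<Sum>m\<in>A. f m)"
    using span_weights_sum[OF assms(2)] by blast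
  show ?thesis by (rule weight_separation[OF A(1) _ assms(1) _ A(4)]) (use A in auto)
qed

text \<open>Linear combinations of words in the \<open>d i\<close> with at most \<open>r\<close>
  factors and total weight \<open>s\<close>. The length is recorded for the induction on traces,
  where a commutator has to count as shorter than the word it comes from.\<close>

inductive comb :: "nat \<Rightarrow> int \<Rightarrow> ('v \<Rightarrow> 'v) \<Rightarrow> bool" where
  id: "comb 0 0 (\<lambda>v. v)"
| zero: "comb r s (\<lambda>v. 0)"
| mono: "comb r s \<phi> \<Longrightarrow> comb (Suc r) s \<phi>"
| add: "comb r s \<phi> \<Longrightarrow> comb r s \<psi> \<Longrightarrow> comb r s (\<lambda>v. \<phi> v + \<psi> v)"
| scale: "comb r s \<phi> \<Longrightarrow> comb r s (\<lambda>v. c *s \<phi> v)"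
| step: "comb r s \<phi> \<Longrightarrow> t = s + i \<Longrightarrow> comb (Suc r) t (\<lambda>v. d i (\<phi> v))"

lemma comb_lin: "comb r s \<phi> \<Longrightarrow> lin \<phi>"
  by (induction rule: comb.induct) (auto intro: lin_id lin_zero lin_plus lin_smult lin_comp'[OF lin_d])

lemma comb_V: "comb r s \<phi> \<Longrightarrow> v \<in> V n \<Longrightarrow> \<phi> v \<in> V (n + s)"
proof (induction rule: comb.induct)
  case (step r s \<phi> t i)
  then show ?case using d_V[of "\<phi> v" "n + s" i] by (simp add: add.assoc)
qed (auto intro: subspace_V subspace_0 subspace_add subspace_scale)

lemma comb_mono: "comb r s \<phi> \<Longrightarrow> r \<le> r' \<Longrightarrow> comb r' s \<phi>"
  by (induction r' rule: nat_induct) (auto simp: le_Suc_eq intro: comb.mono)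

lemma comb_compose: "comb r s \<phi> \<Longrightarrow> comb r' s' \<psi> \<Longrightarrow> comb (r + r') (s + s') (\<lambda>v. \<phi> (\<psi> v))"
proof (induction rule: comb.induct)
  case (step r s \<phi> t i)
  then show ?case using comb.step[of "r + r'" "s + s'" "\<lambda>v. \<phi> (\<psi> v)" "t + s'" i] by simp
qed (auto intro: comb.intros simp: comb_mono)

text \<open>Bracketing with \<open>d i\<close> replaces one factor of a word by a multiple of a
  single \<open>d\<close>, plus a scalar, so the bound on the length does not grow.\<close>

lemma comb_commutator: "comb r s \<phi> \<Longrightarrow> comb r (s + i) (\<lambda>v. d i (\<phi> v) - \<phi> (d i v))"
proof (induction rule: comb.induct)
  case (add r s \<phi> \<psi>)
  have "(\<lambda>v. d i (\<phi> v + \<psi> v) - (\<phi> (d i v) + \<psi> (d i v))) =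
      (\<lambda>v. (d i (\<phi> v) - \<phi> (d i v)) + (d i (\<psi> v) - \<psi> (d i v)))"
    by (simp add: d_simps fun_eq_iff)
  then show ?case using comb.add[OF add.IH] by simp
next
  case (scale r s \<phi> c)
  have "(\<lambda>v. d i (c *s \<phi> v) - c *s \<phi> (d i v)) = (\<lambda>v. c *s (d i (\<phi> v) - \<phi> (d i v)))"
    by (simp add: d_simps fun_eq_iff scale_right_diff_distrib)
  then show ?case using comb.scale[OF scale.IH, of c] by simp
next
  case (step r s \<phi> t j)
  have eq: "d i (d j (\<phi> v)) - d j (\<phi> (d i v)) = (of_int (j - i) *s d (i + j) (\<phi> v)
      + (if i + j = 0 then of_int (i ^ 3 - i) / 12 * kap else 0) *s \<phi> v) + d j (d i (\<phi> v) - \<phi> (d i v))" for v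
  proof -
    have "d i (d j (\<phi> v)) - d j (\<phi> (d i v)) = (d i (d j (\<phi> v)) - d j (d i (\<phi> v))) + d j (d i (\<phi> v) - \<phi> (d i v))"
      by (simp add: d_simps)
    then show ?thesis unfolding bracket by simp
  qed
  have c1: "comb (Suc r) (t + i) (\<lambda>v. d (i + j) (\<phi> v))"
    by (rule comb.step[OF step.hyps(1)]) (simp add: step.hyps(2))
  have c2: "comb (Suc r) (t + i) (\<lambda>v. (if i + j = 0 then of_int (i ^ 3 - i) / 12 * kap else 0) *s \<phi> v)"
  proof (cases "i + j = 0")
    case True
    then have "t + i = s" using step.hyps(2) by simp
    then show ?thesis using comb.scale[OF comb.mono[OF step.hyps(1)]] by simp
  qed (simp add: comb.zero)
  have c3: "comb (Suc r) (t + i) (\<lambda>v. d j (d i (\<phi> v) - \<phi> (d i v)))"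
    by (rule comb.step[OF step.IH]) (simp add: step.hyps(2))
  show ?case unfolding eq by (rule comb.add[OF comb.add[OF comb.scale[OF c1] c2] c3])
qed (auto intro: comb.intros simp: d_simps)

definition "combs s \<phi> \<longleftrightarrow> (\<exists>r. comb r s \<phi>)"

lemma combs_id: "combs 0 (\<lambda>v. v)" and combs_d: "combs i (d i)"
  using comb.id comb.step[OF comb.id, of i i] unfolding combs_def by auto

lemma combs_add: "combs s \<phi> \<Longrightarrow> combs s \<psi> \<Longrightarrow> combs s (\<lambda>v. \<phi> v + \<psi> v)"
proof -
  assume "combs s \<phi>" "combs s \<psi>"
  then obtain r r' where "comb r s \<phi>" "comb r' s \<psi>" unfolding combs_def by blast
  then have "comb (max r r') s \<phi>" "comb (max r r') s \<psi>" by (auto intro: comb_mono)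
  then show ?thesis unfolding combs_def by (intro exI comb.add)
qed

lemma combs_scale: "combs s \<phi> \<Longrightarrow> combs s (\<lambda>v. c *s \<phi> v)"
  unfolding combs_def by (erule exE, rule exI, rule comb.scale)

lemma combs_diff: "combs s \<phi> \<Longrightarrow> combs s \<psi> \<Longrightarrow> combs s (\<lambda>v. \<phi> v - \<psi> v)"
  using combs_add[of s \<phi> "\<lambda>v. (- 1) *s \<psi> v"] combs_scale[of s \<psi> "- 1"] by simp

lemma combs_comp: "combs s \<phi> \<Longrightarrow> combs s' \<psi> \<Longrightarrow> t = s + s' \<Longrightarrow> combs t (\<lambda>v. \<phi> (\<psi> v))"
  unfolding combs_def by (elim exE, rule exI, simp only:, rule comb_compose)

lemma combs_lin: "combs s \<phi> \<Longrightarrow> lin \<phi>"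
  unfolding combs_def by (erule exE, rule comb_lin)

lemma combs_V: "combs s \<phi> \<Longrightarrow> v \<in> V n \<Longrightarrow> \<phi> v \<in> V (n + s)"
  unfolding combs_def by (erule exE, rule comb_V)

text \<open>
  In the trivialisation \<open>d\<^sub>1 = 1\<close> one has \<open>d\<^sub>-\<^sub>1 = x (x - 1) + C\<close> (\<open>C\<close> is the Casimir operator of \<open>sl\<^sub>2\<close>) and
  \<open>d\<^sub>-\<^sub>2 = x (x - 1) (x - 2) + 3 x C + b\<close>; the operators \<open>C\<close>, \<open>b\<close> and \<open>Y = [C, d\<^sub>-\<^sub>2]\<close> commute with \<open>d\<^sub>1\<close>.
\<close>

definition C :: "'v \<Rightarrow> 'v" where "C v = d 1 (d (- 1) v) - (d 0 (d 0 v) - d 0 v)"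

definition b :: "'v \<Rightarrow> 'v" where
  "b v = d 1 (d 1 (d (- 2) v)) - ((d 0 (d 0 (d 0 v)) - 3 *s d 0 (d 0 v)) + 2 *s d 0 v) - 3 *s C (d 0 v)"

definition Y :: "'v \<Rightarrow> 'v" where "Y v = C (d (- 2) v) - d (- 2) (C v)"

definition xi :: "complex \<Rightarrow> complex" where "xi z = z * (z - 1) * (z - 2)"

lemma combs_C: "combs 0 C"
proof -
  have "combs 0 (\<lambda>v. d 1 (d (- 1) v) - (d 0 (d 0 v) - d 0 v))"
    by (intro combs_diff combs_d combs_comp[OF combs_d combs_d]) simp_all
  then show ?thesis by (simp add: C_def[abs_def])
qed

lemma combs_b: "combs 0 b"
proof -
  have "combs (- 1) (\<lambda>v. d 1 (d (- 2) v))" by (rule combs_comp[OF combs_d combs_d]) simp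
  then have "combs 0 (\<lambda>v. d 1 (d 1 (d (- 2) v)))" by (rule combs_comp[OF combs_d]) simp
  moreover have c2: "combs 0 (\<lambda>v. d 0 (d 0 v))" by (rule combs_comp[OF combs_d combs_d]) simp
  moreover from c2 have "combs 0 (\<lambda>v. d 0 (d 0 (d 0 v)))" by (rule combs_comp[OF combs_d]) simp
  moreover have "combs 0 (\<lambda>v. C (d 0 v))" by (rule combs_comp[OF combs_C combs_d]) simp
  ultimately have "combs 0 (\<lambda>v. d 1 (d 1 (d (- 2) v)) - ((d 0 (d 0 (d 0 v)) - 3 *s d 0 (d 0 v)) + 2 *s d 0 v) - 3 *s C (d 0 v))"
    by (intro combs_diff combs_add combs_scale combs_d)
  then show ?thesis by (simp add: b_def[abs_def])
qed

lemma combs_Y: "combs (- 2) Y"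
proof -
  have "combs (- 2) (\<lambda>v. C (d (- 2) v) - d (- 2) (C v))"
    by (intro combs_diff combs_comp[OF combs_C combs_d] combs_comp[OF combs_d combs_C]) simp_all
  then show ?thesis by (simp add: Y_def[abs_def])
qed

lemmas lin_C = combs_lin[OF combs_C] and lin_b = combs_lin[OF combs_b]

lemma C_in: "v \<in> V n \<Longrightarrow> C v \<in> V n" and b_in: "v \<in> V n \<Longrightarrow> b v \<in> V n" and Y_in: "v \<in> V n \<Longrightarrow> Y v \<in> V (n - 2)"
  using combs_V[OF combs_C] combs_V[OF combs_b] combs_V[OF combs_Y] by auto

lemma scale_merge: "p *s v + q *s v = (p + q) *s v" "p *s v - q *s v = (p - q) *s v"
  by (simp_all add: scale_left_distrib scale_left_diff_distrib)

lemma d1_dm1: "v \<in> V n \<Longrightarrow> d 1 (d (- 1) v) = C v + (x n * (x n - 1)) *s v"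
  by (simp add: C_def d0_V d_simps scale_right_diff_distrib right_diff_distrib scale_left_diff_distrib)

lemma dm1_d1: "v \<in> V n \<Longrightarrow> d (- 1) (d 1 v) = C v + ((x n + 1) * x n) *s v"
proof -
  assume v: "v \<in> V n"
  have "d (- 1) (d 1 v) = d 1 (d (- 1) v) + (2 * x n) *s v"
    using bracket[of "- 1" 1 v] by (simp add: d0_V[OF v] algebra_simps)
  also have "\<dots> = C v + (x n * (x n - 1) + 2 * x n) *s v"
    unfolding d1_dm1[OF v] by (simp add: scale_left_distrib add.assoc)
  also have "x n * (x n - 1) + 2 * x n = (x n + 1) * x n" by (simp add: algebra_simps)
  finally show ?thesis .
qed

lemma C_d1: "v \<in> V n \<Longrightarrow> C (d 1 v) = d 1 (C v)"
proof -
  assume v: "v \<in> V n"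
  have "C (d 1 v) + ((x n + 1) * x n) *s d 1 v = d 1 (d (- 1) (d 1 v))"
    using d1_dm1[OF d_V[OF v, of 1]] by (simp add: x_add)
  also have "\<dots> = d 1 (C v) + ((x n + 1) * x n) *s d 1 v" unfolding dm1_d1[OF v] by (simp add: d_simps)
  finally show ?thesis by simp
qed

lemma C_dm1: "v \<in> V n \<Longrightarrow> C (d (- 1) v) = d (- 1) (C v)"
proof -
  assume v: "v \<in> V n"
  have "C (d (- 1) v) + (x n * (x n - 1)) *s d (- 1) v = d (- 1) (d 1 (d (- 1) v))"
    using dm1_d1[OF d_V[OF v, of "- 1"]] by (simp add: x_add)
  also have "\<dots> = d (- 1) (C v) + (x n * (x n - 1)) *s d (- 1) v" unfolding d1_dm1[OF v] by (simp add: d_simps)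
  finally show ?thesis by simp
qed

lemma d1_d1_dm2: "v \<in> V n \<Longrightarrow> d 1 (d 1 (d (- 2) v)) = b v + (xi (x n) *s v + (3 * x n) *s C v)"
proof -
  assume v: "v \<in> V n"
  have "((d 0 (d 0 (d 0 v)) - 3 *s d 0 (d 0 v)) + 2 *s d 0 v) = xi (x n) *s v"
  proof -
    have e2: "d 0 (d 0 v) = (x n * x n) *s v" by (simp add: d0_V[OF v] d_simps)
    then have e3: "d 0 (d 0 (d 0 v)) = (x n * x n * x n) *s v" by (simp add: d0_V[OF v] d_simps)
    have "x n * x n * x n - 3 * (x n * x n) + 2 * x n = xi (x n)" by (simp add: xi_def algebra_simps)
    then show ?thesis unfolding e3 unfolding e2 unfolding d0_V[OF v] scale_scale scale_merge by simp
  qed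
  moreover have "3 *s C (d 0 v) = (3 * x n) *s C v" by (simp add: d0_V[OF v] lin_simps[OF lin_C])
  ultimately show ?thesis unfolding b_def by simp
qed

lemma dm2_d1: "d (- 2) (d 1 v) = d 1 (d (- 2) v) + 3 *s d (- 1) v"
  using bracket[of "- 2" 1 v] by (simp add: algebra_simps)

lemma b_d1: "v \<in> V n \<Longrightarrow> b (d 1 v) = d 1 (b v)"
proof -
  assume v: "v \<in> V n"
  have e: "x (n + 1) = x n + 1" by (simp add: x_add)
  have "b (d 1 v) + (xi (x n + 1) *s d 1 v + (3 * (x n + 1)) *s d 1 (C v)) = d 1 (d 1 (d (- 2) (d 1 v)))"
    using d1_d1_dm2[OF d_V[OF v, of 1]] unfolding e C_d1[OF v] by simp
  also have "\<dots> = d 1 (d 1 (d 1 (d (- 2) v))) + 3 *s d 1 (d 1 (d (- 1) v))"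
    unfolding dm2_d1 by (simp add: d_simps)
  also have "\<dots> = d 1 (b v) + ((xi (x n) + 3 * (x n * (x n - 1))) *s d 1 v + (3 * x n + 3) *s d 1 (C v))"
    unfolding d1_d1_dm2[OF v] d1_dm1[OF v]
    by (simp add: d_simps scale_right_distrib scale_left_distrib)
  also have "xi (x n) + 3 * (x n * (x n - 1)) = xi (x n + 1)" by (simp add: xi_def algebra_simps)
  also have "3 * x n + 3 = 3 * (x n + 1)" by simp
  finally show ?thesis by simp
qed

text \<open>\<open>C\<close> commutes with \<open>d 1\<close> and \<open>d (- 1)\<close>, and the
  bracket of \<open>d (- 2)\<close> with \<open>d 1\<close> is \<open>3 d (- 1)\<close>; so the
  bracket of \<open>C\<close> with \<open>d (- 2)\<close> commutes with \<open>d 1\<close>.\<close>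

lemma Y_d1: "v \<in> V n \<Longrightarrow> Y (d 1 v) = d 1 (Y v)"
proof -
  assume v: "v \<in> V n"
  have "Y (d 1 v) = C (d 1 (d (- 2) v)) + 3 *s C (d (- 1) v) - d (- 2) (d 1 (C v))"
    unfolding Y_def C_d1[OF v] dm2_d1 by (simp add: lin_simps[OF lin_C])
  also have "\<dots> = d 1 (C (d (- 2) v)) + 3 *s d (- 1) (C v) - (d 1 (d (- 2) (C v)) + 3 *s d (- 1) (C v))"
    unfolding dm2_d1 C_dm1[OF v] using C_d1[OF d_V[OF v, of "- 2"]] by simp
  also have "\<dots> = d 1 (Y v)" by (simp add: Y_def d_simps)
  finally show ?thesis .
qed

text \<open>\<open>b\<close> differs from \<open>d 1 d 1 d (- 2)\<close> only by terms in
  \<open>d 0\<close> and \<open>C\<close>, with which \<open>C\<close> commutes. What matters is the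
  factor \<open>d 1 d 1\<close>: without it the commutator becomes the word \<open>Y\<close> of
  weight -2, which \<open>d 2\<close> completes to a word of weight 0.\<close>

lemma C_b_commutator: "v \<in> V n \<Longrightarrow> C (b v) - b (C v) = d 1 (d 1 (Y v))"
proof -
  assume v: "v \<in> V n"
  have w: "d (- 2) v \<in> V (n - 2)" "d 1 (d (- 2) v) \<in> V (n - 1)"
    using d_V[OF v, of "- 2"] d_V[OF d_V[OF v, of "- 2"], of 1] by simp_all
  have "C (d 1 (d 1 (d (- 2) v))) = d 1 (d 1 (C (d (- 2) v)))" using C_d1[OF w(2)] C_d1[OF w(1)] by simp
  moreover have "C (d 1 (d 1 (d (- 2) v))) = C (b v) + (xi (x n) *s C v + (3 * x n) *s C (C v))"
    unfolding d1_d1_dm2[OF v] by (simp add: lin_simps[OF lin_C])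
  moreover have "d 1 (d 1 (d (- 2) (C v))) = b (C v) + (xi (x n) *s C v + (3 * x n) *s C (C v))"
    by (rule d1_d1_dm2[OF C_in[OF v]])
  ultimately show ?thesis by (simp add: Y_def d_simps algebra_simps)
qed

end

section \<open>Traces and matrix entries with respect to a finite basis\<close>

context complex_vector_space
begin

definition tr :: "'v set \<Rightarrow> ('v \<Rightarrow> 'v) \<Rightarrow> complex" where
  "tr B f = (\<Sum>e\<in>B. representation B (f e) e)"

definition ent :: "'v set \<Rightarrow> ('v \<Rightarrow> 'v) \<Rightarrow> 'v \<Rightarrow> 'v \<Rightarrow> complex" where
  "ent B f i j = representation B (f j) i"

lemma representation_sum_scale:
  assumes "independent B" "finite A" "\<And>a. a \<in> A \<Longrightarrow> w a \<in> span B"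
  shows "representation B (\<Sum>a\<in>A. c a *s w a) i = (\<Sum>a\<in>A. c a * representation B (w a) i)"
  using assms(2,3)
proof (induction A rule: finite_induct)
  case (insert a A)
  then have "(\<Sum>a\<in>A. c a *s w a) \<in> span B" by (intro span_sum span_scale) auto
  then show ?case using insert assms(1)
    by (simp add: representation_add representation_scale span_scale)
qed (simp add: representation_zero)

lemma ent_comp:
  assumes B: "finite B" "independent B" and f: "lin f" "\<And>v. v \<in> span B \<Longrightarrow> f v \<in> span B"
    and g: "g j \<in> span B"
  shows "ent B (\<lambda>v. f (g v)) i j = (\<Sum>k\<in>B. ent B f i k * ent B g k j)"
proof -
  have "f (g j) = f (\<Sum>k\<in>B. representation B (g j) k *s k)"
    using sum_representation_eq[OF B(2) g B(1) subset_refl] by simp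
  also have "\<dots> = (\<Sum>k\<in>B. representation B (g j) k *s f k)"
    by (simp add: lin_sum[OF f(1)] lin_scale[OF f(1)])
  finally have "representation B (f (g j)) i = representation B (\<Sum>k\<in>B. representation B (g j) k *s f k) i"
    by (rule arg_cong)
  also have "\<dots> = (\<Sum>k\<in>B. representation B (g j) k * representation B (f k) i)"
    by (rule representation_sum_scale[OF B(2,1)]) (rule f(2)[OF span_base])
  finally have "representation B (f (g j)) i = (\<Sum>k\<in>B. representation B (g j) k * representation B (f k) i)" .
  then show ?thesis by (simp add: ent_def mult.commute)
qed

lemma tr_ent: "tr B f = (\<Sum>i\<in>B. ent B f i i)"
  by (simp add: tr_def ent_def)

lemma tr_comp:
  assumes "finite B" "independent B" "lin f" "lin g"
    "\<And>v. v \<in> span B \<Longrightarrow> f v \<in> span B" "\<And>v. v \<in> span B \<Longrightarrow> g v \<in> span B"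
  shows "tr B (\<lambda>v. f (g v)) = (\<Sum>i\<in>B. \<Sum>k\<in>B. ent B f i k * ent B g k i)"
proof -
  have "ent B (\<lambda>v. f (g v)) i i = (\<Sum>k\<in>B. ent B f i k * ent B g k i)" if "i \<in> B" for i
    by (rule ent_comp[where f = f and g = g]) (use assms span_base[OF that] in auto)
  then show ?thesis by (simp add: tr_ent)
qed

lemma tr_commute:
  assumes "finite B" "independent B" "lin f" "lin g"
    "\<And>v. v \<in> span B \<Longrightarrow> f v \<in> span B" "\<And>v. v \<in> span B \<Longrightarrow> g v \<in> span B"
  shows "tr B (\<lambda>v. f (g v)) = tr B (\<lambda>v. g (f v))"
proof -
  have "tr B (\<lambda>v. f (g v)) = (\<Sum>i\<in>B. \<Sum>k\<in>B. ent B f i k * ent B g k i)" by (rule tr_comp) (fact assms)+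
  also have "\<dots> = (\<Sum>k\<in>B. \<Sum>i\<in>B. ent B f i k * ent B g k i)" by (rule sum.swap)
  also have "\<dots> = (\<Sum>k\<in>B. \<Sum>i\<in>B. ent B g k i * ent B f i k)" by (simp only: mult.commute)
  also have "\<dots> = tr B (\<lambda>v. g (f v))" by (rule tr_comp[symmetric]) (fact assms)+
  finally show ?thesis .
qed

lemma tr_cong: "(\<And>v. v \<in> B \<Longrightarrow> f v = g v) \<Longrightarrow> tr B f = tr B g"
  by (simp add: tr_def)

lemma tr_add:
  assumes "independent B" "\<And>v. v \<in> B \<Longrightarrow> f v \<in> span B" "\<And>v. v \<in> B \<Longrightarrow> g v \<in> span B"
  shows "tr B (\<lambda>v. f v + g v) = tr B f + tr B g"
  using assms by (simp add: tr_def representation_add sum.distrib)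

lemma tr_diff:
  assumes "independent B" "\<And>v. v \<in> B \<Longrightarrow> f v \<in> span B" "\<And>v. v \<in> B \<Longrightarrow> g v \<in> span B"
  shows "tr B (\<lambda>v. f v - g v) = tr B f - tr B g"
  using assms by (simp add: tr_def representation_diff sum_subtractf)

lemma tr_scale:
  assumes "independent B" "\<And>v. v \<in> B \<Longrightarrow> f v \<in> span B"
  shows "tr B (\<lambda>v. c *s f v) = c * tr B f"
  using assms by (simp add: tr_def representation_scale sum_distrib_left)

end

section \<open>The half line: identification of the weight spaces with \<open>V 0\<close>,
  quasi-polynomial traces, recursions for \<open>d 2\<close>\<close>

locale vir_half = vir_module scale d lam kap N
  for scale :: "complex \<Rightarrow> 'v::ab_group_add \<Rightarrow> 'v" (infixr "*s" 75) and d lam kap N +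
  assumes bij: "0 \<le> n \<Longrightarrow> bij_betw (d 1) (V n) (V (n + 1))"
    and V0: "V 0 \<noteq> {0}"
begin

definition g :: "nat \<Rightarrow> 'v \<Rightarrow> 'v" where "g n = d 1 ^^ n"

lemma lin_g: "lin (g n)"
  unfolding g_def by (rule lin_funpow[OF lin_d])

lemma g_Suc: "g (Suc n) u = d 1 (g n u)"
  by (simp add: g_def)

lemma bij_g: "bij_betw (g n) (V 0) (V (int n))"
proof (induction n)
  case (Suc n)
  have e: "g (Suc n) = d 1 \<circ> g n" by (simp add: g_def)
  have i: "int (Suc n) = int n + 1" by simp
  show ?case unfolding e i by (rule bij_betw_trans[OF Suc bij]) simp
qed (simp add: g_def bij_betw_id[unfolded id_def])

lemma g_in: "u \<in> V 0 \<Longrightarrow> g n u \<in> V (int n)"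
  using bij_g[of n] by (auto simp: bij_betw_def)

lemma g_inj: "u \<in> V 0 \<Longrightarrow> w \<in> V 0 \<Longrightarrow> g n u = g n w \<Longrightarrow> u = w"
  using bij_g[of n] by (auto simp: bij_betw_def inj_on_def)

text \<open>A left inverse of \<open>g n\<close> that is linear on the whole type and takes all its
  values in \<open>V 0\<close>. With it \<open>hat\<close> is defined, linear and
  \<open>V 0\<close>-valued on every argument; off \<open>V (int n)\<close> its values depend on the
  choice.\<close>

definition q :: "nat \<Rightarrow> 'v \<Rightarrow> 'v" where
  "q n = (SOME h. range h \<subseteq> V 0 \<and> lin h \<and> (\<forall>v\<in>V 0. h (g n v) = v))"

lemma q_props: "range (q n) \<subseteq> V 0 \<and> lin (q n) \<and> (\<forall>v\<in>V 0. q n (g n v) = v)"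
proof -
  have vsp: "vector_space_pair scale scale"
    by (simp add: vector_space_pair_def vector_space_axioms)
  have "inj_on (g n) (V 0)" using bij_g by (simp add: bij_betw_def)
  from vector_space_pair.linear_exists_left_inverse_on[OF vsp lin_g subspace_V this]
  have "\<exists>h. range h \<subseteq> V 0 \<and> lin h \<and> (\<forall>v\<in>V 0. h (g n v) = v)" .
  then show ?thesis unfolding q_def by (rule someI_ex)
qed

lemma q_in: "q n v \<in> V 0" and lin_q: "lin (q n)" and q_g: "v \<in> V 0 \<Longrightarrow> q n (g n v) = v"
  using q_props[of n] by auto

lemma g_q: "w \<in> V (int n) \<Longrightarrow> g n (q n w) = w"
proof -
  assume "w \<in> V (int n)"
  then obtain u where "u \<in> V 0" "w = g n u" using bij_g[of n] by (auto simp: bij_betw_def)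
  then show ?thesis by (simp add: q_g)
qed

definition hat :: "('v \<Rightarrow> 'v) \<Rightarrow> nat \<Rightarrow> nat \<Rightarrow> 'v \<Rightarrow> 'v" where "hat \<phi> j k u = q k (\<phi> (g j u))"

lemma hat_in: "hat \<phi> j k u \<in> V 0"
  by (simp add: hat_def q_in)

lemma lin_hat: "lin \<phi> \<Longrightarrow> lin (hat \<phi> j k)"
  unfolding hat_def[abs_def] by (intro lin_comp'[OF lin_q] lin_comp'[OF _ lin_g])

lemma g_hat: "combs s \<phi> \<Longrightarrow> int k = int j + s \<Longrightarrow> u \<in> V 0 \<Longrightarrow> g k (hat \<phi> j k u) = \<phi> (g j u)"
  unfolding hat_def by (rule g_q) (use combs_V[OF _ g_in] in fastforce)

lemma hat_comp:
  "combs s \<phi> \<Longrightarrow> int k = int j + s \<Longrightarrow> u \<in> V 0 \<Longrightarrow> hat (\<lambda>v. \<psi> (\<phi> v)) j l u = hat \<psi> k l (hat \<phi> j k u)"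
  using g_hat[of s \<phi> k j u] by (simp add: hat_def)

context
  fixes B assumes B: "finite B" "independent B" "span B = V 0"
begin

lemma B_in: "e \<in> B \<Longrightarrow> e \<in> V 0"
  using span_base[of e B] B(3) by simp

text \<open>By cyclicity the trace of \<open>d i \<phi>\<close> on \<open>V j\<close> equals that of
  \<open>\<phi> d i\<close> on \<open>V (j - i)\<close>, which differs from the trace of
  \<open>d i \<phi>\<close> there by the trace of a commutator no longer than \<open>\<phi>\<close>.
  So the difference with step \<open>\<bar>i\<bar>\<close> is covered by induction. For
  \<open>i = 0\<close> the operator \<open>d 0\<close> is the scalar
  \<open>lam + of_nat j\<close>.\<close>

lemma trace_quasi_poly: "comb r s \<phi> \<Longrightarrow> s = 0 \<Longrightarrow> quasi_poly (\<lambda>j. tr B (hat \<phi> j j))"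
proof (induction r arbitrary: s \<phi> rule: less_induct)
  case (less r)
  \<comment> \<open>The outer induction runs over the length because the commutator is not a premise
    of the rule \<open>step\<close>; the inner one follows the construction of the word.\<close>
  have "comb r0 s \<phi> \<Longrightarrow> r0 \<le> r \<Longrightarrow> s = 0 \<Longrightarrow> quasi_poly (\<lambda>j. tr B (hat \<phi> j j))" for r0 s \<phi>
  proof (induction rule: comb.induct)
    case id
    have "tr B (hat (\<lambda>v. v) j j) = tr B (\<lambda>v. v)" for j
      by (rule tr_cong) (simp add: hat_def q_g B_in)
    moreover have "quasi_poly (\<lambda>j::nat. tr B (\<lambda>v. v))"
      by (rule quasi_poly.step[of 1]) (auto intro: quasi_poly.zero)
    ultimately show ?case by simp
  next
    case (zero r s)
    have "tr B (hat (\<lambda>v. 0) j j) = 0" for j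
      by (simp add: tr_def hat_def lin_0[OF lin_q] representation_zero)
    then show ?case by (intro quasi_poly.zero) simp
  next
    case (mono r s \<phi>)
    then show ?case by simp
  next
    case (add r s \<phi> \<psi>)
    have "tr B (hat (\<lambda>v. \<phi> v + \<psi> v) j j) = tr B (hat \<phi> j j) + tr B (hat \<psi> j j)" for j
      using tr_add[OF B(2), of "hat \<phi> j j" "hat \<psi> j j"] hat_in B(3)
      by (simp add: hat_def[abs_def] lin_add[OF lin_q])
    then show ?case using quasi_poly_add[OF add.IH(1) add.IH(2)] add.prems by simp
  next
    case (scale r s \<phi> c)
    have "tr B (hat (\<lambda>v. c *s \<phi> v) j j) = c * tr B (hat \<phi> j j)" for j
      using tr_scale[OF B(2), of "hat \<phi> j j" c] hat_in B(3)
      by (simp add: hat_def[abs_def] lin_scale[OF lin_q])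
    then show ?case using quasi_poly_cmult[OF scale.IH] scale.prems by simp
  next
    case (step r1 s1 \<phi> t i)
    have r1: "r1 < r" using step.prems by simp
    have s1: "s1 = - i" using step.hyps(2) step.prems by simp
    have c\<phi>: "combs (- i) \<phi>" using step.hyps(1) s1 by (auto simp: combs_def)
    show ?case
    proof (cases "i = 0")
      case True
      have "quasi_poly (\<lambda>j. tr B (hat \<phi> j j))" by (rule less.IH[OF r1 step.hyps(1)]) (simp add: s1 True)
      then have "quasi_poly (\<lambda>j. (lam + of_nat j) * tr B (hat \<phi> j j))" by (rule quasi_poly_linear_mult)
      moreover have "tr B (hat (\<lambda>v. d i (\<phi> v)) j j) = (lam + of_nat j) * tr B (hat \<phi> j j)" for j
      proof -
        have "hat (\<lambda>v. d i (\<phi> v)) j j u = (lam + of_nat j) *s hat \<phi> j j u" if "u \<in> V 0" for u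
          using d0_V[OF combs_V[OF c\<phi> g_in[OF that, of j]]] True
          by (simp add: hat_def x_def lin_scale[OF lin_q])
        then have "tr B (hat (\<lambda>v. d i (\<phi> v)) j j) = tr B (\<lambda>u. (lam + of_nat j) *s hat \<phi> j j u)"
          by (intro tr_cong) (simp add: B_in)
        then show ?thesis using tr_scale[OF B(2), of "hat \<phi> j j"] hat_in B(3) by simp
      qed
      ultimately show ?thesis by simp
    next
      case False
      define f where "f j = tr B (hat (\<lambda>v. d i (\<phi> v)) j j)" for j
      define e where "e j = tr B (hat (\<lambda>v. d i (\<phi> v) - \<phi> (d i v)) j j)" for j
      have qe: "quasi_poly e"
        unfolding e_def by (rule less.IH[OF r1 comb_commutator[OF step.hyps(1)]]) (simp add: s1)
      have lphi: "lin \<phi>" by (rule combs_lin[OF c\<phi>])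
      have fe: "f j = f k - e k" if jk: "int k + i = int j" for j k
      proof -
        have kj: "int k = int j + (- i)" "int j = int k + i" using jk by auto
        have "f j = tr B (\<lambda>u. hat (d i) k j (hat \<phi> j k u))"
          unfolding f_def by (intro tr_cong hat_comp[OF c\<phi> kj(1)] B_in)
        also have "\<dots> = tr B (\<lambda>u. hat \<phi> j k (hat (d i) k j u))"
          using B hat_in by (intro tr_commute lin_hat lin_d lphi) auto
        also have "\<dots> = tr B (hat (\<lambda>v. \<phi> (d i v)) k k)"
          by (intro tr_cong hat_comp[OF combs_d kj(2), symmetric] B_in)
        also have "\<dots> = tr B (\<lambda>u. hat (\<lambda>v. d i (\<phi> v)) k k u - hat (\<lambda>v. d i (\<phi> v) - \<phi> (d i v)) k k u)"
          by (intro tr_cong) (simp add: hat_def lin_diff[OF lin_q])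
        also have "\<dots> = f k - e k"
          unfolding f_def e_def by (rule tr_diff[OF B(2)]) (simp_all add: hat_in B(3))
        finally show ?thesis .
      qed
      have "quasi_poly f"
      proof (cases "i > 0")
        case True
        have "quasi_poly (\<lambda>n. (- 1) * e n)" by (rule quasi_poly_cmult[OF qe])
        moreover have "f (n + nat i) - f n = (- 1) * e n" for n using fe[of n "n + nat i"] True by simp
        ultimately show ?thesis using True by (intro quasi_poly.step[of "nat i" f]) simp_all
      next
        case F: False
        have "quasi_poly (\<lambda>n. e (n + nat (- i)))" by (rule quasi_poly_shift[OF qe])
        moreover have "f (n + nat (- i)) - f n = e (n + nat (- i))" for n
          using fe[of "n + nat (- i)" n] F False by simp
        ultimately show ?thesis using F False by (intro quasi_poly.step[of "nat (- i)" f]) simp_all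
      qed
      then show ?thesis by (simp add: f_def[abs_def])
    qed
  qed
  then show ?case using less.prems by blast
qed

end

abbreviation E :: "nat \<Rightarrow> 'v \<Rightarrow> 'v" where "E n \<equiv> hat (d 2) n (n + 2)"

lemma g_E: "u \<in> V 0 \<Longrightarrow> g (n + 2) (E n u) = d 2 (g n u)"
  by (rule g_hat[OF combs_d]) simp_all

lemma C_g: "u \<in> V 0 \<Longrightarrow> C (g n u) = g n (C u)"
proof (induction n)
  case (Suc n)
  then show ?case using C_d1[OF g_in[of u n]] by (simp only: g_Suc)
qed (simp add: g_def)

lemma b_g: "u \<in> V 0 \<Longrightarrow> b (g n u) = g n (b u)"
proof (induction n)
  case (Suc n)
  then show ?case using b_d1[OF g_in[of u n]] by (simp only: g_Suc)
qed (simp add: g_def)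

text \<open>The bracket of \<open>d (- 1)\<close> and \<open>d 2\<close>, which is
  \<open>3 d 1\<close>, is applied to \<open>d 1 (g n u)\<close> and followed by \<open>d 1\<close>,
  so that \<open>d 1 d (- 1)\<close> can be expressed by \<open>C\<close>. The comparison takes
  place in \<open>V (n + 3)\<close>.\<close>

lemma E_recursion1:
  fixes n :: nat
  assumes u: "u \<in> V 0"
  defines "X \<equiv> x (int n)"
  shows "((X + 3) * (X + 2)) *s E (n + 1) u + C (E (n + 1) u) = ((X + 1) * X) *s E n u + E n (C u) + 3 *s u"
proof (rule g_inj[of _ _ "n + 3"])
  have sub: "subspace (V 0)" by (rule subspace_V)
  note inV = subspace_add[OF sub] subspace_scale[OF sub] hat_in C_in u
  show "((X + 3) * (X + 2)) *s E (n + 1) u + C (E (n + 1) u) \<in> V 0"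
    "((X + 1) * X) *s E n u + E n (C u) + 3 *s u \<in> V 0" by (intro inV)+
  let ?w = "g n u"
  have w: "?w \<in> V (int n)" by (rule g_in[OF u])
  have g3: "g (n + 3) v = d 1 (g (n + 2) v)" for v using g_Suc[of "n + 2" v] by (simp add: numeral_3_eq_3)
  have E1: "g (n + 3) (E (n + 1) u) = d 2 (d 1 ?w)" using g_E[OF u, of "n + 1"] by (simp add: g_Suc numeral_3_eq_3)
  have w3: "d 2 (d 1 ?w) \<in> V (int n + 3)" using d_V[OF d_V[OF w, of 1], of 2] by (simp add: add.assoc)
  have "g (n + 3) (((X + 3) * (X + 2)) *s E (n + 1) u + C (E (n + 1) u)) =
      C (d 2 (d 1 ?w)) + ((X + 3) * (X + 2)) *s d 2 (d 1 ?w)"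
    using C_g[OF hat_in, of "n + 3" "d 2" "n + 1" "n + 1 + 2" u] E1 by (simp add: lin_simps[OF lin_g])
  also have "\<dots> = d 1 (d (- 1) (d 2 (d 1 ?w)))"
  proof -
    have "x (int n + 3) = X + 3" by (simp add: X_def x_add)
    then show ?thesis unfolding d1_dm1[OF w3] by simp
  qed
  also have "d (- 1) (d 2 (d 1 ?w)) = d 2 (d (- 1) (d 1 ?w)) + 3 *s d 1 (d 1 ?w)"
    using bracket[of "- 1" 2 "d 1 ?w"] by (simp add: algebra_simps)
  also have "d (- 1) (d 1 ?w) = g n (C u) + ((X + 1) * X) *s ?w"
    unfolding dm1_d1[OF w] C_g[OF u] X_def by (rule refl)
  also have "d 1 (d 2 (g n (C u) + ((X + 1) * X) *s ?w) + 3 *s d 1 (d 1 ?w)) =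
      d 1 (d 2 (g n (C u))) + ((X + 1) * X) *s d 1 (d 2 ?w) + 3 *s d 1 (d 1 (d 1 ?w))"
    by (simp add: d_simps)
  also have "\<dots> = g (n + 3) (((X + 1) * X) *s E n u + E n (C u) + 3 *s u)"
    using g_E[OF u, of n] g_E[OF C_in[OF u], of n]
    by (simp add: lin_simps[OF lin_g] g3) (simp add: g_Suc numeral_2_eq_2)
  finally show "g (n + 3) (((X + 3) * (X + 2)) *s E (n + 1) u + C (E (n + 1) u)) =
    g (n + 3) (((X + 1) * X) *s E n u + E n (C u) + 3 *s u)" .
qed

text \<open>\<open>d1_d1_dm2\<close> gives the formula after two applications of \<open>d 1\<close>.
  They are cancelled by injectivity on \<open>V n\<close> and \<open>V (n + 1)\<close>, whence the
  index \<open>n + 2\<close> of the argument.\<close>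

lemma dm2_g: "u \<in> V 0 \<Longrightarrow> d (- 2) (g (n + 2) u) =
  g n (b u + (xi (x (int n + 2)) *s u + (3 * x (int n + 2)) *s C u))"
proof -
  assume u: "u \<in> V 0"
  let ?F = "b u + (xi (x (int n + 2)) *s u + (3 * x (int n + 2)) *s C u)"
  have F: "?F \<in> V 0" using u by (intro subspace_add[OF subspace_V] subspace_scale[OF subspace_V] b_in C_in)
  have w: "g (n + 2) u \<in> V (int n + 2)" using g_in[OF u, of "n + 2"] by (simp only: of_nat_add of_nat_numeral)
  have z: "d (- 2) (g (n + 2) u) \<in> V (int n)" using d_V[OF w, of "- 2"] by simp
  have "d 1 (d 1 (d (- 2) (g (n + 2) u))) = g (n + 2) ?F"
    unfolding d1_d1_dm2[OF w] by (simp add: C_g[OF u] b_g[OF u] lin_simps[OF lin_g])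
  also have "\<dots> = d 1 (d 1 (g n ?F))" by (simp add: g_Suc numeral_2_eq_2)
  finally have e: "d 1 (d 1 (d (- 2) (g (n + 2) u))) = d 1 (d 1 (g n ?F))" .
  have inj: "inj_on (d 1) (V (int n))" "inj_on (d 1) (V (int n + 1))"
    using bij[of "int n"] bij[of "int n + 1"] by (auto simp: bij_betw_def)
  have "d 1 (d (- 2) (g (n + 2) u)) = d 1 (g n ?F)"
    by (rule inj_onD[OF inj(2) e]) (use d_V[OF z, of 1] d_V[OF g_in[OF F, of n], of 1] in auto)
  then show ?thesis by (rule inj_onD[OF inj(1)]) (use z g_in[OF F, of n] in auto)
qed

lemma dm2_d2: "w \<in> V m \<Longrightarrow> d (- 2) (d 2 w) = d 2 (d (- 2) w) + (4 * x m - kap / 2) *s w"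
  using bracket[of "- 2" 2 w] by (simp add: d0_V algebra_simps)

text \<open>The bracket of \<open>d (- 2)\<close> and \<open>d 2\<close> is
  \<open>4 d 0 - kap / 2\<close>. It is used at weight index \<open>n + 2\<close>, where
  \<open>d 0\<close> is \<open>X + 2\<close>; hence the constant \<open>8 - kap / 2\<close>.\<close>

lemma E_recursion2:
  fixes n :: nat
  assumes u: "u \<in> V 0"
  defines "X \<equiv> x (int n)"
  shows "((X + 4) * (X + 3) * (X + 2)) *s E (n + 2) u + (3 * (X + 4)) *s C (E (n + 2) u) + b (E (n + 2) u) =
    ((X + 2) * (X + 1) * X) *s E n u + (3 * (X + 2)) *s E n (C u) + E n (b u) + (4 * X + (8 - kap / 2)) *s u"
proof (rule g_inj[of _ _ "n + 2"])
  have sub: "subspace (V 0)" by (rule subspace_V)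
  note inV = subspace_add[OF sub] subspace_scale[OF sub] hat_in C_in b_in u
  show "((X + 4) * (X + 3) * (X + 2)) *s E (n + 2) u + (3 * (X + 4)) *s C (E (n + 2) u) + b (E (n + 2) u) \<in> V 0"
    "((X + 2) * (X + 1) * X) *s E n u + (3 * (X + 2)) *s E n (C u) + E n (b u) + (4 * X + (8 - kap / 2)) *s u \<in> V 0"
    by (intro inV)+
  let ?w = "g (n + 2) u"
  have w: "?w \<in> V (int n + 2)" using g_in[OF u, of "n + 2"] by (simp only: of_nat_add of_nat_numeral)
  have x4: "x (int (n + 2) + 2) = X + 4" by (simp add: X_def x_def)
  have xi4: "xi (X + 4) = (X + 4) * (X + 3) * (X + 2)" by (simp add: xi_def add.commute)
  have x2: "x (int n + 2) = X + 2" by (simp add: X_def x_def)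
  have xi2: "xi (X + 2) = (X + 2) * (X + 1) * X" by (simp add: xi_def add.commute)
  have "g (n + 2) (((X + 4) * (X + 3) * (X + 2)) *s E (n + 2) u + (3 * (X + 4)) *s C (E (n + 2) u) + b (E (n + 2) u))
      = d (- 2) (g (n + 2 + 2) (E (n + 2) u))"
    unfolding dm2_g[OF hat_in, of "n + 2"] x4 xi4 by (simp add: add_ac)
  also have "\<dots> = d (- 2) (d 2 ?w)" by (simp only: g_E[OF u])
  also have "\<dots> = d 2 (d (- 2) ?w) + (4 * x (int n + 2) - kap / 2) *s ?w"
    by (rule dm2_d2[OF w])
  also have "d (- 2) ?w = g n (b u + (xi (x (int n + 2)) *s u + (3 * x (int n + 2)) *s C u))" by (rule dm2_g[OF u])
  also have "d 2 \<dots> = g (n + 2) (E n (b u + (xi (x (int n + 2)) *s u + (3 * x (int n + 2)) *s C u)))"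
    by (rule g_E[symmetric]) (intro inV)
  also have "E n (b u + (xi (x (int n + 2)) *s u + (3 * x (int n + 2)) *s C u)) =
      E n (b u) + (((X + 2) * (X + 1) * X) *s E n u + (3 * (X + 2)) *s E n (C u))"
    unfolding x2 xi2 using lin_hat[OF lin_d] by (simp add: lin_simps)
  also have "4 * x (int n + 2) - kap / 2 = 4 * X + (8 - kap / 2)" unfolding x2 by simp
  also have "g (n + 2) (E n (b u) + (((X + 2) * (X + 1) * X) *s E n u + (3 * (X + 2)) *s E n (C u))) + (4 * X + (8 - kap / 2)) *s ?w
      = g (n + 2) (((X + 2) * (X + 1) * X) *s E n u + (3 * (X + 2)) *s E n (C u) + E n (b u) + (4 * X + (8 - kap / 2)) *s u)"
    by (simp add: lin_simps[OF lin_g] add_ac)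
  finally show "g (n + 2) (((X + 4) * (X + 3) * (X + 2)) *s E (n + 2) u + (3 * (X + 4)) *s C (E (n + 2) u) + b (E (n + 2) u)) =
    g (n + 2) (((X + 2) * (X + 1) * X) *s E n u + (3 * (X + 2)) *s E n (C u) + E n (b u) + (4 * X + (8 - kap / 2)) *s u)" .
qed

end

context complex_vector_space
begin

lemma representation_outside:
  assumes "independent B" "B1 \<subseteq> B" "v \<in> span B1" "i \<notin> B1"
  shows "representation B v i = 0"
  using representation_extend[OF assms(1,3,2)] representation_ne_zero[of B1 v i] assms(4) by auto

lemma in_span_subbasis:
  assumes "finite B" "independent B" "B1 \<subseteq> B" "v \<in> span B" "\<And>i. i \<in> B - B1 \<Longrightarrow> representation B v i = 0"
  shows "v \<in> span B1"
proof -
  have "v = (\<Sum>i\<in>B. representation B v i *s i)"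
    using sum_representation_eq[OF assms(2,4,1) subset_refl] by simp
  also have "\<dots> = (\<Sum>i\<in>B1. representation B v i *s i)"
    using assms(1,3,5) by (intro sum.mono_neutral_right) auto
  finally have e: "v = (\<Sum>i\<in>B1. representation B v i *s i)" .
  show ?thesis by (subst e) (intro span_sum span_scale span_base)
qed

lemma dim_image_less:
  assumes W: "fdim N W" and f: "lin f" and z: "z \<in> W" "z \<noteq> 0" "f z = 0"
  shows "dim (f ` W) < dim W"
proof -
  have "independent {z}" using z(2) by simp
  then obtain B where B: "finite B" "independent B" "{z} \<subseteq> B" "B \<subseteq> W" "span B = W"
    using fdim_basis_extend[OF W, of "{z}"] z(1) by auto
  have "f ` W \<subseteq> span (f ` (B - {z}))"
  proof
    fix y assume "y \<in> f ` W"
    then obtain w where w: "w \<in> span B" "y = f w" using B(5) by auto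
    have "f w \<in> span (f ` (B - {z}))"
    proof (rule lin_image_span[OF f _ subspace_span w(1)])
      fix e assume "e \<in> B"
      then show "f e \<in> span (f ` (B - {z}))"
        using z(3) by (cases "e = z") (auto intro: span_zero span_base)
    qed
    then show "y \<in> span (f ` (B - {z}))" using w(2) by simp
  qed
  then have "dim (f ` W) \<le> card (f ` (B - {z}))" by (rule dim_le_card) (use B(1) in simp)
  also have "\<dots> \<le> card (B - {z})" by (rule card_image_le) (use B(1) in simp)
  also have "\<dots> < card B" using B(1,3) by (intro card_Diff1_less) auto
  also have "card B = dim W" using dim_span_eq_card_independent[OF B(2)] B(5) by simp
  finally show ?thesis .
qed

end

context vir_half
begin

lemma fd0: "fdim N (V 0)" by (rule fdim_V)

lemma lin_E: "lin (E n)" by (rule lin_hat[OF lin_d])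

context
  fixes B assumes B: "finite B" "independent B" "span B = V 0"
begin

lemma B_V0: "e \<in> B \<Longrightarrow> e \<in> V 0"
  using span_base[of e B] B(3) by simp

lemma representation_simps:
  assumes "u \<in> V 0" "w \<in> V 0"
  shows "representation B (u + w) i = representation B u i + representation B w i"
    "representation B (c *s u) i = c * representation B u i"
  using assms B by (simp_all add: representation_add representation_scale)

lemma ent_comp_V0:
  assumes "lin f" "\<And>v. v \<in> V 0 \<Longrightarrow> f v \<in> V 0" "h j \<in> V 0"
  shows "representation B (f (h j)) i = (\<Sum>k\<in>B. ent B f i k * ent B h k j)"
  using ent_comp[OF B(1,2) assms(1), of h j i] assms(2,3) B(3) by (simp add: ent_def)

lemma ent_recursion1:
  fixes n :: nat
  assumes "i \<in> B" "j \<in> B"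
  defines "X \<equiv> lam + of_nat n"
  shows "(X + 3) * (X + 2) * ent B (E (n + 1)) i j + (\<Sum>k\<in>B. ent B C i k * ent B (E (n + 1)) k j) =
    (X + 1) * X * ent B (E n) i j + (\<Sum>k\<in>B. ent B (E n) i k * ent B C k j) + 3 * (if i = j then 1 else 0)"
proof -
  have j: "j \<in> V 0" using B_V0 assms by simp
  have Xx: "x (int n) = X" by (simp add: X_def x_def)
  note E_recursion1[OF j, of n, unfolded Xx]
  from arg_cong[OF this, of "\<lambda>v. representation B v i"]
  have "(X + 3) * (X + 2) * representation B (E (n + 1) j) i + representation B (C (E (n + 1) j)) i =
      (X + 1) * X * representation B (E n j) i + representation B (E n (C j)) i + 3 * representation B j i"
    using subspace_add[OF subspace_V] subspace_scale[OF subspace_V] hat_in C_in j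
    by (simp add: representation_simps)
  moreover have "representation B (C (E (n + 1) j)) i = (\<Sum>k\<in>B. ent B C i k * ent B (E (n + 1)) k j)"
    by (rule ent_comp_V0[where f = C and h = "E (n + 1)", OF lin_C C_in hat_in])
  moreover have "representation B (E n (C j)) i = (\<Sum>k\<in>B. ent B (E n) i k * ent B C k j)"
    by (rule ent_comp_V0[where f = "E n" and h = C, OF lin_E hat_in C_in[OF j]])
  moreover have "representation B j i = (if i = j then 1 else 0)"
    using representation_basis[OF B(2) assms(2)] by auto
  ultimately show ?thesis by (simp add: ent_def)
qed

lemma ent_recursion2:
  fixes n :: nat
  assumes "i \<in> B" "j \<in> B"
  defines "X \<equiv> lam + of_nat n"
  shows "(X + 4) * (X + 3) * (X + 2) * ent B (E (n + 2)) i j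
      + 3 * (X + 4) * (\<Sum>k\<in>B. ent B C i k * ent B (E (n + 2)) k j)
      + (\<Sum>k\<in>B. ent B b i k * ent B (E (n + 2)) k j) =
    (X + 2) * (X + 1) * X * ent B (E n) i j + 3 * (X + 2) * (\<Sum>k\<in>B. ent B (E n) i k * ent B C k j)
      + (\<Sum>k\<in>B. ent B (E n) i k * ent B b k j) + (4 * X + (8 - kap / 2)) * (if i = j then 1 else 0)"
proof -
  have j: "j \<in> V 0" using B_V0 assms by simp
  have Xx: "x (int n) = X" by (simp add: X_def x_def)
  note E_recursion2[OF j, of n, unfolded Xx]
  from arg_cong[OF this, of "\<lambda>v. representation B v i"]
  have "(X + 4) * (X + 3) * (X + 2) * representation B (E (n + 2) j) i
      + 3 * (X + 4) * representation B (C (E (n + 2) j)) i + representation B (b (E (n + 2) j)) i =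
      (X + 2) * (X + 1) * X * representation B (E n j) i + 3 * (X + 2) * representation B (E n (C j)) i
      + representation B (E n (b j)) i + (4 * X + (8 - kap / 2)) * representation B j i"
    using subspace_add[OF subspace_V] subspace_scale[OF subspace_V] hat_in C_in b_in j
    by (simp only: representation_simps)
  moreover have "representation B (C (E (n + 2) j)) i = (\<Sum>k\<in>B. ent B C i k * ent B (E (n + 2)) k j)"
    by (rule ent_comp_V0[where f = C and h = "E (n + 2)", OF lin_C C_in hat_in])
  moreover have "representation B (b (E (n + 2) j)) i = (\<Sum>k\<in>B. ent B b i k * ent B (E (n + 2)) k j)"
    by (rule ent_comp_V0[where f = b and h = "E (n + 2)", OF lin_b b_in hat_in])
  moreover have "representation B (E n (C j)) i = (\<Sum>k\<in>B. ent B (E n) i k * ent B C k j)"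
    by (rule ent_comp_V0[where f = "E n" and h = C, OF lin_E hat_in C_in[OF j]])
  moreover have "representation B (E n (b j)) i = (\<Sum>k\<in>B. ent B (E n) i k * ent B b k j)"
    by (rule ent_comp_V0[where f = "E n" and h = b, OF lin_E hat_in b_in[OF j]])
  moreover have "representation B j i = (if i = j then 1 else 0)"
    using representation_basis[OF B(2) assms(2)] by auto
  ultimately show ?thesis by (simp add: ent_def)
qed

text \<open>The recursion estimate with \<open>T\<close> the identity matrix: to leading order
  \<open>d 2\<close> is \<open>d 1 d 1\<close> divided by \<open>x\<close>. The norm of the scaled
  \<open>E\<close> on its right side is bounded by \<open>D n + nrm B B T\<close>, which is the form
  needed for decay.\<close>

lemma E_limit:
  assumes ij: "i \<in> B" "j \<in> B"
  shows "(\<lambda>n. (lam + of_nat n) * ent B (E (n + 2)) i j) \<longlonglongrightarrow> (if i = j then 1 else 0)"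
proof -
  define T :: "'v \<Rightarrow> 'v \<Rightarrow> complex" where "T i j = (if i = j then 1 else 0)" for i j
  define D where "D n = nrm B B (\<lambda>i j. (lam + of_nat n) * ent B (E (n + 2)) i j - T i j)" for n
  obtain K where K: "\<forall>\<^sub>F n in sequentially. cmod (lam + of_nat n) * D n \<le>
      K * (nrm B B (\<lambda>i j. (lam + of_nat n) * ent B (E (n + 2)) i j) + nrm B B T)"
    using two_step_recursion_asymptotics[OF B(1) B(1), of lam "\<lambda>n. ent B (E n)" "ent B C" "ent B C" T "ent B b" "ent B b" "8 - kap / 2"]
      ent_recursion1 ent_recursion2 unfolding D_def T_def by blast
  have "\<forall>\<^sub>F n in sequentially. cmod (lam + of_nat n) * D n \<le> \<bar>K\<bar> * (D n + 2 * nrm B B T)"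
    using K
  proof eventually_elim
    case (elim n)
    have "nrm B B (\<lambda>i j. (lam + of_nat n) * ent B (E (n + 2)) i j) \<le> D n + nrm B B T"
      using nrm_add[of B B "\<lambda>i j. (lam + of_nat n) * ent B (E (n + 2)) i j - T i j" T] by (simp add: D_def)
    then have "K * (nrm B B (\<lambda>i j. (lam + of_nat n) * ent B (E (n + 2)) i j) + nrm B B T) \<le> \<bar>K\<bar> * (D n + 2 * nrm B B T)"
      by (intro mult_mono) auto
    then show ?case using elim by linarith
  qed
  then have D0: "D \<longlonglongrightarrow> 0" by (rule growing_factor_decay) (simp add: D_def)
  have "(\<lambda>n. (lam + of_nat n) * ent B (E (n + 2)) i j - T i j) \<longlonglongrightarrow> 0"
  proof (rule tendsto_0_le[OF D0, where K = 1], rule always_eventually, rule allI)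
    fix n show "norm ((lam + of_nat n) * ent B (E (n + 2)) i j - T i j) \<le> norm (D n) * 1"
      using nrm_entry[OF B(1) B(1) ij, of "\<lambda>i j. (lam + of_nat n) * ent B (E (n + 2)) i j - T i j"]
      by (simp add: D_def)
  qed
  then show ?thesis unfolding T_def by (rule LIM_zero_cancel)
qed

end

text \<open>In a basis adapted to \<open>W\<close> the matrices of \<open>C\<close> and
  \<open>b\<close> are block triangular, so the block of \<open>E n\<close> that leads out of
  \<open>W\<close> satisfies the two recursions by itself, with \<open>T = 0\<close>. Without an
  inhomogeneous term the estimate says that the modulus of \<open>x\<close> times the norm of the
  block is at most \<open>K\<close> times that norm, so the block is zero for large
  \<open>n\<close>.\<close>

lemma E_preserves:
  assumes W: "subspace W" "W \<subseteq> V 0" "\<And>w. w \<in> W \<Longrightarrow> C w \<in> W" "\<And>w. w \<in> W \<Longrightarrow> b w \<in> W"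
  shows "\<exists>M. \<forall>n\<ge>M. \<forall>w\<in>W. E n w \<in> W"
proof -
  obtain B1 where B1: "finite B1" "independent B1" "B1 \<subseteq> W" "span B1 = W"
    using fdim_basis[OF fdim_mono[OF fd0 W(1,2)]] by metis
  obtain B where B: "finite B" "independent B" "B1 \<subseteq> B" "B \<subseteq> V 0" "span B = V 0"
    using fdim_basis_extend[OF fd0 B1(2)] B1(3) W(2) by (metis order_trans)
  note Bs = B(1,2,5)
  let ?I = "B - B1"
  have fin: "finite ?I" "finite B1" using B(1) B1(1) by auto
  have z: "ent B f i k = 0" if "i \<in> ?I" "k \<in> B1" "\<And>w. w \<in> W \<Longrightarrow> f w \<in> W" for f i k
    unfolding ent_def using that B1 by (intro representation_outside[OF B(2,3)]) auto
  have s1: "(\<Sum>k\<in>B. ent B f i k * ent B h k j) = (\<Sum>k\<in>?I. ent B f i k * ent B h k j)"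
    if "i \<in> ?I" "\<And>w. w \<in> W \<Longrightarrow> f w \<in> W" for f h i j
    using B(1) z[OF that(1) _ that(2)] by (intro sum.mono_neutral_right) auto
  have s2: "(\<Sum>k\<in>B. ent B h i k * ent B f k j) = (\<Sum>k\<in>B1. ent B h i k * ent B f k j)"
    if "j \<in> B1" "\<And>w. w \<in> W \<Longrightarrow> f w \<in> W" for f h i j
    using B(1,3) z[OF _ that] by (intro sum.mono_neutral_right) auto
  define T :: "'v \<Rightarrow> 'v \<Rightarrow> complex" where "T = (\<lambda>i j. 0)"
  have T0: "nrm ?I B1 T = 0" by (simp add: nrm_def T_def)
  define G where "G n = nrm ?I B1 (\<lambda>i j. (lam + of_nat n) * ent B (E (n + 2)) i j)" for n
  have "\<exists>K. \<forall>\<^sub>F n in sequentially. cmod (lam + of_nat n) * nrm ?I B1 (\<lambda>i j. (lam + of_nat n) * ent B (E (n + 2)) i j - T i j) \<le>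
      K * (nrm ?I B1 (\<lambda>i j. (lam + of_nat n) * ent B (E (n + 2)) i j) + nrm ?I B1 T)"
  proof (rule two_step_recursion_asymptotics[OF fin, where A = "ent B C" and A' = "ent B C" and B = "ent B b" and B' = "ent B b" and \<kappa> = "8 - kap / 2"])
    fix n i j assume ij: "i \<in> ?I" "j \<in> B1"
    then have ijB: "i \<in> B" "j \<in> B" "i \<noteq> j" using B(3) by auto
    show "(lam + of_nat n + 3) * (lam + of_nat n + 2) * ent B (E (n + 1)) i j + (\<Sum>k\<in>?I. ent B C i k * ent B (E (n + 1)) k j) =
        (lam + of_nat n + 1) * (lam + of_nat n) * ent B (E n) i j + (\<Sum>k\<in>B1. ent B (E n) i k * ent B C k j) + 3 * T i j"
      using ent_recursion1[OF Bs ijB(1,2), of n] ijB(3) s1[OF ij(1) W(3)] s2[OF ij(2) W(3)] by (simp add: T_def)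
    show "(lam + of_nat n + 4) * (lam + of_nat n + 3) * (lam + of_nat n + 2) * ent B (E (n + 2)) i j
        + 3 * (lam + of_nat n + 4) * (\<Sum>k\<in>?I. ent B C i k * ent B (E (n + 2)) k j) + (\<Sum>k\<in>?I. ent B b i k * ent B (E (n + 2)) k j) =
      (lam + of_nat n + 2) * (lam + of_nat n + 1) * (lam + of_nat n) * ent B (E n) i j
        + 3 * (lam + of_nat n + 2) * (\<Sum>k\<in>B1. ent B (E n) i k * ent B C k j)
        + (\<Sum>k\<in>B1. ent B (E n) i k * ent B b k j) + (4 * (lam + of_nat n) + (8 - kap / 2)) * T i j"
      using ent_recursion2[OF Bs ijB(1,2), of n] ijB(3) s1[OF ij(1) W(3)] s2[OF ij(2) W(3)] s1[OF ij(1) W(4)] s2[OF ij(2) W(4)]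
      by (simp add: T_def)
  qed
  then obtain K where "\<forall>\<^sub>F n in sequentially. cmod (lam + of_nat n) * G n \<le> K * G n"
    unfolding T0 by (auto simp: T_def G_def)
  moreover have "\<forall>\<^sub>F n in sequentially. K < cmod (lam + of_nat n)" by (rule eventually_norm_shift_gt)
  ultimately have "\<forall>\<^sub>F n in sequentially. 0 < cmod (lam + of_nat n) \<and> G n = 0"
    using eventually_norm_shift_gt[of 0 lam]
  proof eventually_elim
    case (elim n)
    have "0 \<le> G n" by (simp add: G_def)
    then have "G n = 0" using elim(1,2) mult_strict_right_mono[of K "cmod (lam + of_nat n)" "G n"] by fastforce
    then show ?case using elim(3) by simp
  qed
  then obtain M where M: "\<And>n. n \<ge> M \<Longrightarrow> 0 < cmod (lam + of_nat n) \<and> G n = 0"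
    unfolding eventually_sequentially by blast
  have "E m w \<in> W" if m: "m \<ge> M + 2" and w: "w \<in> W" for m w
  proof -
    define n where "n = m - 2"
    have n: "m = n + 2" "n \<ge> M" using m by (auto simp: n_def)
    have "representation B (E m j) i = 0" if ij: "i \<in> ?I" "j \<in> B1" for i j
    proof -
      have "cmod (lam + of_nat n) * cmod (ent B (E (n + 2)) i j) \<le> 0" "0 < cmod (lam + of_nat n)"
        using nrm_entry[OF fin ij, of "\<lambda>i j. (lam + of_nat n) * ent B (E (n + 2)) i j"] M[OF n(2)]
        unfolding G_def norm_mult by linarith+
      then have "cmod (ent B (E (n + 2)) i j) \<le> 0" by (simp only: mult_le_0_iff) linarith
      then show ?thesis by (simp add: ent_def n(1))
    qed
    then have "E m j \<in> W" if "j \<in> B1" for j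
      using in_span_subbasis[OF B(1-3), of "E m j"] hat_in B(5) B1(4) that by simp
    then show ?thesis using lin_image_span[OF lin_E _ W(1), of B1 m w] w B1(4) by simp
  qed
  then show ?thesis by blast
qed

text \<open>Vectors obtained from \<open>P\<close> by lowering operators alone, labelled by their
  weight. When \<open>P\<close> describes a tail closed under raising operators, their span is the
  submodule generated by that tail.\<close>

inductive gen_below :: "('v \<Rightarrow> int \<Rightarrow> bool) \<Rightarrow> 'v \<Rightarrow> int \<Rightarrow> bool" for P where
  base: "P v n \<Longrightarrow> gen_below P v n"
| step: "gen_below P v n \<Longrightarrow> k > 0 \<Longrightarrow> gen_below P (d (- k) v) (n - k)"

lemma linear_subspace_image: "lin f \<Longrightarrow> subspace W \<Longrightarrow> subspace (f ` W)"
  using module_hom.subspace_image[of scale scale f W] by (simp add: Vector_Spaces.linear_iff_module_hom)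

text \<open>The images \<open>H n\<close> of \<open>W\<close> are stable under every
  \<open>d l\<close> as long as the weight stays in the tail. The submodule they generate therefore
  meets \<open>V (int M)\<close> exactly in \<open>H M\<close>; being zero or everything, it forces
  the same alternative on \<open>W\<close>.\<close>

lemma irreducible_half:
  assumes W: "subspace W" "W \<subseteq> V 0" "\<And>w. w \<in> W \<Longrightarrow> C w \<in> W" "\<And>w. w \<in> W \<Longrightarrow> b w \<in> W"
  shows "W = {0} \<or> W = V 0"
proof -
  obtain M where M: "\<And>n w. n \<ge> M \<Longrightarrow> w \<in> W \<Longrightarrow> E n w \<in> W" using E_preserves[OF W] by blast
  define H where "H n = g n ` W" for n
  have HV: "v \<in> H n \<Longrightarrow> v \<in> V (int n)" for v n using g_in W(2) by (auto simp: H_def)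
  have p1: "d 1 v \<in> H (Suc n)" if "v \<in> H n" for v n using that by (auto simp: H_def g_Suc)
  have m1: "d (- 1) v \<in> H n" if v: "v \<in> H (Suc n)" for v n
  proof -
    obtain w where w: "w \<in> W" "v = d 1 (g n w)" using v by (auto simp: H_def g_Suc)
    have w0: "w \<in> V 0" using w W(2) by blast
    have "d (- 1) v = g n (C w + ((x (int n) + 1) * x (int n)) *s w)"
      unfolding w(2) dm1_d1[OF g_in[OF w0]] C_g[OF w0] by (simp add: lin_simps[OF lin_g])
    moreover have "C w + ((x (int n) + 1) * x (int n)) *s w \<in> W"
      using w W by (intro subspace_add[OF W(1)] subspace_scale[OF W(1)]) auto
    ultimately show ?thesis by (simp add: H_def)
  qed
  have m2: "d (- 2) v \<in> H n" if v: "v \<in> H (n + 2)" for v n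
  proof -
    obtain w where w: "w \<in> W" "v = g (n + 2) w" using v by (auto simp: H_def)
    have w0: "w \<in> V 0" using w W(2) by blast
    have "b w + (xi (x (int n + 2)) *s w + (3 * x (int n + 2)) *s C w) \<in> W"
      using w W by (intro subspace_add[OF W(1)] subspace_scale[OF W(1)]) auto
    then show ?thesis unfolding w(2) dm2_g[OF w0] by (simp add: H_def)
  qed
  have p2: "d 2 v \<in> H (n + 2)" if v: "v \<in> H n" "n \<ge> M" for v n
  proof -
    obtain w where w: "w \<in> W" "v = g n w" using v by (auto simp: H_def)
    have w0: "w \<in> V 0" using w W(2) by blast
    show ?thesis unfolding w(2) g_E[OF w0, symmetric] using M[OF v(2) w(1)] by (simp add: H_def)
  qed
  have sH: "subspace (H n)" for n
    unfolding H_def using linear_subspace_image[OF lin_g W(1)] .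
  \<comment> \<open>\<open>d 1\<close> and \<open>d 2\<close> generate the positive part. The
    bracket of \<open>d 1\<close> and \<open>d k\<close> is \<open>(k - 1) d (k + 1)\<close>, with
    coefficient 0 at \<open>k = 1\<close>, so \<open>d 2\<close> enters through
    \<open>p2\<close>.\<close>
  have pk: "d (int k) v \<in> H (n + k)" if "v \<in> H n" "n \<ge> M" "k \<ge> 1" for v n k
    using that(3,1,2)
  proof (induction k arbitrary: v n rule: dec_induct)
    case base
    then show ?case using p1 by simp
  next
    case (step k)
    show ?case
    proof (cases "k = 1")
      case True
      then show ?thesis using p2 step by simp
    next
      case False
      have "of_int (int k - 1) *s d (int (Suc k)) v = d 1 (d (int k) v) - d (int k) (d 1 v)"
        using bracket[of 1 "int k" v] by simp
      moreover have "d 1 (d (int k) v) \<in> H (n + Suc k)" using p1[OF step.IH[OF step.prems]] by simp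
      moreover have "d (int k) (d 1 v) \<in> H (n + Suc k)" using step.IH[OF p1[OF step.prems(1)]] step.prems(2) by simp
      ultimately have "of_int (int k - 1) *s d (int (Suc k)) v \<in> H (n + Suc k)"
        using subspace_diff[OF sH] by metis
      from subspace_scale[OF sH this, of "1 / of_int (int k - 1)"] show ?thesis
        using False step.hyps by simp
    qed
  qed
  have mk: "d (- int k) v \<in> H n" if "v \<in> H (n + k)" "k \<ge> 1" for v n k
    using that(2,1)
  proof (induction k arbitrary: v n rule: dec_induct)
    case base
    then show ?case using m1 by simp
  next
    case (step k)
    show ?case
    proof (cases "k = 1")
      case True
      then show ?thesis using m2[of v n] step.prems by (simp add: numeral_2_eq_2)
    next
      case False
      have "of_int (1 - int k) *s d (- int (Suc k)) v = d (- 1) (d (- int k) v) - d (- int k) (d (- 1) v)"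
        using bracket[of "- 1" "- int k" v] step.hyps by simp
      moreover have "d (- 1) (d (- int k) v) \<in> H n"
        using m1[of _ n] step.IH[of v "Suc n"] step.prems by simp
      moreover have "d (- int k) (d (- 1) v) \<in> H n"
        using m1[of v "n + k"] step.IH[of "d (- 1) v" n] step.prems by simp
      ultimately have "of_int (1 - int k) *s d (- int (Suc k)) v \<in> H n"
        using subspace_diff[OF sH] by metis
      from subspace_scale[OF sH this, of "1 / of_int (1 - int k)"] show ?thesis
        using False step.hyps by simp
    qed
  qed
  have dH: "d l v \<in> H m'" if "v \<in> H m" "m \<ge> M" "int m' = int m + l" for v m m' l
  proof -
    consider "l = 0" | "l \<ge> 1" | "l \<le> - 1" by linarith
    then show ?thesis
    proof cases
      case 1
      then have "m' = m" using that(3) by simp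
      then show ?thesis using 1 d0_V[OF HV[OF that(1)]] subspace_scale[OF sH that(1)] by simp
    next
      case 2
      then have "m' = m + nat l" using that(3) by linarith
      then show ?thesis using pk[OF that(1,2), of "nat l"] 2 by simp
    next
      case 3
      then have "m = m' + nat (- l)" using that(3) by linarith
      then show ?thesis using mk[of v m' "nat (- l)"] 3 that(1) by simp
    qed
  qed
  let ?gen = "\<lambda>v n. gen_below (\<lambda>v n. \<exists>m. n = int m \<and> v \<in> H m \<and> m \<ge> M) v n"
  have genV: "v \<in> V n" if "?gen v n" for v n
    using that
  proof (induction rule: gen_below.induct)
    case (base v n)
    then show ?case using HV by blast
  next
    case (step v n k)
    then show ?case using d_V[OF step.IH, of "- k"] by simp
  qed
  \<comment> \<open>Lowering only decreases the weight, so a generated vector that ends in the tail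
    has been there throughout.\<close>
  have gH: "\<forall>m. n = int m \<longrightarrow> m \<ge> M \<longrightarrow> v \<in> H m" if "?gen v n" for v n
    using that
  proof (induction rule: gen_below.induct)
    case (base v n)
    then show ?case by auto
  next
    case (step v n k)
    show ?case
    proof (intro allI impI)
      fix m assume m: "n - k = int m" "m \<ge> M"
      then have n: "n = int (nat n)" "nat n \<ge> M" using step.hyps(2) by linarith+
      have "v \<in> H (nat n)" using step.IH n by blast
      then show "d (- k) v \<in> H m" using dH[of v "nat n" m "- k"] n m by simp
    qed
  qed
  define S where "S = span {v. \<exists>n. ?gen v n}"
  have Sd: "d (- k) v \<in> S" if v: "v \<in> S" and k: "k > 0" for v k
  proof -
    have "d (- k) e \<in> span {v. \<exists>n. ?gen v n}" if "e \<in> {v. \<exists>n. ?gen v n}" for e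
    proof -
      from that obtain n where "?gen e n" by blast
      then have "?gen (d (- k) e) (n - k)" using k by (rule gen_below.step)
      then show ?thesis by (intro span_base) blast
    qed
    from lin_image_span[OF lin_d this subspace_span] v show ?thesis unfolding S_def by blast
  qed
  have sS: "subspace S" unfolding S_def by (rule subspace_span)
  have gd: "d l v \<in> S" if "?gen v n" for v n l
    using that
  proof (induction arbitrary: l rule: gen_below.induct)
    case (base v n)
    then obtain m where m: "n = int m" "v \<in> H m" "m \<ge> M" by blast
    show ?case
    proof (cases "l \<ge> 0")
      case True
      then have "d l v \<in> H (m + nat l)" using dH[OF m(2,3), of "m + nat l" l] by simp
      then have "?gen (d l v) (int (m + nat l))" using m(3) by (intro gen_below.base exI[of _ "m + nat l"]) simp
      then show ?thesis unfolding S_def by (intro span_base) blast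
    next
      case False
      then have "?gen (d (- (- l)) v) (n - (- l))" using gen_below.step[OF gen_below.base, of _ v n "- l"] base by auto
      then show ?thesis unfolding S_def by (intro span_base) auto
    qed
  next
    case (step v n k)
    have vS: "v \<in> S" unfolding S_def using step.hyps(1) by (intro span_base) blast
    have "d l (d (- k) v) = d (- k) (d l v) + (of_int (- k - l) *s d (l - k) v
        + (if l - k = 0 then (of_int (l ^ 3 - l) / 12 * kap) *s v else 0))"
      using bracket[of l "- k" v] by (simp add: algebra_simps)
    also have "\<dots> \<in> S"
      using step.IH Sd[OF _ step.hyps(2)] vS
      by (intro subspace_add[OF sS] subspace_scale[OF sS]) (auto intro: subspace_scale[OF sS] subspace_0[OF sS])
    finally show ?case .
  qed
  have dS: "d l v \<in> S" if v: "v \<in> S" for l v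
  proof -
    have "d l e \<in> S" if "e \<in> {v. \<exists>n. ?gen v n}" for e using that gd by blast
    from lin_image_span[OF lin_d this sS] v show ?thesis unfolding S_def by blast
  qed
  from irred[OF sS dS] consider "S = {0}" | "S = UNIV" by blast
  then show ?thesis
  proof cases
    case 1
    have "w = 0" if w: "w \<in> W" for w
    proof -
      have "?gen (g M w) (int M)" using w by (intro gen_below.base) (auto simp: H_def)
      then have "g M w \<in> S" unfolding S_def by (intro span_base) blast
      then have "g M w = g M 0" using 1 lin_0[OF lin_g] by simp
      then show ?thesis using g_inj[of w 0 M] w W(2) subspace_0[OF subspace_V] by blast
    qed
    then show ?thesis using subspace_0[OF W(1)] by blast
  next
    case 2
    have "V 0 \<subseteq> W"
    proof
      fix u assume u: "u \<in> V 0"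
      \<comment> \<open>The sum of \<open>H M\<close> and all other weight spaces contains the
        generators, hence everything; comparing the components of weight \<open>M\<close> puts
        \<open>g M u\<close> into \<open>H M\<close>.\<close>
      define P where "P = {y + z | y z. y \<in> H M \<and> z \<in> span (\<Union>m\<in>- {int M}. V m)}"
      have sP: "subspace P" unfolding P_def by (rule subspace_sums[OF sH subspace_span])
      have "S \<subseteq> P" unfolding S_def
      proof (rule span_minimal[OF _ sP])
        show "{v. \<exists>n. ?gen v n} \<subseteq> P"
        proof
          fix v assume "v \<in> {v. \<exists>n. ?gen v n}"
          then obtain n where n: "?gen v n" by blast
          show "v \<in> P"
          proof (cases "n = int M")
            case True
            then have "v \<in> H M" using gH[OF n] by blast
            then have "v = v + 0 \<and> v \<in> H M \<and> 0 \<in> span (\<Union>m\<in>- {int M}. V m)" using span_zero by simp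
            then show ?thesis unfolding P_def by blast
          next
            case False
            then have "v \<in> span (\<Union>m\<in>- {int M}. V m)" using genV[OF n] by (intro span_base) blast
            then have "v = 0 + v \<and> 0 \<in> H M \<and> v \<in> span (\<Union>m\<in>- {int M}. V m)" using subspace_0[OF sH] by simp
            then show ?thesis unfolding P_def by blast
          qed
        qed
      qed
      then have "g M u \<in> P" using 2 by blast
      then obtain y z where yz: "g M u = y + z" "y \<in> H M" "z \<in> span (\<Union>m\<in>- {int M}. V m)" unfolding P_def by blast
      have "z = g M u - y" using yz(1) by simp
      then have "z \<in> V (int M)" using g_in[OF u, of M] HV[OF yz(2)] subspace_diff[OF subspace_V] by blast
      then have "z = 0" using V_inter_other yz(3) by blast
      then obtain w where "w \<in> W" "g M u = g M w" using yz by (auto simp: H_def)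
      then show "u \<in> W" using g_inj[OF u, of w M] W(2) by blast
    qed
    then show ?thesis using W(2) by blast
  qed
qed

section \<open>The algebra generated by \<open>C\<close> and \<open>b\<close>, and vanishing of its
  commutator ideal\<close>

inductive alg :: "('v \<Rightarrow> 'v) \<Rightarrow> bool" where
  id: "alg (\<lambda>v. v)"
| C: "alg \<phi> \<Longrightarrow> alg (\<lambda>v. C (\<phi> v))"
| b: "alg \<phi> \<Longrightarrow> alg (\<lambda>v. b (\<phi> v))"
| add: "alg \<phi> \<Longrightarrow> alg \<psi> \<Longrightarrow> alg (\<lambda>v. \<phi> v + \<psi> v)"
| scale: "alg \<phi> \<Longrightarrow> alg (\<lambda>v. c *s \<phi> v)"

lemma alg_combs: "alg \<phi> \<Longrightarrow> combs 0 \<phi>"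
  by (induction rule: alg.induct)
     (auto intro: combs_id combs_add combs_scale combs_comp[OF combs_C] combs_comp[OF combs_b])

lemma alg_lin: "alg \<phi> \<Longrightarrow> lin \<phi>"
  by (rule combs_lin[OF alg_combs])

lemma alg_in: "alg \<phi> \<Longrightarrow> v \<in> V n \<Longrightarrow> \<phi> v \<in> V n"
  using combs_V[OF alg_combs] by fastforce

lemma alg_d1: "alg \<phi> \<Longrightarrow> v \<in> V n \<Longrightarrow> \<phi> (d 1 v) = d 1 (\<phi> v)"
  by (induction rule: alg.induct) (simp_all add: d_simps C_d1[OF alg_in] b_d1[OF alg_in])

lemma alg_comp: "alg \<phi> \<Longrightarrow> alg \<psi> \<Longrightarrow> alg (\<lambda>v. \<phi> (\<psi> v))"
  by (induction rule: alg.induct) (auto intro: alg.intros)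

lemma alg_transitive:
  assumes v: "v \<in> V 0" "v \<noteq> 0" and u: "u \<in> V 0"
  shows "\<exists>\<phi>. alg \<phi> \<and> \<phi> v = u"
proof -
  define W where "W = (\<lambda>\<phi>. \<phi> v) ` Collect alg"
  have WI: "alg \<phi> \<Longrightarrow> \<phi> v \<in> W" for \<phi> unfolding W_def by (rule image_eqI[where x = \<phi>]) simp_all
  have WE: "\<exists>\<phi>. alg \<phi> \<and> w = \<phi> v" if "w \<in> W" for w using that by (auto simp: W_def)
  have "W = {0} \<or> W = V 0"
  proof (rule irreducible_half)
    show "subspace W"
    proof (rule subspaceI)
      show "0 \<in> W" using WI[OF alg.scale[OF alg.id, of 0]] by simp
      fix p q assume "p \<in> W" "q \<in> W"
      then obtain \<phi> \<psi> where "alg \<phi>" "p = \<phi> v" "alg \<psi>" "q = \<psi> v" using WE by metis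
      then show "p + q \<in> W" using WI[OF alg.add[of \<phi> \<psi>]] by simp
    next
      fix c p assume "p \<in> W"
      then obtain \<phi> where "alg \<phi>" "p = \<phi> v" using WE by metis
      then show "c *s p \<in> W" using WI[OF alg.scale[of \<phi> c]] by simp
    qed
    show "W \<subseteq> V 0" using alg_in[OF _ v(1)] by (auto simp: W_def)
    fix w assume "w \<in> W"
    then obtain \<phi> where \<phi>: "alg \<phi>" "w = \<phi> v" using WE by metis
    show "C w \<in> W" "b w \<in> W" using WI[OF alg.C[OF \<phi>(1)]] WI[OF alg.b[OF \<phi>(1)]] \<phi>(2) by simp_all
  qed
  moreover have "v \<in> W" using WI[OF alg.id] .
  ultimately have "u \<in> W" using v(2) u by blast
  then show ?thesis using WE by metis
qed

text \<open>The two-sided ideal generated by the commutator of \<open>C\<close> and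
  \<open>b\<close>, with the factor \<open>d 1 d 1\<close> removed: \<open>\<mu>\<close> has weight
  -2 and stands for the operator \<open>\<mu> d 1 d 1\<close> on \<open>V 0\<close>. In this form an
  element can be multiplied by \<open>d 2\<close> within the words.\<close>

inductive idl :: "('v \<Rightarrow> 'v) \<Rightarrow> bool" where
  base: "alg \<phi> \<Longrightarrow> alg \<psi> \<Longrightarrow> idl (\<lambda>v. \<phi> (Y (\<psi> v)))"
| add: "idl \<mu> \<Longrightarrow> idl \<nu> \<Longrightarrow> idl (\<lambda>v. \<mu> v + \<nu> v)"
| scale: "idl \<mu> \<Longrightarrow> idl (\<lambda>v. c *s \<mu> v)"

lemma idl_combs: "idl \<mu> \<Longrightarrow> combs (- 2) \<mu>"
proof (induction rule: idl.induct)
  case (base \<phi> \<psi>)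
  have "combs (- 2) (\<lambda>v. Y (\<psi> v))" by (rule combs_comp[OF combs_Y alg_combs[OF base(2)]]) simp
  then show ?case by (rule combs_comp[OF alg_combs[OF base(1)]]) simp
qed (auto intro: combs_add combs_scale)

lemma idl_lin: "idl \<mu> \<Longrightarrow> lin \<mu>"
  by (rule combs_lin[OF idl_combs])

lemma idl_in: "idl \<mu> \<Longrightarrow> v \<in> V n \<Longrightarrow> \<mu> v \<in> V (n - 2)"
  using combs_V[OF idl_combs, of \<mu> v n] by simp

lemma idl_d1: "idl \<mu> \<Longrightarrow> v \<in> V n \<Longrightarrow> \<mu> (d 1 v) = d 1 (\<mu> v)"
proof (induction rule: idl.induct)
  case (base \<phi> \<psi>)
  have v: "\<psi> v \<in> V n" by (rule alg_in[OF base(2,3)])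
  show ?case unfolding alg_d1[OF base(2,3)] Y_d1[OF v] by (rule alg_d1[OF base(1) Y_in[OF v]])
qed (simp_all add: d_simps)

lemma idl_right: "idl \<mu> \<Longrightarrow> alg \<phi> \<Longrightarrow> idl (\<lambda>v. \<mu> (\<phi> v))"
  by (induction rule: idl.induct) (auto intro: idl.intros alg_comp)

text \<open>The way back: with \<open>d 1 d 1\<close> restored, \<open>Y\<close> becomes the
  commutator of \<open>C\<close> and \<open>b\<close>, so the result lies in \<open>alg\<close>.
  This makes the product of two elements of the ideal an element of the ideal.\<close>

lemma idl_alg: "idl \<mu> \<Longrightarrow> \<exists>\<chi>. alg \<chi> \<and> (\<forall>n. \<forall>v\<in>V n. \<chi> v = d 1 (d 1 (\<mu> v)))"
proof (induction rule: idl.induct)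
  case (base \<phi> \<psi>)
  have "alg (\<lambda>v. \<phi> (C (b (\<psi> v)) + (- 1) *s b (C (\<psi> v))))"
    by (rule alg_comp[OF base(1)]) (intro alg.intros base(2))
  moreover have "\<phi> (C (b (\<psi> v)) + (- 1) *s b (C (\<psi> v))) = d 1 (d 1 (\<phi> (Y (\<psi> v))))" if v: "v \<in> V n" for v n
  proof -
    have w: "\<psi> v \<in> V n" by (rule alg_in[OF base(2) v])
    have "C (b (\<psi> v)) + (- 1) *s b (C (\<psi> v)) = d 1 (d 1 (Y (\<psi> v)))" using C_b_commutator[OF w] by simp
    then show ?thesis
      using alg_d1[OF base(1) d_V[OF Y_in[OF w], of 1]] alg_d1[OF base(1) Y_in[OF w]] by simp
  qed
  ultimately show ?case by blast
next
  case (add \<mu> \<nu>)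
  then obtain \<chi> \<chi>' where c: "alg \<chi>" "alg \<chi>'" "\<And>n v. v \<in> V n \<Longrightarrow> \<chi> v = d 1 (d 1 (\<mu> v))"
    "\<And>n v. v \<in> V n \<Longrightarrow> \<chi>' v = d 1 (d 1 (\<nu> v))" by blast
  show ?case by (intro exI[of _ "\<lambda>v. \<chi> v + \<chi>' v"] conjI alg.add c(1,2)) (auto simp: c(3,4) d_simps)
next
  case (scale \<mu> c)
  then obtain \<chi> where c: "alg \<chi>" "\<And>n v. v \<in> V n \<Longrightarrow> \<chi> v = d 1 (d 1 (\<mu> v))" by blast
  show ?case by (intro exI[of _ "\<lambda>v. c *s \<chi> v"] conjI alg.scale c(1)) (auto simp: c(2) d_simps)
qed

lemma idl_g: "idl \<mu> \<Longrightarrow> w \<in> V 0 \<Longrightarrow> \<mu> (g (n + 2) w) = g n (\<mu> (d 1 (d 1 w)))"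
proof (induction n)
  case 0
  show ?case by (simp add: g_def numeral_2_eq_2)
next
  case (Suc n)
  then show ?case using idl_d1[OF Suc.prems(1) g_in[OF Suc.prems(2), of "n + 2"]] by (simp add: g_Suc)
qed

lemma idl_trace_zero:
  assumes \<mu>: "idl \<mu>" and B: "finite B" "independent B" "span B = V 0"
  shows "tr B (\<lambda>u. \<mu> (d 1 (d 1 u))) = 0"
proof -
  define m where "m u = \<mu> (d 1 (d 1 u))" for u
  have lm: "lin m" unfolding m_def by (intro lin_comp'[OF idl_lin[OF \<mu>]] lin_comp'[OF lin_d] lin_d)
  have m_in: "m u \<in> V 0" if "u \<in> V 0" for u
    using idl_in[OF \<mu> d_V[OF d_V[OF that, of 1], of 1]] by (simp add: m_def)
  have hat_m: "hat (\<lambda>v. \<mu> (d 2 v)) n n u = m (E n u)" if u: "u \<in> V 0" for n u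
  proof -
    have "\<mu> (d 2 (g n u)) = g n (m (E n u))"
      unfolding m_def idl_g[OF \<mu> hat_in, symmetric] g_E[OF u] by (rule refl)
    then show ?thesis unfolding hat_def[of _ n n] by (simp add: q_g m_in hat_in)
  qed
  \<comment> \<open>\<open>h n\<close> is the trace of the word \<open>\<mu> d 2\<close> on
    \<open>V n\<close>, hence a quasi-polynomial; by \<open>E_limit\<close> its product with
    \<open>x\<close> tends to \<open>tr B m\<close>.\<close>
  define h where "h n = (\<Sum>i\<in>B. \<Sum>k\<in>B. ent B m i k * ent B (E n) k i)" for n
  have h_tr: "tr B (hat (\<lambda>v. \<mu> (d 2 v)) n n) = h n" for n
  proof -
    have "tr B (hat (\<lambda>v. \<mu> (d 2 v)) n n) = tr B (\<lambda>u. m (E n u))"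
      by (rule tr_cong) (rule hat_m[OF B_V0[OF B]])
    also have "\<dots> = h n"
      unfolding h_def by (rule tr_comp[OF B(1,2) lm lin_E]) (simp_all add: B(3) m_in hat_in)
    finally show ?thesis .
  qed
  have "combs 0 (\<lambda>v. \<mu> (d 2 v))" by (rule combs_comp[OF idl_combs[OF \<mu>] combs_d]) simp
  then obtain r where "comb r 0 (\<lambda>v. \<mu> (d 2 v))" by (auto simp: combs_def)
  from trace_quasi_poly[OF B this refl] have qp: "quasi_poly h" unfolding h_tr .
  have "(\<lambda>n. \<Sum>i\<in>B. \<Sum>k\<in>B. ent B m i k * ((lam + of_nat n) * ent B (E (n + 2)) k i))
      \<longlonglongrightarrow> (\<Sum>i\<in>B. \<Sum>k\<in>B. ent B m i k * (if k = i then 1 else 0))"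
    by (intro tendsto_sum tendsto_mult tendsto_const E_limit[OF B])
  moreover have "(\<Sum>i\<in>B. \<Sum>k\<in>B. ent B m i k * (if k = i then 1 else 0)) = tr B m"
    unfolding tr_ent using B(1) by (intro sum.cong refl) (simp add: if_distrib cong: if_cong)
  moreover have "(\<Sum>i\<in>B. \<Sum>k\<in>B. ent B m i k * ((lam + of_nat n) * ent B (E (n + 2)) k i)) = (lam + of_nat n) * h (n + 2)" for n
    by (simp add: h_def sum_distrib_left mult_ac)
  ultimately have lim: "(\<lambda>n. (lam + of_nat n) * h (n + 2)) \<longlonglongrightarrow> tr B m" by simp
  have "(\<lambda>n. (1 / (lam + of_nat n)) * ((lam + of_nat n) * h (n + 2))) \<longlonglongrightarrow> 0 * tr B m"
    by (intro tendsto_mult inverse_shift_tendsto lim)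
  moreover have "\<forall>\<^sub>F n in sequentially. (1 / (lam + of_nat n)) * ((lam + of_nat n) * h (n + 2)) = h (n + 2)"
    using eventually_norm_shift_gt[of 0 lam] by eventually_elim simp
  ultimately have "(\<lambda>n. h (n + 2)) \<longlonglongrightarrow> 0" by (simp add: tendsto_cong)
  then have "\<forall>\<^sub>F n in sequentially. h (n + 2) = 0" by (rule quasi_poly_decay[OF quasi_poly_shift[OF qp]])
  then have "\<forall>\<^sub>F n in sequentially. (lam + of_nat n) * h (n + 2) = 0" by eventually_elim simp
  then have "(\<lambda>n. (lam + of_nat n) * h (n + 2)) \<longlonglongrightarrow> 0" by (rule tendsto_eventually)
  from LIMSEQ_unique[OF lim this] show ?thesis by (simp add: m_def[abs_def])
qed

text \<open>Let \<open>y \<nu>\<close> be nonzero of least rank. Transitivity of \<open>alg\<close>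
  provides \<open>\<phi>\<close> such that \<open>T\<close>, the composite of \<open>\<phi>\<close>
  and \<open>y \<nu>\<close>, fixes a nonzero vector \<open>v\<close> in the image of
  \<open>y \<nu>\<close>. Then \<open>T - 1\<close> after \<open>y \<nu>\<close> again comes from
  the ideal and has smaller rank, so it vanishes on \<open>V 0\<close>. Thus \<open>T\<close> is a
  nonzero idempotent there, and its trace is its rank.\<close>

lemma idl_zero:
  assumes "idl \<mu>" "u \<in> V 0"
  shows "\<mu> (d 1 (d 1 u)) = 0"
proof (rule ccontr)
  define y where "y \<mu> u = \<mu> (d 1 (d 1 u))" for \<mu> :: "'v \<Rightarrow> 'v" and u
  define Pr where "Pr \<mu> \<longleftrightarrow> idl \<mu> \<and> (\<exists>u\<in>V 0. y \<mu> u \<noteq> 0)" for \<mu>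
  assume "\<mu> (d 1 (d 1 u)) \<noteq> 0"
  then have "Pr \<mu>" using assms by (auto simp: Pr_def y_def)
  from ex_has_least_nat[of Pr \<mu> "\<lambda>\<mu>. dim (y \<mu> ` V 0)", OF this]
  obtain \<nu> where \<nu>: "Pr \<nu>" "\<And>\<mu>. Pr \<mu> \<Longrightarrow> dim (y \<nu> ` V 0) \<le> dim (y \<mu> ` V 0)" by blast
  have i\<nu>: "idl \<nu>" using \<nu>(1) by (simp add: Pr_def)
  have ly: "lin (y \<nu>)" unfolding y_def by (intro lin_comp'[OF idl_lin[OF i\<nu>]] lin_comp'[OF lin_d] lin_d)
  have y_in: "y \<nu> u \<in> V 0" if "u \<in> V 0" for u
    using idl_in[OF i\<nu> d_V[OF d_V[OF that, of 1], of 1]] by (simp add: y_def)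
  obtain u0 where u0: "u0 \<in> V 0" "y \<nu> u0 \<noteq> 0" using \<nu>(1) by (auto simp: Pr_def)
  define v where "v = y \<nu> u0"
  have v: "v \<in> V 0" "v \<noteq> 0" using y_in[OF u0(1)] u0(2) by (simp_all add: v_def)
  obtain \<phi> where \<phi>: "alg \<phi>" "\<phi> v = u0" using alg_transitive[OF v u0(1)] by blast
  define T where "T u = y \<nu> (\<phi> u)" for u
  have lT: "lin T" unfolding T_def by (rule lin_comp'[OF ly alg_lin[OF \<phi>(1)]])
  have T_in: "T u \<in> V 0" if "u \<in> V 0" for u unfolding T_def by (rule y_in[OF alg_in[OF \<phi>(1) that]])
  have Tv: "T v = v" using \<phi>(2) by (simp add: T_def v_def)
  obtain \<chi> where \<chi>: "alg \<chi>" "\<And>n v. v \<in> V n \<Longrightarrow> \<chi> v = d 1 (d 1 (\<nu> v))" using idl_alg[OF i\<nu>] by blast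
  \<comment> \<open>\<open>\<chi>\<close> stands for \<open>d 1 d 1 \<nu>\<close>; written with
    \<open>\<nu>\<close> on the left and an element of \<open>alg\<close> on the right, the product
    visibly stays in the ideal.\<close>
  define \<nu>' where "\<nu>' u = \<nu> (\<phi> (\<chi> u)) + (- 1) *s \<nu> u" for u
  have i\<nu>': "idl \<nu>'" unfolding \<nu>'_def
    by (intro idl.add idl.scale i\<nu> idl_right[OF i\<nu> alg_comp[OF \<phi>(1) \<chi>(1)]])
  have y': "y \<nu>' u = T (y \<nu> u) - y \<nu> u" if u: "u \<in> V 0" for u
  proof -
    have w: "d 1 (d 1 u) \<in> V 2" using d_V[OF d_V[OF u, of 1], of 1] by simp
    have yu: "\<nu> (d 1 (d 1 u)) \<in> V 0" using y_in[OF u] by (simp add: y_def)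
    have "\<nu> (\<phi> (\<chi> (d 1 (d 1 u)))) = \<nu> (\<phi> (d 1 (d 1 (\<nu> (d 1 (d 1 u))))))" using \<chi>(2)[OF w] by simp
    also have "\<dots> = \<nu> (d 1 (d 1 (\<phi> (\<nu> (d 1 (d 1 u))))))"
      using alg_d1[OF \<phi>(1) d_V[OF yu, of 1]] alg_d1[OF \<phi>(1) yu] by simp
    finally show ?thesis by (simp add: y_def \<nu>'_def T_def)
  qed
  have fdI: "fdim N (y \<nu> ` V 0)"
    using linear_subspace_image[OF ly subspace_V] y_in by (intro fdim_mono[OF fd0]) auto
  have "y \<nu>' ` V 0 = (\<lambda>w. T w - w) ` (y \<nu> ` V 0)" using y' by (force simp: image_image)
  also have "dim \<dots> < dim (y \<nu> ` V 0)"
    by (rule dim_image_less[OF fdI lin_minus'[OF lT lin_id], of v]) (use v Tv u0 in \<open>auto simp: v_def\<close>)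
  finally have "\<not> Pr \<nu>'" using \<nu>(2)[of \<nu>'] by force
  then have TT: "T (y \<nu> u) = y \<nu> u" if "u \<in> V 0" for u using i\<nu>' y'[OF that] that by (auto simp: Pr_def)
  have idem: "T (T u) = T u" if "u \<in> V 0" for u
    using TT[OF alg_in[OF \<phi>(1) that]] by (simp add: T_def)
  have fdT: "fdim N (T ` V 0)"
    using linear_subspace_image[OF lT subspace_V] T_in by (intro fdim_mono[OF fd0]) auto
  obtain B1 where B1: "finite B1" "independent B1" "B1 \<subseteq> T ` V 0" "span B1 = T ` V 0"
    using fdim_basis[OF fdT] by metis
  have "B1 \<subseteq> V 0" using B1(3) T_in by blast
  then obtain B where B: "finite B" "independent B" "B1 \<subseteq> B" "span B = V 0"
    using fdim_basis_extend[OF fd0 B1(2)] by metis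
  have "tr B T = (\<Sum>e\<in>B. if e \<in> B1 then 1 else 0)"
    unfolding tr_def
  proof (rule sum.cong[OF refl])
    fix e assume e: "e \<in> B"
    have e0: "e \<in> V 0" using B_V0[OF B(1,2,4) e] .
    show "representation B (T e) e = (if e \<in> B1 then 1 else 0)"
    proof (cases "e \<in> B1")
      case True
      then obtain u where "u \<in> V 0" "e = T u" using B1(3) by blast
      then have "T e = e" using idem by simp
      then show ?thesis using True representation_basis[OF B(2) e] by simp
    next
      case False
      have "T e \<in> span B1" using B1(4) e0 by blast
      then show ?thesis using False representation_outside[OF B(2,3), of "T e" e] by simp
    qed
  qed
  also have "\<dots> = of_nat (card B1)" using B(1,3) by (simp add: sum.If_cases Int_absorb1)
  finally have "tr B T = of_nat (card B1)" .
  moreover have "tr B T = 0"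
  proof -
    have "tr B T = tr B (\<lambda>u. \<nu> (\<phi> (d 1 (d 1 u))))"
    proof (rule tr_cong)
      fix e assume "e \<in> B"
      then have e0: "e \<in> V 0" using B_V0[OF B(1,2,4)] by blast
      show "T e = \<nu> (\<phi> (d 1 (d 1 e)))"
        using alg_d1[OF \<phi>(1) d_V[OF e0, of 1]] alg_d1[OF \<phi>(1) e0] by (simp add: T_def y_def)
    qed
    also have "\<dots> = 0" by (rule idl_trace_zero[OF idl_right[OF i\<nu> \<phi>(1)] B(1,2,4)])
    finally show ?thesis .
  qed
  ultimately have "B1 = {}" using B1(1) by simp
  then have T0: "T ` V 0 = {0}" using B1(4) by simp
  have "T v \<in> T ` V 0" using v(1) by (rule imageI)
  then show False unfolding T0 Tv using v(2) by simp
qed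

theorem V0_one_dimensional:
  "\<exists>v0 \<alpha> \<eta>. v0 \<noteq> 0 \<and> v0 \<in> V 0 \<and> V 0 = range (\<lambda>c. c *s v0) \<and> C v0 = \<alpha> *s v0 \<and> b v0 = \<eta> *s v0"
proof -
  have comm: "C (b u) = b (C u)" if u: "u \<in> V 0" for u
  proof -
    have "idl Y" using idl.base[OF alg.id alg.id] .
    from idl_zero[OF this u] have z: "Y (d 1 (d 1 u)) = 0" .
    have "C (b u) - b (C u) = Y (d 1 (d 1 u))"
      unfolding C_b_commutator[OF u] using Y_d1[OF u] Y_d1[OF d_V[OF u, of 1]] by simp
    then show ?thesis using z by simp
  qed
  obtain w where w: "w \<in> V 0" "w \<noteq> 0" using V0 subspace_0[OF subspace_V] by blast
  obtain u \<alpha> where u: "u \<in> V 0" "u \<noteq> 0" "C u = \<alpha> *s u"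
    using eigen_exists[OF fd0 lin_C _ w] C_in by blast
  define K where "K = {u \<in> V 0. C u = \<alpha> *s u}"
  have sK: "subspace K"
    unfolding K_def using subspace_V[of 0] by (auto simp: subspace_def lin_simps[OF lin_C] algebra_simps)
  have fK: "fdim N K" by (rule fdim_mono[OF fd0 sK]) (auto simp: K_def)
  have "b w \<in> K" if "w \<in> K" for w
  proof -
    have w: "w \<in> V 0" "C w = \<alpha> *s w" using that by (simp_all add: K_def)
    then have "C (b w) = \<alpha> *s b w" unfolding comm[OF w(1)] by (simp add: lin_simps[OF lin_b])
    then show ?thesis using b_in[OF w(1)] by (simp add: K_def)
  qed
  then have "b ` K \<subseteq> K" by blast
  then obtain v0 \<eta> where v0: "v0 \<in> K" "v0 \<noteq> 0" "b v0 = \<eta> *s v0"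
    using eigen_exists[OF fK lin_b, of u] u by (auto simp: K_def)
  have C0: "C v0 = \<alpha> *s v0" and vV: "v0 \<in> V 0" using v0(1) by (simp_all add: K_def)
  have r: "range (\<lambda>c. c *s v0) = span {v0}" by (simp add: span_singleton)
  have "span {v0} = {0} \<or> span {v0} = V 0"
  proof (rule irreducible_half)
    show "span {v0} \<subseteq> V 0" using span_minimal[of "{v0}" "V 0"] vV subspace_V by simp
    show "C w \<in> span {v0}" if "w \<in> span {v0}" for w
      using that by (auto simp: span_singleton lin_simps[OF lin_C] C0)
    show "b w \<in> span {v0}" if "w \<in> span {v0}" for w
      using that by (auto simp: span_singleton lin_simps[OF lin_b] v0(3))
  qed (rule subspace_span)
  then have "V 0 = range (\<lambda>c. c *s v0)" using r v0(2) span_base[of v0 "{v0}"] by auto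
  then show ?thesis using v0(2,3) C0 vV by blast
qed

end

section \<open>Identification with a tensor density module\<close>

text \<open>\<open>D z\<close> is the scalar of \<open>d 1 d (- 1)\<close> at weight
  \<open>z\<close>, and \<open>c z + f\<close> that of \<open>d 1 d 1 d (- 2)\<close> at weight
  \<open>z + 1\<close>; the shift makes \<open>c\<close> an odd cubic. The factor with
  \<open>h\<close> comes from \<open>d 2\<close>, and \<open>k\<close> is half the central charge.
  The difference of the two sides is the polynomial \<open>R\<close> in \<open>u\<close>, which has
  infinitely many roots; its coefficients of degree 8, 6 and 3 give the three conclusions.\<close>

lemma virasoro_identity:
  fixes \<alpha> f h k :: complex and U :: "complex set"
  defines "D \<equiv> \<lambda>z. z * (z - 1) + \<alpha>" and "c \<equiv> \<lambda>z. z ^ 3 + (3 * \<alpha> - 1) * z"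
  assumes U: "infinite U"
    and eq: "\<And>u. u \<in> U \<Longrightarrow> (c (u + 1) + f) * (c (u + 1) + h) * (D (u - 1) * D u) =
      (c (u - 1) + f) * (c (u - 1) + h) * (D (u + 1) * D (u + 2))
      + (4 * u - k) * (D (u - 1) * D u * D (u + 1) * D (u + 2))"
  shows "k = 0" "h = - f" "f ^ 2 = \<alpha> ^ 2 * (1 - 4 * \<alpha>)"
proof -
  define s p where "s = f + h" and "p = f * h"
  define R where "R = [:12*\<alpha>^2*s + 6*\<alpha>^3*s + 4*\<alpha>^2*k + 4*\<alpha>^3*k + \<alpha>^4*k,
    - 4*\<alpha>^2 + 8*\<alpha>^3 + 32*\<alpha>^4 - 8*\<alpha>*p - 4*p,
    - 6*\<alpha>^2*s - 8*s + 14*\<alpha>*s + 2*\<alpha>^2*k + 4*\<alpha>^3*k + 4*\<alpha>*k - 4*k,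
    32*\<alpha>^3 - 8*p - 8*\<alpha>^2,
    10*s - 14*\<alpha>*s - 8*\<alpha>*k + 6*\<alpha>^2*k + 9*k, 0, - 2*s - 6*k + 4*\<alpha>*k, 0, k:]"
  have "poly R u = 0" if "u \<in> U" for u
  proof -
    have sp: "(z + f) * (z + h) = z * z + s * z + p" for z
      by (simp add: s_def p_def algebra_simps)
    have "poly R u = (c (u + 1) * c (u + 1) + s * c (u + 1) + p) * (D (u - 1) * D u) -
      ((c (u - 1) * c (u - 1) + s * c (u - 1) + p) * (D (u + 1) * D (u + 2))
      + (4 * u - k) * (D (u - 1) * D u * D (u + 1) * D (u + 2)))"
      unfolding R_def D_def c_def poly_pCons poly_0 by algebra
    then show ?thesis using eq[OF that] unfolding sp by simp
  qed
  then have "U \<subseteq> {u. poly R u = 0}" by blast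
  then have "R = 0" using U poly_roots_finite finite_subset by blast
  then have e: "coeff R 8 = 0" "coeff R 6 = 0" "coeff R 3 = 0" by simp_all
  show k: "k = 0" using e(1) by (simp add: R_def numeral_eq_Suc)
  have s: "s = 0" using e(2) k by (simp add: R_def numeral_eq_Suc)
  show h: "h = - f" using s by (simp add: s_def add_eq_0_iff2)
  have "32*\<alpha>^3 - 8*p - 8*\<alpha>^2 = 0" using e(3) by (simp add: R_def numeral_3_eq_3)
  then show "f ^ 2 = \<alpha> ^ 2 * (1 - 4 * \<alpha>)" unfolding p_def h by algebra
qed

text \<open>\<open>\<beta>\<close> and \<open>1 - \<beta>\<close> give the same
  \<open>\<alpha>\<close>; the sign of the square root of \<open>1 - 4 * \<alpha>\<close> is chosen
  to match \<open>f\<close>.\<close>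

lemma virasoro_parameter:
  fixes \<alpha> f :: complex
  assumes "f ^ 2 = \<alpha> ^ 2 * (1 - 4 * \<alpha>)"
  obtains \<beta> where "\<alpha> = \<beta> * (1 - \<beta>)" "f = \<alpha> * (2 * \<beta> - 1)"
proof -
  define r where "r = csqrt (1 - 4 * \<alpha>)"
  have r: "r ^ 2 = 1 - 4 * \<alpha>" by (simp add: r_def)
  have "f ^ 2 = (\<alpha> * r) ^ 2" using assms by (simp add: power_mult_distrib r)
  then have "f = \<alpha> * r \<or> f = \<alpha> * (- r)" by (simp add: power2_eq_iff)
  then obtain t where t: "t = r \<or> t = - r" "f = \<alpha> * t" by blast
  then have t2: "t ^ 2 = 1 - 4 * \<alpha>" using r by auto
  define \<beta> where "\<beta> = (1 + t) / 2"
  have e: "t = 2 * \<beta> - 1" by (simp add: \<beta>_def field_simps)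
  have "\<alpha> = \<beta> * (1 - \<beta>)" using t2 unfolding e by algebra
  moreover have "f = \<alpha> * (2 * \<beta> - 1)" unfolding t(2) e ..
  ultimately show ?thesis by (rule that)
qed

context vir_half
begin

lemma scalar_E:
  assumes v0: "v0 \<noteq> 0" "v0 \<in> V 0" "V 0 = range (\<lambda>c. c *s v0)" "C v0 = \<alpha> *s v0" "b v0 = \<eta> *s v0"
  defines "D \<equiv> \<lambda>z. z * (z - 1) + \<alpha>" and "F \<equiv> \<lambda>z. xi z + 3 * z * \<alpha> + \<eta>"
  obtains e where "\<And>n. E n v0 = e n *s v0"
    "\<And>n. D (x (int n) + 3) * e (Suc n) = D (x (int n) + 1) * e n + 3"
    "\<And>n. F (x (int n) + 4) * e (n + 2) = F (x (int n) + 2) * e n + (4 * x (int n) + (8 - kap / 2))"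
proof -
  have "\<exists>c. E n v0 = c *s v0" for n
  proof -
    have "E n v0 \<in> V 0" by (rule hat_in)
    then show ?thesis unfolding v0(3) by blast
  qed
  then obtain e where e: "\<And>n. E n v0 = e n *s v0" by metis
  have lE: "lin (E n)" for n by (rule lin_E)
  have "D (x (int n) + 3) * e (Suc n) = D (x (int n) + 1) * e n + 3" for n
  proof -
    define X where "X = x (int n)"
    have "(D (X + 3) * e (n + 1)) *s v0 = (D (X + 1) * e n + 3) *s v0"
      using E_recursion1[OF v0(2), of n, folded X_def] unfolding v0(4) lin_scale[OF lE] e lin_scale[OF lin_C]
      unfolding v0(4) scale_scale scale_merge by (simp add: D_def algebra_simps)
    then show ?thesis unfolding X_def using v0(1) by simp
  qed
  moreover have "F (x (int n) + 4) * e (n + 2) = F (x (int n) + 2) * e n + (4 * x (int n) + (8 - kap / 2))" for n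
  proof -
    define X where "X = x (int n)"
    have "(F (X + 4) * e (n + 2)) *s v0 = (F (X + 2) * e n + (4 * X + (8 - kap / 2))) *s v0"
      using E_recursion2[OF v0(2), of n, folded X_def] unfolding v0(4,5) lin_scale[OF lE] e lin_scale[OF lin_C] lin_scale[OF lin_b]
      unfolding v0(4,5) scale_scale scale_merge by (simp add: F_def xi_def algebra_simps)
    then show ?thesis unfolding X_def using v0(1) by simp
  qed
  ultimately show ?thesis using that[OF e] by blast
qed

lemma half_tensor_basis:
  obtains \<beta> u M where "\<And>n::nat. n \<ge> M \<Longrightarrow> u n \<noteq> 0"
    "\<And>n. n \<ge> M \<Longrightarrow> V (int n) = range (\<lambda>c. c *s u n)"
    "\<And>n. n \<ge> M \<Longrightarrow> d 1 (u n) = (x (int n) + \<beta>) *s u (Suc n)"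
    "\<And>n. n \<ge> M \<Longrightarrow> d (- 1) (u (Suc n)) = (x (int n) + 1 - \<beta>) *s u n"
    "\<And>n. n \<ge> M \<Longrightarrow> d 2 (u n) = (x (int n) + 2 * \<beta>) *s u (n + 2)"
    "\<And>n. n \<ge> M \<Longrightarrow> d (- 2) (u (n + 2)) = (x (int n) + 2 - 2 * \<beta>) *s u n"
proof -
  obtain v0 \<alpha> \<eta> where v0: "v0 \<noteq> 0" "v0 \<in> V 0" "V 0 = range (\<lambda>c. c *s v0)" "C v0 = \<alpha> *s v0" "b v0 = \<eta> *s v0"
    using V0_one_dimensional by metis
  define X where "X n = x (int n)" for n
  have X_Suc: "X (Suc n) = X n + 1" "X (n + 2) = X n + 2" for n by (simp_all add: X_def x_def)
  define D where "D z = z * (z - 1) + \<alpha>" for z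
  define F where "F z = xi z + 3 * z * \<alpha> + \<eta>" for z
  define c where "c z = z ^ 3 + (3 * \<alpha> - 1) * z" for z :: complex
  obtain e where e: "\<And>n. E n v0 = e n *s v0" "\<And>n. D (X n + 3) * e (Suc n) = D (X n + 1) * e n + 3"
    "\<And>n. F (X n + 4) * e (n + 2) = F (X n + 2) * e n + (4 * X n + (8 - kap / 2))"
    using scalar_E[OF v0] unfolding D_def F_def X_def by metis
  \<comment> \<open>Multiplied by \<open>D (X n + 2)\<close>, the first recursion telescopes:
    \<open>P\<close> grows by \<open>3 * D (X n + 2)\<close> per step, an increment integrated by
    \<open>c\<close>, up to the constant \<open>h\<close>.\<close>
  define P where "P n = D (X n + 1) * D (X n + 2) * e n" for n
  define f h where "f = \<eta> + 3 * \<alpha>" and "h = P 0 - c (X 0 + 1)"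
  have P: "P n = c (X n + 1) + h" for n
  proof (induction n)
    case (Suc n)
    have "P (Suc n) = D (X n + 2) * (D (X n + 3) * e (Suc n))" by (simp add: P_def X_Suc add.assoc)
    also have "\<dots> = P n + 3 * D (X n + 2)" unfolding e(2) P_def by (simp add: algebra_simps)
    also have "\<dots> = c (X (Suc n) + 1) + h" unfolding Suc X_Suc c_def D_def by algebra
    finally show ?case .
  qed (simp add: h_def)
  have F: "F (z + 1) = c z + f" for z
    unfolding F_def xi_def c_def f_def by algebra
  let ?U = "range (\<lambda>n. X n + 2)"
  have U: "infinite ?U"
    by (rule range_inj_infinite) (auto simp: inj_def X_def x_def)
  have eq: "(c (u + 1) + f) * (c (u + 1) + h) * (D (u - 1) * D u) =
      (c (u - 1) + f) * (c (u - 1) + h) * (D (u + 1) * D (u + 2))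
      + (4 * u - kap / 2) * (D (u - 1) * D u * D (u + 1) * D (u + 2))" if uU: "u \<in> ?U" for u
  proof -
    obtain n where u: "u = X n + 2" using uU by blast
    have "(c (u + 1) + f) * (c (u + 1) + h) = F (X n + 4) * P (n + 2)"
      unfolding P X_Suc using F[of "X n + 3"] by (simp add: u add.assoc)
    also have "\<dots> = (F (X n + 4) * e (n + 2)) * (D (u + 1) * D (u + 2))"
      by (simp add: P_def X_Suc u add.assoc mult_ac)
    also have "\<dots> = (F (X n + 2) * e n + (4 * u - kap / 2)) * (D (u + 1) * D (u + 2))"
      unfolding e(3) u by (simp add: algebra_simps)
    finally have L: "(c (u + 1) + f) * (c (u + 1) + h) = (F (X n + 2) * e n + (4 * u - kap / 2)) * (D (u + 1) * D (u + 2))" .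
    have "(c (u + 1) + f) * (c (u + 1) + h) * (D (u - 1) * D u) =
      F (X n + 2) * (D (u - 1) * D u * e n) * (D (u + 1) * D (u + 2))
      + (4 * u - kap / 2) * (D (u - 1) * D u * D (u + 1) * D (u + 2))"
      unfolding L by (simp add: algebra_simps)
    moreover have "D (u - 1) * D u * e n = c (u - 1) + h" using P[of n] by (simp add: P_def u add.commute)
    moreover have "F (X n + 2) = c (u - 1) + f" using F[of "X n + 1"] by (simp add: u add.commute)
    ultimately show ?thesis by simp
  qed
  note id = virasoro_identity[OF U eq[unfolded D_def c_def], folded D_def c_def]
  obtain \<beta> where \<beta>: "\<alpha> = \<beta> * (1 - \<beta>)" "f = \<alpha> * (2 * \<beta> - 1)"
    using virasoro_parameter[OF id(3)] by metis
  have D: "D z = (z - \<beta>) * (z + \<beta> - 1)" for z unfolding D_def \<beta>(1) by algebra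
  have cf: "c z + f = (z + 1 - 2 * \<beta>) * (z + \<beta>) * (z + \<beta> - 1)" for z
    unfolding c_def \<beta>(2) unfolding \<beta>(1) by algebra
  have ch: "c z + h = (z - \<beta>) * (z + 1 - \<beta>) * (z - 1 + 2 * \<beta>)" for z
  proof -
    have h: "h = - (\<alpha> * (2 * \<beta> - 1))" using id(2) \<beta>(2) by simp
    show ?thesis unfolding c_def h unfolding \<beta>(1) by algebra
  qed
  have "\<forall>\<^sub>F n in sequentially. norm \<beta> + 1 < norm (lam + of_nat n)"
    by (rule eventually_norm_shift_gt)
  then obtain M where M: "\<And>n. n \<ge> M \<Longrightarrow> norm \<beta> + 1 < norm (X n)"
    unfolding eventually_sequentially X_def x_def by auto
  have nz: "X n + \<beta> \<noteq> 0" "X n + 1 - \<beta> \<noteq> 0" if "n \<ge> M" for n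
  proof -
    show "X n + \<beta> \<noteq> 0"
    proof
      assume "X n + \<beta> = 0"
      then have "X n = - \<beta>" by (simp add: eq_neg_iff_add_eq_0)
      then show False using M[OF that] by simp
    qed
    show "X n + 1 - \<beta> \<noteq> 0"
    proof
      assume "X n + 1 - \<beta> = 0"
      then have "X n = \<beta> - 1" by (simp add: algebra_simps)
      then show False using M[OF that] norm_triangle_ineq4[of \<beta> 1] by simp
    qed
  qed
  \<comment> \<open>In the trivialisation \<open>d 1\<close> has coefficient 1; rescaling by this
    product gives it the coefficient \<open>X n + \<beta>\<close> of the tensor density module. The
    choice of \<open>M\<close> keeps the factors nonzero.\<close>
  define r where "r n = (\<Prod>j\<in>{M..<n}. X j + \<beta>)" for n
  have r0: "r n \<noteq> 0" for n using nz by (auto simp: r_def)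
  have r1: "r (Suc n) = r n * (X n + \<beta>)" if "n \<ge> M" for n using that by (simp add: r_def)
  have r2: "r (n + 2) = r n * (X n + \<beta>) * (X n + 1 + \<beta>)" if "n \<ge> M" for n
    using r1[OF that] r1[of "Suc n"] that by (simp add: X_Suc)
  define u where "u n = (1 / r n) *s g n v0" for n
  have gv: "g n v0 \<in> V (int n)" for n by (rule g_in[OF v0(2)])
  have gu: "g n v0 = r n *s u n" for n using r0[of n] by (simp add: u_def)
  show ?thesis
  proof
    fix n
    have "g n v0 \<noteq> 0" using g_inj[OF v0(2) subspace_0[OF subspace_V], of n] v0(1) lin_0[OF lin_g] by auto
    then show "u n \<noteq> 0" using r0[of n] by (simp add: u_def)
    have "V (int n) = g n ` V 0" using bij_g[of n] by (auto simp: bij_betw_def)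
    also have "\<dots> = range (\<lambda>c. (c * r n) *s u n)"
      unfolding v0(3) image_image lin_scale[OF lin_g] gu by simp
    also have "\<dots> = range (\<lambda>c. c *s u n)"
    proof -
      have "range (\<lambda>c. c * r n) = UNIV" using r0[of n] by (intro surjI[of _ "\<lambda>c. c / r n"]) simp
      then show ?thesis using image_image[of "\<lambda>c. c *s u n" "\<lambda>c. c * r n" UNIV] by simp
    qed
    finally show "V (int n) = range (\<lambda>c. c *s u n)" .
    assume n: "n \<ge> M"
    have "d 1 (u n) = (1 / r n) *s g (Suc n) v0" by (simp add: u_def d_simps g_Suc)
    also have "\<dots> = (X n + \<beta>) *s u (Suc n)" unfolding gu using r0[of n] r1[OF n] by simp
    finally show "d 1 (u n) = (x (int n) + \<beta>) *s u (Suc n)" unfolding X_def .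
    have "d (- 1) (u (Suc n)) = (1 / r (Suc n)) *s d (- 1) (d 1 (g n v0))"
      by (simp add: u_def d_simps g_Suc)
    also have "d (- 1) (d 1 (g n v0)) = D (X n + 1) *s g n v0"
      unfolding dm1_d1[OF gv] C_g[OF v0(2)] v0(4) lin_scale[OF lin_g] scale_merge D_def X_def
      by (simp add: algebra_simps)
    also have "(1 / r (Suc n)) *s \<dots> = (X n + 1 - \<beta>) *s u n"
    proof -
      have "1 / (r n * (X n + \<beta>)) * ((X n + 1 - \<beta>) * (X n + 1 + \<beta> - 1) * r n) = X n + 1 - \<beta>"
        using r0[of n] nz(1)[OF n] by (simp add: add.assoc)
      then show ?thesis unfolding gu D r1[OF n] scale_scale by (simp only:)
    qed
    finally show "d (- 1) (u (Suc n)) = (x (int n) + 1 - \<beta>) *s u n" unfolding X_def .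
    have "d 2 (u n) = (1 / r n * e n) *s g (n + 2) v0"
      unfolding u_def lin_scale[OF lin_d] g_E[OF v0(2), symmetric] e(1) lin_scale[OF lin_g] by simp
    also have "e n = (X n + 2 * \<beta>) / ((X n + \<beta>) * (X n + 1 + \<beta>))"
    proof -
      have nz': "X n + 1 + \<beta> \<noteq> 0" "X n + 2 - \<beta> \<noteq> 0"
        using nz[of "Suc n"] n by (auto simp: X_Suc add.commute)
      have "((X n + 1 - \<beta>) * (X n + 2 - \<beta>)) * ((X n + \<beta>) * (X n + 1 + \<beta>) * e n) =
          ((X n + 1 - \<beta>) * (X n + 2 - \<beta>)) * (X n + 2 * \<beta>)"
        using P[of n] unfolding P_def ch D by (simp add: algebra_simps)
      then have "e n * ((X n + \<beta>) * (X n + 1 + \<beta>)) = X n + 2 * \<beta>"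
        using nz(2)[OF n] nz' by (simp add: mult.commute[of "e n"])
      then show ?thesis using nz(1)[OF n] nz' by (subst nonzero_eq_divide_eq) simp_all
    qed
    also have "(1 / r n * \<dots>) *s g (n + 2) v0 = (X n + 2 * \<beta>) *s u (n + 2)"
    proof -
      have "1 / r n * ((X n + 2 * \<beta>) / ((X n + \<beta>) * (X n + 1 + \<beta>))) * r (n + 2) = X n + 2 * \<beta>"
        using r0[of "n + 2"] unfolding r2[OF n] by simp
      then show ?thesis unfolding gu scale_scale by (simp only:)
    qed
    finally show "d 2 (u n) = (x (int n) + 2 * \<beta>) *s u (n + 2)" unfolding X_def .
    have xn: "x (int n + 2) = X n + 2" by (simp add: X_def x_def)
    have "d (- 2) (u (n + 2)) = (1 / r (n + 2)) *s g n (F (X n + 2) *s v0)"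
      unfolding u_def lin_scale[OF lin_d] dm2_g[OF v0(2)] xn v0(4,5) scale_scale scale_merge F_def
      by (simp only: add_ac)
    also have "g n (F (X n + 2) *s v0) = (F (X n + 2) * r n) *s u n"
      unfolding lin_scale[OF lin_g] gu by simp
    also have "F (X n + 2) = (X n + 2 - 2 * \<beta>) * (X n + 1 + \<beta>) * (X n + \<beta>)"
      using F[of "X n + 1"] unfolding cf by (simp add: add.commute)
    also have "(1 / r (n + 2)) *s ((\<dots> * r n) *s u n) = (X n + 2 - 2 * \<beta>) *s u n"
    proof -
      have "1 / r (n + 2) * ((X n + 2 - 2 * \<beta>) * (X n + 1 + \<beta>) * (X n + \<beta>) * r n) = X n + 2 - 2 * \<beta>"
        using r0[of "n + 2"] unfolding r2[OF n] by simp
      then show ?thesis unfolding scale_scale by (simp only:)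
    qed
    finally show "d (- 2) (u (n + 2)) = (x (int n) + 2 - 2 * \<beta>) *s u n" unfolding X_def .
  qed
qed

lemma half_tensor_module:
  obtains \<beta> w M where "\<And>n::int. n \<ge> M \<Longrightarrow> w n \<noteq> 0" "\<And>n. n \<ge> M \<Longrightarrow> w n \<in> V n"
    "\<And>n k. n \<ge> M \<Longrightarrow> n + k \<ge> M \<Longrightarrow> d k (w n) = (x n + of_int k * \<beta>) *s w (n + k)"
proof -
  obtain \<beta> u and K :: nat where u0: "\<And>n. n \<ge> K \<Longrightarrow> u n \<noteq> 0"
    and uV: "\<And>n. n \<ge> K \<Longrightarrow> V (int n) = range (\<lambda>c. c *s u n)"
    and p1: "\<And>n. n \<ge> K \<Longrightarrow> d 1 (u n) = (x (int n) + \<beta>) *s u (Suc n)"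
    and m1: "\<And>n. n \<ge> K \<Longrightarrow> d (- 1) (u (Suc n)) = (x (int n) + 1 - \<beta>) *s u n"
    and p2: "\<And>n. n \<ge> K \<Longrightarrow> d 2 (u n) = (x (int n) + 2 * \<beta>) *s u (n + 2)"
    and m2: "\<And>n. n \<ge> K \<Longrightarrow> d (- 2) (u (n + 2)) = (x (int n) + 2 - 2 * \<beta>) *s u n"
    by (rule half_tensor_basis, rule that)
  have xS: "x (1 + int n) = x (int n) + 1" "x (int n + int k) = x (int n) + of_nat k" for n k
    by (simp_all add: x_def)
  have uin: "u n \<in> V (int n)" if "n \<ge> K" for n
  proof -
    have "1 *s u n \<in> V (int n)" unfolding uV[OF that] by (rule rangeI)
    then show ?thesis by simp
  qed
  have pk: "d (int k) (u n) = (x (int n) + of_nat k * \<beta>) *s u (n + k)" if "k \<ge> 1" "n \<ge> K" for n k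
    using that
  proof (induction k arbitrary: n rule: dec_induct)
    case base
    then show ?case using p1 by simp
  next
    case (step k)
    show ?case
    proof (cases "k = 1")
      case True
      then show ?thesis using p2[OF step.prems] by (simp add: numeral_2_eq_2)
    next
      case False
      define X kc where "X = x (int n)" and "kc = (of_nat k :: complex)"
      have c: "kc - 1 \<noteq> 0" using False by (simp add: kc_def)
      have "(kc - 1) *s d (int (Suc k)) (u n) = d 1 (d (int k) (u n)) - d (int k) (d 1 (u n))"
        using bracket[of 1 "int k" "u n"] by (simp add: kc_def)
      also have "d 1 (d (int k) (u n)) = ((X + kc * \<beta>) * (X + kc + \<beta>)) *s u (n + Suc k)"
        using p1[of "n + k"] step.prems unfolding step.IH[OF step.prems] lin_scale[OF lin_d]
        by (simp add: X_def kc_def x_def add.assoc)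
      also have "d (int k) (d 1 (u n)) = ((X + \<beta>) * (X + 1 + kc * \<beta>)) *s u (n + Suc k)"
        using step.IH[of "Suc n"] step.prems unfolding p1[OF step.prems] lin_scale[OF lin_d]
        by (simp add: X_def kc_def xS(1))
      finally have "(kc - 1) *s d (int (Suc k)) (u n) =
          ((X + kc * \<beta>) * (X + kc + \<beta>) - (X + \<beta>) * (X + 1 + kc * \<beta>)) *s u (n + Suc k)"
        unfolding scale_merge .
      also have "(X + kc * \<beta>) * (X + kc + \<beta>) - (X + \<beta>) * (X + 1 + kc * \<beta>) = (kc - 1) * (X + (kc + 1) * \<beta>)"
        by (simp add: algebra_simps)
      finally have "(kc - 1) *s d (int (Suc k)) (u n) = (kc - 1) *s ((X + (kc + 1) * \<beta>) *s u (n + Suc k))" by simp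
      then have "d (int (Suc k)) (u n) = (X + (kc + 1) * \<beta>) *s u (n + Suc k)"
        using c by (simp only: scale_left_imp_eq[OF c])
      then show ?thesis by (simp add: X_def kc_def add.commute)
    qed
  qed
  have mk: "d (- int k) (u (n + k)) = (x (int n) + of_nat k - of_nat k * \<beta>) *s u n" if "k \<ge> 1" "n \<ge> K" for n k
    using that
  proof (induction k arbitrary: n rule: dec_induct)
    case base
    then show ?case using m1 by simp
  next
    case (step k)
    show ?case
    proof (cases "k = 1")
      case True
      then show ?thesis using m2[OF step.prems] by (simp add: numeral_2_eq_2)
    next
      case False
      define X kc where "X = x (int n)" and "kc = (of_nat k :: complex)"
      have c: "1 - kc \<noteq> 0" using False by (simp add: kc_def)
      let ?w = "u (n + Suc k)"
      have "(1 - kc) *s d (- int (Suc k)) ?w = d (- 1) (d (- int k) ?w) - d (- int k) (d (- 1) ?w)"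
        using bracket[of "- 1" "- int k" ?w] step.hyps by (simp add: kc_def)
      also have "d (- int k) ?w = (X + 1 + kc - kc * \<beta>) *s u (Suc n)"
        using step.IH[of "Suc n"] step.prems by (simp add: X_def kc_def xS(1))
      also have "d (- 1) \<dots> = ((X + 1 + kc - kc * \<beta>) * (X + 1 - \<beta>)) *s u n"
        unfolding lin_scale[OF lin_d] m1[OF step.prems] by (simp add: X_def)
      also have "d (- 1) ?w = (X + kc + 1 - \<beta>) *s u (n + k)"
        using m1[of "n + k"] step.prems by (simp add: X_def kc_def x_def add.assoc)
      also have "d (- int k) \<dots> = ((X + kc + 1 - \<beta>) * (X + kc - kc * \<beta>)) *s u n"
        unfolding lin_scale[OF lin_d] step.IH[OF step.prems] by (simp add: X_def kc_def)
      also have "((X + 1 + kc - kc * \<beta>) * (X + 1 - \<beta>)) *s u n - ((X + kc + 1 - \<beta>) * (X + kc - kc * \<beta>)) *s u n =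
          ((X + 1 + kc - kc * \<beta>) * (X + 1 - \<beta>) - (X + kc + 1 - \<beta>) * (X + kc - kc * \<beta>)) *s u n"
        unfolding scale_merge ..
      also have "(X + 1 + kc - kc * \<beta>) * (X + 1 - \<beta>) - (X + kc + 1 - \<beta>) * (X + kc - kc * \<beta>) =
          (1 - kc) * (X + (kc + 1) - (kc + 1) * \<beta>)"
        by (simp add: algebra_simps)
      finally have "(1 - kc) *s d (- int (Suc k)) ?w = (1 - kc) *s ((X + (kc + 1) - (kc + 1) * \<beta>) *s u n)" by simp
      then have "d (- int (Suc k)) ?w = (X + (kc + 1) - (kc + 1) * \<beta>) *s u n"
        by (rule scale_left_imp_eq[OF c])
      then show ?thesis by (simp add: X_def kc_def add.commute)
    qed
  qed
  show ?thesis
  proof (rule that[of "int K" "\<lambda>n. u (nat n)" \<beta>])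
    fix n assume n: "n \<ge> int K"
    then have "nat n \<ge> K" by simp
    then show "u (nat n) \<noteq> 0" "u (nat n) \<in> V n" using u0 uin[of "nat n"] n by auto
    fix k assume nk: "n + k \<ge> int K"
    consider "k = 0" | "k \<ge> 1" | "k \<le> - 1" by linarith
    then show "d k (u (nat n)) = (x n + of_int k * \<beta>) *s u (nat (n + k))"
    proof cases
      case 1
      then show ?thesis using d0_V[OF uin[of "nat n"]] n by simp
    next
      case 2
      then show ?thesis using pk[of "nat k" "nat n"] n by (simp add: nat_add_distrib of_nat_nat)
    next
      case 3
      define j m where "j = nat (- k)" and "m = nat (n + k)"
      have jm: "k = - int j" "n = int m + int j" "j \<ge> 1" "m \<ge> K" using 3 nk by (auto simp: j_def m_def)
      have "nat n = m + j" "nat (n + k) = m" using jm by simp_all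
      moreover have "x n = x (int m) + of_nat j" by (simp add: jm(2) x_def)
      ultimately show ?thesis using mk[OF jm(3,4)] by (simp add: jm(1))
    qed
  qed
qed

text \<open>\<open>G\<close> collects the vectors killed by all large \<open>d l\<close>;
  \<open>R n\<close> those on which large \<open>d l\<close> act as on \<open>c\<close> times a
  formal basis vector of index \<open>n\<close>, even for \<open>n\<close> below the range of
  \<open>w\<close>. Irreducibility makes \<open>G\<close> zero and the span of all
  \<open>R n\<close> everything.\<close>

theorem half_dim_le_1:
  assumes u: "u \<in> V n" "u \<noteq> 0" and v: "v \<in> V n"
  shows "\<exists>c. v = c *s u"
proof -
  obtain \<beta> w and M :: int where w0: "\<And>n. n \<ge> M \<Longrightarrow> w n \<noteq> 0" and wV: "\<And>n. n \<ge> M \<Longrightarrow> w n \<in> V n"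
    and dw: "\<And>n k. n \<ge> M \<Longrightarrow> n + k \<ge> M \<Longrightarrow> d k (w n) = (x n + of_int k * \<beta>) *s w (n + k)"
    by (rule half_tensor_module, rule that)
  have comm: "d l (d k z) = d k (d l z) + of_int (k - l) *s d (k + l) z" if "k + l \<noteq> 0" for k l z
    using bracket[of l k z] that by (simp add: algebra_simps)
  define G where "G = {z. \<exists>k0. \<forall>k\<ge>k0. d k z = 0}"
  have "G = {0} \<or> G = UNIV"
  proof (rule irred)
    show "subspace G"
    proof (rule subspaceI)
      show "0 \<in> G" by (simp add: G_def d_simps)
      fix y z assume "y \<in> G" "z \<in> G"
      then obtain k1 k2 where "\<forall>k\<ge>k1. d k y = 0" "\<forall>k\<ge>k2. d k z = 0" by (auto simp: G_def)
      then have "\<forall>k\<ge>max k1 k2. d k (y + z) = 0" by (simp add: d_simps)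
      then show "y + z \<in> G" unfolding G_def by blast
    next
      fix c z assume "z \<in> G"
      then obtain k1 where "\<forall>k\<ge>k1. d k z = 0" by (auto simp: G_def)
      then have "\<forall>k\<ge>k1. d k (c *s z) = 0" by (simp add: d_simps)
      then show "c *s z \<in> G" unfolding G_def by blast
    qed
    fix k z assume "z \<in> G"
    then obtain k0 where k0: "\<And>l. l \<ge> k0 \<Longrightarrow> d l z = 0" by (auto simp: G_def)
    have "d l (d k z) = 0" if "l \<ge> \<bar>k0\<bar> + \<bar>k\<bar> + 1" for l
    proof -
      have "k + l \<noteq> 0" "l \<ge> k0" "k + l \<ge> k0" using that by linarith+
      then show ?thesis using comm[of k l z] k0[of l] k0[of "k + l"] by (simp add: d_simps)
    qed
    then show "d k z \<in> G" unfolding G_def by blast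
  qed
  moreover have "G \<noteq> UNIV"
  proof
    assume "G = UNIV"
    \<comment> \<open>At most one weight is 0, and it is avoided: for \<open>x m = 0\<close> and
      \<open>\<beta> = 0\<close> the vector \<open>w m\<close> would be killed by all large
      \<open>d l\<close>.\<close>
    define m where "m = (if x M = 0 then M + 1 else M)"
    have m: "m \<ge> M" "x m \<noteq> 0" by (auto simp: m_def x_add)
    have "w m \<in> G" using \<open>G = UNIV\<close> by simp
    then obtain k0 where k0: "\<And>k. k \<ge> k0 \<Longrightarrow> d k (w m) = 0" by (auto simp: G_def)
    define k where "k = \<bar>k0\<bar>"
    have z: "x m + of_int l * \<beta> = 0" if "l \<ge> k" for l
    proof -
      have l: "l \<ge> k0" "m + l \<ge> M" using that m(1) by (auto simp: k_def)
      have "(x m + of_int l * \<beta>) *s w (m + l) = 0" using dw[OF m(1) l(2)] k0[OF l(1)] by simp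
      then show ?thesis using w0[OF l(2)] by simp
    qed
    have "\<beta> = 0" using z[of k] z[of "k + 1"] by (simp add: distrib_right add.assoc[symmetric])
    then show False using z[of k] m(2) by simp
  qed
  ultimately have G: "G = {0}" by blast
  define R where "R n = {z \<in> V n. \<exists>c k0. \<forall>l\<ge>k0. n + l \<ge> M \<and> d l z = (c * (x n + of_int l * \<beta>)) *s w (n + l)}" for n
  have sR: "subspace (R n)" for n
  proof (rule subspaceI)
    have "\<forall>l\<ge>M - n. n + l \<ge> M \<and> d l 0 = (0 * (x n + of_int l * \<beta>)) *s w (n + l)" by (simp add: d_simps)
    then show "0 \<in> R n" unfolding R_def using subspace_0[OF subspace_V] by blast
    fix y z assume "y \<in> R n" "z \<in> R n"
    then obtain c1 k1 c2 k2 where yz: "y \<in> V n" "z \<in> V n"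
      "\<forall>l\<ge>k1. n + l \<ge> M \<and> d l y = (c1 * (x n + of_int l * \<beta>)) *s w (n + l)"
      "\<forall>l\<ge>k2. n + l \<ge> M \<and> d l z = (c2 * (x n + of_int l * \<beta>)) *s w (n + l)" by (auto simp: R_def)
    then have "\<forall>l\<ge>max k1 k2. n + l \<ge> M \<and> d l (y + z) = ((c1 + c2) * (x n + of_int l * \<beta>)) *s w (n + l)"
      by (simp add: lin_add[OF lin_d] scale_merge distrib_right)
    then show "y + z \<in> R n" unfolding R_def using subspace_add[OF subspace_V yz(1,2)] by blast
  next
    fix a z assume "z \<in> R n"
    then obtain c1 k1 where z: "z \<in> V n"
      "\<forall>l\<ge>k1. n + l \<ge> M \<and> d l z = (c1 * (x n + of_int l * \<beta>)) *s w (n + l)" by (auto simp: R_def)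
    then have "\<forall>l\<ge>k1. n + l \<ge> M \<and> d l (a *s z) = ((a * c1) * (x n + of_int l * \<beta>)) *s w (n + l)"
      by (simp add: lin_scale[OF lin_d] mult.assoc)
    then show "a *s z \<in> R n" unfolding R_def using subspace_scale[OF subspace_V z(1)] by blast
  qed
  have dR: "d k z \<in> R (n + k)" if zR: "z \<in> R n" for k n z
  proof -
    obtain c k0 where z: "z \<in> V n"
      "\<And>l. l \<ge> k0 \<Longrightarrow> n + l \<ge> M" "\<And>l. l \<ge> k0 \<Longrightarrow> d l z = (c * (x n + of_int l * \<beta>)) *s w (n + l)"
      using zR by (auto simp: R_def)
    have "n + k + l \<ge> M \<and> d l (d k z) = ((c * (x n + of_int k * \<beta>)) * (x (n + k) + of_int l * \<beta>)) *s w (n + k + l)"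
      if l: "l \<ge> \<bar>k0\<bar> + \<bar>k\<bar> + 1" for l
    proof -
      have l': "k + l \<noteq> 0" "l \<ge> k0" "k + l \<ge> k0" using l by linarith+
      have M: "n + k + l \<ge> M" "n + l + k \<ge> M" using z(2)[OF l'(3)] by simp_all
      define X L kk where "X = x n" and "L = (of_int l :: complex)" and "kk = (of_int k :: complex)"
      have x: "x (n + l) = X + L" "x (n + k) = X + kk" by (simp_all add: X_def L_def kk_def x_add)
      have nkl: "n + l + k = n + k + l" "n + (k + l) = n + k + l" by simp_all
      have "d l (d k z) = d k (d l z) + of_int (k - l) *s d (k + l) z" by (rule comm[OF l'(1)])
      also have "d k (d l z) = (c * (X + L * \<beta>) * (X + L + kk * \<beta>)) *s w (n + k + l)"
        unfolding z(3)[OF l'(2)] lin_scale[OF lin_d] dw[OF z(2)[OF l'(2)] M(2)] x nkl scale_scale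
        by (simp add: X_def L_def kk_def)
      also have "d (k + l) z = (c * (X + (kk + L) * \<beta>)) *s w (n + k + l)"
        unfolding z(3)[OF l'(3)] nkl by (simp add: X_def L_def kk_def)
      also have "of_int (k - l) *s \<dots> = ((kk - L) * (c * (X + (kk + L) * \<beta>))) *s w (n + k + l)"
        by (simp add: L_def kk_def)
      finally have "d l (d k z) = (c * (X + L * \<beta>) * (X + L + kk * \<beta>) + (kk - L) * (c * (X + (kk + L) * \<beta>))) *s w (n + k + l)"
        unfolding scale_merge .
      \<comment> \<open>The bracket relation of tensor densities: the scalar attached to
        \<open>d k z\<close> is \<open>c * (x n + of_int k * \<beta>)\<close>, independent of
        \<open>l\<close>.\<close>
      also have "c * (X + L * \<beta>) * (X + L + kk * \<beta>) + (kk - L) * (c * (X + (kk + L) * \<beta>)) =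
          (c * (X + kk * \<beta>)) * (X + kk + L * \<beta>)"
        by (simp add: algebra_simps)
      finally show ?thesis using M(1) unfolding x by (simp add: X_def L_def kk_def)
    qed
    then show ?thesis unfolding R_def using d_V[OF z(1)] by blast
  qed
  define S where "S = span (\<Union>n. R n)"
  have "S = {0} \<or> S = UNIV"
  proof (rule irred)
    show "subspace S" unfolding S_def by (rule subspace_span)
    fix k z assume z: "z \<in> S"
    have "d k e \<in> S" if "e \<in> (\<Union>n. R n)" for e
      unfolding S_def using that dR by (intro span_base) blast
    from lin_image_span[OF lin_d this \<open>subspace S\<close>] z show "d k z \<in> S" unfolding S_def by blast
  qed
  moreover have "S \<noteq> {0}"
  proof -
    have "\<forall>l\<ge>0. M + l \<ge> M \<and> d l (w M) = (1 * (x M + of_int l * \<beta>)) *s w (M + l)" using dw[of M] by simp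
    then have "w M \<in> R M" unfolding R_def using wV[of M] by blast
    then have "w M \<in> S" unfolding S_def by (intro span_base) blast
    then show ?thesis using w0[of M] by auto
  qed
  ultimately have S: "S = UNIV" by blast
  have VR: "z \<in> R n" if z: "z \<in> V n" for z
  proof -
    define P where "P = {y + z | y z. y \<in> R n \<and> z \<in> span (\<Union>m\<in>- {n}. V m)}"
    have sP: "subspace P" unfolding P_def by (rule subspace_sums[OF sR subspace_span])
    have RV: "R m \<subseteq> V m" for m by (auto simp: R_def)
    have "S \<subseteq> P" unfolding S_def
    proof (rule span_minimal[OF _ sP], rule subsetI)
      fix e assume "e \<in> (\<Union>m. R m)"
      then obtain m where m: "e \<in> R m" by blast
      show "e \<in> P"
      proof (cases "m = n")
        case True
        then have "e = e + 0 \<and> e \<in> R n \<and> 0 \<in> span (\<Union>m\<in>- {n}. V m)" using m span_zero by simp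
        then show ?thesis unfolding P_def by blast
      next
        case False
        then have "e \<in> span (\<Union>m\<in>- {n}. V m)" using m RV by (intro span_base) blast
        then have "e = 0 + e \<and> 0 \<in> R n \<and> e \<in> span (\<Union>m\<in>- {n}. V m)" using subspace_0[OF sR] by simp
        then show ?thesis unfolding P_def by blast
      qed
    qed
    then have "z \<in> P" using S by blast
    then obtain y y' where y: "z = y + y'" "y \<in> R n" "y' \<in> span (\<Union>m\<in>- {n}. V m)" unfolding P_def by blast
    have "y' = z - y" using y(1) by simp
    then have "y' \<in> V n" using z y(2) RV subspace_diff[OF subspace_V] by blast
    then have "y' = 0" using V_inter_other y(3) by blast
    then show ?thesis using y by simp
  qed
  obtain c1 k1 where c1: "\<And>l. l \<ge> k1 \<Longrightarrow> d l u = (c1 * (x n + of_int l * \<beta>)) *s w (n + l)"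
    using VR[OF u(1)] by (auto simp: R_def)
  obtain c2 k2 where c2: "\<And>l. l \<ge> k2 \<Longrightarrow> d l v = (c2 * (x n + of_int l * \<beta>)) *s w (n + l)"
    using VR[OF v] by (auto simp: R_def)
  have "c1 \<noteq> 0"
  proof
    assume "c1 = 0"
    then have "\<forall>l\<ge>k1. d l u = 0" using c1 by simp
    then have "u \<in> G" unfolding G_def by blast
    then show False using G u(2) by simp
  qed
  have "d l (c1 *s v - c2 *s u) = 0" if "l \<ge> max k1 k2" for l
    using that c1[of l] c2[of l] by (simp add: d_simps mult_ac)
  then have "c1 *s v - c2 *s u \<in> G" unfolding G_def by blast
  then have "c1 *s v = c2 *s u" using G by simp
  then have "v = (c2 / c1) *s u"
    using \<open>c1 \<noteq> 0\<close> by (metis divide_inverse_commute left_inverse scale_one scale_scale)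
  then show ?thesis ..
qed

end

section \<open>Arbitrary support: reindexing, reflection and the case of bounded support\<close>

context vir_module
begin

lemma bij_far: "\<exists>M. \<forall>m. \<bar>m\<bar> \<ge> M \<longrightarrow> bij_betw (d 1) (V m) (V (m + 1))"
proof (rule sl2_bijective[OF lin_d lin_d fdim_V])
  fix m v assume v: "v \<in> V m"
  show "d 1 v \<in> V (m + 1)" "d (- 1) v \<in> V (m - 1)" using d_V[OF v, of 1] d_V[OF v, of "- 1"] by simp_all
  show "d 1 (d (- 1) v) - d (- 1) (d 1 v) = (- 2 * (lam + of_int m)) *s v"
    using bracket[of 1 "- 1" v] d0_V[OF v] by (simp add: x_def)
qed

lemma dim_le_1_upper:
  assumes unb: "\<And>M. \<exists>m\<ge>M. V m \<noteq> {0}" and u: "u \<in> V n" "u \<noteq> 0" and v: "v \<in> V n"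
  shows "\<exists>c. v = c *s u"
proof -
  obtain M where M: "\<And>m. \<bar>m\<bar> \<ge> M \<Longrightarrow> bij_betw (d 1) (V m) (V (m + 1))" using bij_far by blast
  obtain m where m: "m \<ge> max 0 M" "V m \<noteq> {0}" using unb by blast
  define lam' where "lam' = lam + of_int m"
  have W: "{v. d 0 v = (lam' + of_int n) *s v} = V (m + n)" for n
    by (simp add: V_def x_def lam'_def add.assoc)
  have "(\<Union>n. V (m + n)) = (\<Union>n. V n)"
  proof -
    have "v \<in> (\<Union>n. V (m + n))" if "v \<in> V n" for v n using that by (intro UN_I[of "n - m"]) simp_all
    then show ?thesis by blast
  qed
  then have sp: "span (\<Union>n. V (m + n)) = UNIV" using span_V by simp
  interpret H: vir_module scale d lam' kap N
  proof (intro vir_module.intro vir_module_axioms.intro complex_vector_space_axioms)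
    show "fdim N {v. d 0 v = (lam' + of_int n) *s v}" for n unfolding W by (rule fdim_V)
    show "span (\<Union>n. {v. d 0 v = (lam' + of_int n) *s v}) = UNIV" unfolding W by (rule sp)
  qed (fact lin_d bracket irred)+
  have HV: "H.V n = V (m + n)" for n using W[of n] by (simp add: H.V_def H.x_def)
  interpret H: vir_half scale d lam' kap N
  proof
    show "H.V 0 \<noteq> {0}" using m(2) by (simp add: HV)
    fix n :: int assume "0 \<le> n"
    then have "bij_betw (d 1) (V (m + n)) (V (m + n + 1))" using m(1) by (intro M) linarith
    then show "bij_betw (d 1) (H.V n) (H.V (n + 1))" by (simp add: HV add.assoc)
  qed
  show ?thesis by (rule H.half_dim_le_1[of u "n - m" v]) (use u v in \<open>simp_all add: HV\<close>)
qed

lemma mirror: "vir_module scale (\<lambda>k v. - d (- k) v) (- lam) (- kap) N"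
proof -
  have W: "{v. - d (- 0) v = (- lam + of_int n) *s v} = V (- n)" for n
  proof -
    have "- d (- 0) v = (- lam + of_int n) *s v \<longleftrightarrow> d 0 v = (lam + of_int (- n)) *s v" for v
    proof -
      have "(- lam + of_int n) *s v = - ((lam + of_int (- n)) *s v)" by (simp flip: scale_minus_left)
      then show ?thesis by simp
    qed
    then show ?thesis by (simp add: V_def x_def)
  qed
  have "(\<Union>n. V (- n)) = (\<Union>n. V n)"
  proof -
    have "v \<in> (\<Union>n. V (- n))" if "v \<in> V n" for v n using that by (intro UN_I[of "- n"]) simp_all
    then show ?thesis by blast
  qed
  then have sp: "span (\<Union>n. V (- n)) = UNIV" using span_V by simp
  show ?thesis
  proof (intro vir_module.intro vir_module_axioms.intro complex_vector_space_axioms, goal_cases)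
    case (1 k)
    show ?case by (rule linI) (simp_all add: d_simps)
  next
    case (2 m n v)
    have e: "- m - n = - (m + n)" "- m + - n = - (m + n)" "(- m) ^ 3 - - m = - (m ^ 3 - m)" by simp_all
    have "- d (- m) (- d (- n) v) - - d (- n) (- d (- m) v) = d (- m) (d (- n) v) - d (- n) (d (- m) v)"
      by (simp add: d_simps)
    also have "\<dots> = of_int (m - n) *s d (- (m + n)) v
        + (if m + n = 0 then (of_int (- (m ^ 3 - m)) / 12 * kap) *s v else 0)"
      unfolding bracket[of "- m" "- n" v] e by simp
    also have "of_int (m - n) *s d (- (m + n)) v = of_int (n - m) *s - d (- (m + n)) v"
      by (simp add: scale_left_diff_distrib)
    also have "of_int (- (m ^ 3 - m)) / 12 * kap = of_int (m ^ 3 - m) / 12 * - kap" by (simp add: field_simps)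
    finally show ?case .
  next
    case (3 n)
    show ?case unfolding W by (rule fdim_V)
  next
    case 4
    show ?case unfolding W by (rule sp)
  next
    case (5 W)
    show ?case
    proof (rule irred[OF 5(1)])
      fix k w assume "w \<in> W"
      then have "- d k w \<in> W" using 5(2)[of w "- k"] by simp
      then show "d k w \<in> W" using subspace_neg[OF 5(1)] by fastforce
    qed
  qed
qed

text \<open>Bounded support makes \<open>d k\<close> vanish for large modulus of \<open>k\<close>,
  and every other \<open>d k\<close> with \<open>k \<noteq> 0\<close> is a multiple of a bracket of
  two such operators. \<open>d 0\<close> comes from \<open>d (- 1)\<close> and \<open>d 1\<close>,
  whose central term is 0.\<close>

lemma bounded_support_trivial:
  assumes M: "\<And>m. m \<ge> M \<Longrightarrow> V m = {0}" "\<And>m. m \<le> - M \<Longrightarrow> V m = {0}"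
  shows "d k v = 0"
proof -
  have far: "d k v = 0" if k: "\<bar>k\<bar> \<ge> 2 * \<bar>M\<bar>" for k v
  proof -
    have "d k e = 0" if e: "e \<in> (\<Union>n. V n)" for e
    proof -
      obtain n where n: "e \<in> V n" using e by blast
      have dn: "d k e \<in> V (n + k)" by (rule d_V[OF n])
      consider "n \<ge> M" | "n \<le> - M" | "n + k \<ge> M" | "n + k \<le> - M" using k by linarith
      then show ?thesis
        using M n dn by cases (auto simp: d_simps)
    qed
    from lin_eq_on_span[OF lin_d lin_zero this] show ?thesis using span_V by blast
  qed
  have nonzero: "d k v = 0" if k0: "k \<noteq> 0" for k v
  proof -
    define a where "a = 2 * \<bar>M\<bar> + \<bar>k\<bar>"
    have a: "\<bar>k - a\<bar> \<ge> 2 * \<bar>M\<bar>" "\<bar>a\<bar> \<ge> 2 * \<bar>M\<bar>" "a - (k - a) \<noteq> 0" using k0 by (auto simp: a_def abs_if)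
    then have "of_int (a - (k - a)) *s d k v = 0"
      using bracket[of "k - a" a v] k0 by (simp add: far d_simps del: of_int_diff)
    then show ?thesis using a(3) by (simp only: scale_eq_0_iff of_int_eq_0_iff) simp
  qed
  show ?thesis
  proof (cases "k = 0")
    case False
    then show ?thesis by (rule nonzero)
  next
    case True
    have "d 0 v = 0" using bracket[of "- 1" 1 v] by (simp add: nonzero d_simps)
    then show ?thesis using True by simp
  qed
qed

theorem dim_le_1:
  assumes nt: "d k w \<noteq> 0" and u: "u \<in> V n" "u \<noteq> 0" and v: "v \<in> V n"
  shows "\<exists>c. v = c *s u"
proof (cases "\<forall>M. \<exists>m\<ge>M. V m \<noteq> {0}")
  case True
  then show ?thesis using dim_le_1_upper[OF _ u v] by blast
next
  case False
  then obtain M where M: "\<And>m. m \<ge> M \<Longrightarrow> V m = {0}" by blast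
  interpret R: vir_module scale "\<lambda>k v. - d (- k) v" "- lam" "- kap" N by (rule mirror)
  have RV: "R.V m = V (- m)" for m
  proof -
    have "- d 0 v = (- lam + of_int m) *s v \<longleftrightarrow> d 0 v = (lam + of_int (- m)) *s v" for v
    proof -
      have "(- lam + of_int m) *s v = - ((lam + of_int (- m)) *s v)" by (simp flip: scale_minus_left)
      then show ?thesis by simp
    qed
    then show ?thesis by (simp add: R.V_def R.x_def V_def x_def)
  qed
  show ?thesis
  proof (cases "\<forall>M. \<exists>m\<ge>M. V (- m) \<noteq> {0}")
    case True
    show ?thesis
      by (rule R.dim_le_1_upper[of u "- n" v]) (use True u v in \<open>simp_all add: RV\<close>)
  next
    case False
    then obtain K where K: "\<And>m. m \<ge> K \<Longrightarrow> V (- m) = {0}" by blast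
    have "d k w = 0"
    proof (rule bounded_support_trivial[of "max M K"])
      fix m assume "m \<le> - max M K"
      then show "V m = {0}" using K[of "- m"] by simp
    qed (use M in simp)
    then show ?thesis using nt by simp
  qed
qed

end

section \<open>The loop-Virasoro algebra\<close>

lemma poly_additive_induct:
  assumes "\<And>c j. P (monom c j)" "\<And>p q. P p \<Longrightarrow> P q \<Longrightarrow> P (p + q)"
  shows "P (p :: 'a::comm_monoid_add poly)"
proof -
  have "P (\<Sum>i\<in>A. monom (coeff p i) i)" if "finite A" for A
    using that by induction (use assms(1)[of 0 0] assms in auto)
  from this[of "{..degree p}"] show ?thesis by (simp add: poly_as_sum_of_monoms)
qed

context complex_vector_space
begin

definition ev :: "(int \<Rightarrow> 'v \<Rightarrow> 'v) \<Rightarrow> complex poly \<Rightarrow> 'v \<Rightarrow> 'v" where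
  "ev f p v = (\<Sum>j\<le>degree p. coeff p j *s f (int j) v)"

lemma ev_eq: "degree p \<le> n \<Longrightarrow> ev f p v = (\<Sum>j\<le>n. coeff p j *s f (int j) v)"
  unfolding ev_def by (intro sum.mono_neutral_left) (auto simp: coeff_eq_0)

lemma ev_add: "ev f (p + q) v = ev f p v + ev f q v"
proof -
  let ?n = "max (degree p) (degree q)"
  have "degree (p + q) \<le> ?n" by (rule degree_add_le_max)
  then show ?thesis
    using ev_eq[of p ?n f v] ev_eq[of q ?n f v] ev_eq[of "p + q" ?n f v]
    by (simp add: scale_left_distrib sum.distrib)
qed

lemma ev_smult: "ev f (smult c p) v = c *s ev f p v"
  using ev_eq[of "smult c p" "degree p" f v] ev_eq[of p "degree p" f v]
  by (simp add: scale_sum_right)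

lemma ev_monom: "ev f (monom c j) v = c *s f (int j) v"
proof -
  have "ev f (monom c j) v = (\<Sum>i\<le>j. if i = j then c *s f (int j) v else 0)"
    unfolding ev_eq[OF degree_monom_le] by (rule sum.cong) auto
  then show ?thesis by simp
qed

lemma ev_lin: "(\<And>j. lin (f j)) \<Longrightarrow> lin (ev f p)"
proof (induction p rule: poly_additive_induct)
  case (1 c j)
  then show ?case unfolding ev_monom[abs_def] by (intro lin_smult)
next
  case (2 p q)
  show ?case unfolding ev_add[abs_def] by (rule lin_plus[OF 2(1)[OF 2(3)] 2(2)[OF 2(3)]])
qed

end

locale bounded_loop_module = loop_vir_module scale act
  for scale :: "complex \<Rightarrow> 'v::ab_group_add \<Rightarrow> 'v" (infixr "*s" 75)
    and act :: "loop_vir \<Rightarrow> 'v \<Rightarrow> 'v" +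
  fixes lam :: complex
  assumes bounded: uniformly_bounded and nontrivial: "\<not> trivial" and irreducible: irreducible
    and weight: "weight_space lam \<noteq> {0}"

sublocale bounded_loop_module \<subseteq> complex_vector_space scale
  by (rule complex_vector_space.intro) (rule V.vector_space_axioms)

context bounded_loop_module
begin

definition D :: "int \<Rightarrow> int \<Rightarrow> 'v \<Rightarrow> 'v" where
  "D k j v = act (Poly_Mapping.single (VD k, j) 1) v"

definition Z :: "int \<Rightarrow> 'v \<Rightarrow> 'v" where
  "Z j v = act (Poly_Mapping.single (VC, j) 1) v"

lemma act_single: "act (Poly_Mapping.single (VD k, j) c) v = c *s D k j v"
  "act (Poly_Mapping.single (VC, j) c) v = c *s Z j v"
proof -
  have l: "act (loop_scale c x) v = c *s act x v" for x
    using linear_act_left[of v] by (simp add: Vector_Spaces.linear_iff)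
  show "act (Poly_Mapping.single (VD k, j) c) v = c *s D k j v"
    "act (Poly_Mapping.single (VC, j) c) v = c *s Z j v"
    unfolding D_def Z_def l[symmetric] loop_scale_single by simp_all
qed

lemma act_add: "act (x + y) v = act x v + act y v"
  using linear_act_left[of v] by (simp add: Vector_Spaces.linear_iff)

lemma act_zero: "act 0 v = 0"
  using act_add[of 0 0 v] by simp

lemma lin_D: "lin (D k j)" and lin_Z: "lin (Z j)"
  using linear_act_right by (simp_all add: D_def[abs_def] Z_def[abs_def])

lemma D_bracket: "D k i (D l j v) - D l j (D k i v) = of_int (l - k) *s D (k + l) (i + j) v
    + (if k + l = 0 then (of_int (k ^ 3 - k) / 12) *s Z (i + j) v else 0)"
proof -
  have "D k i (D l j v) - D l j (D k i v) =
      act (loop_bracket (Poly_Mapping.single (VD k, i) 1) (Poly_Mapping.single (VD l, j) 1)) v"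
    unfolding D_def act_bracket ..
  then show ?thesis unfolding loop_bracket_VD act_add act_single by simp
qed

lemma Z_D: "Z i (D l j v) = D l j (Z i v)"
proof -
  have "Z i (D l j v) - D l j (Z i v) =
      act (loop_bracket (Poly_Mapping.single (VC, i) 1) (Poly_Mapping.single (VD l, j) 1)) v"
    unfolding D_def Z_def act_bracket ..
  then show ?thesis by (simp add: act_zero)
qed

text \<open>The central coefficient in the bracket of d_2 and d_(-2) is (8 - 2) / 12 = 1/2. Hence
  subspaces stable under all \<open>D k j\<close> are submodules.\<close>

lemma Z_from_D: "Z j v = 2 *s (D 2 j (D (- 2) 0 v) - D (- 2) 0 (D 2 j v) + 4 *s D 0 j v)"
proof -
  have "D 2 j (D (- 2) 0 v) - D (- 2) 0 (D 2 j v) + 4 *s D 0 j v = (1 / 2) *s Z j v"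
    unfolding D_bracket by simp
  then show ?thesis by simp
qed

lemma D_irreducible:
  assumes W: "V.subspace W" "\<And>k j w. w \<in> W \<Longrightarrow> D k j w \<in> W"
  shows "W = {0} \<or> W = UNIV"
proof -
  have Z: "Z j w \<in> W" if "w \<in> W" for j w
    unfolding Z_from_D using that W by (intro V.subspace_scale V.subspace_add V.subspace_diff) auto
  have "act x w \<in> W" if w: "w \<in> W" for x w
  proof (induction x rule: loop_vir_induct)
    case (single a r)
    obtain b j where a: "a = (b, j)" by (cases a)
    show ?case unfolding a using w W Z by (cases b) (auto simp: act_single intro: V.subspace_scale)
  qed (use W(1) in \<open>simp_all add: act_zero act_add V.subspace_0 V.subspace_add\<close>)
  then have "submodule W" using W(1) by (simp add: submodule_def)
  then show ?thesis using irreducible by (auto simp: irreducible_def)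
qed

lemma D_nonzero: "\<exists>k j v. D k j v \<noteq> 0"
proof (rule ccontr)
  assume "\<nexists>k j v. D k j v \<noteq> 0"
  then have z: "D k j v = 0" for k j v by blast
  then have Z: "Z j v = 0" for j v unfolding Z_from_D by simp
  have "act x v = 0" for x v
  proof (induction x rule: loop_vir_induct)
    case (single a r)
    obtain b j where a: "a = (b, j)" by (cases a)
    show ?case unfolding a by (cases b) (simp_all add: act_single z Z)
  qed (simp_all add: act_zero act_add)
  then show False using nontrivial by (simp add: trivial_def)
qed

lemma weight_space_D: "weight_space \<mu> = {v. D 0 0 v = \<mu> *s v}"
  by (simp add: weight_space_def D_def d0_def)

lemma weight_subspace: "V.subspace (weight_space \<mu>)"
  unfolding weight_space_D by (rule V.subspaceI) (simp_all add: lin_simps[OF lin_D] algebra_simps)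

lemma D_weight: "v \<in> weight_space \<mu> \<Longrightarrow> D k j v \<in> weight_space (\<mu> + of_int k)"
  using D_bracket[of 0 0 k j v]
  by (cases "k = 0") (simp_all add: weight_space_D lin_simps[OF lin_D] algebra_simps)

lemma weights_fdim: "\<exists>N. \<forall>\<mu>. fdim N (weight_space \<mu>)"
proof -
  obtain N where N: "\<And>\<mu>. weight_space \<mu> \<noteq> {0} \<Longrightarrow>
      (\<exists>B. finite B \<and> weight_space \<mu> \<subseteq> V.span B) \<and> V.dim (weight_space \<mu>) < N"
    using bounded by (auto simp: uniformly_bounded_def)
  have "fdim N (weight_space \<mu>)" for \<mu>
  proof (cases "weight_space \<mu> = {0}")
    case True
    then show ?thesis using weight_subspace[of \<mu>] by (auto simp: fdim_def intro!: exI[of _ "{}"])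
  next
    case False
    obtain B where B: "finite B" "weight_space \<mu> \<subseteq> V.span B" using N[OF False] by blast
    obtain C where C: "C \<subseteq> weight_space \<mu>" "V.independent C" "weight_space \<mu> \<subseteq> V.span C" "card C = V.dim (weight_space \<mu>)"
      using V.basis_exists by blast
    have "finite C" using V.independent_span_bound[OF B(1) C(2)] B(2) C(1) by blast
    then show ?thesis using C N[OF False] weight_subspace unfolding fdim_def by (intro conjI exI[of _ C]) auto
  qed
  then show ?thesis by blast
qed

lemma weights_span: "V.span (\<Union>n. weight_space (lam + of_int n)) = UNIV"
proof -
  let ?S = "V.span (\<Union>n. weight_space (lam + of_int n))"
  have "?S = {0} \<or> ?S = UNIV"
  proof (rule D_irreducible)
    fix k j w assume w: "w \<in> ?S"
    have "D k j e \<in> ?S" if "e \<in> (\<Union>n. weight_space (lam + of_int n))" for e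
    proof -
      obtain n where "e \<in> weight_space (lam + of_int n)" using \<open>e \<in> _\<close> by blast
      from D_weight[OF this, of k j] have "D k j e \<in> weight_space (lam + of_int (n + k))" by (simp add: add.assoc)
      then show ?thesis by (intro V.span_base) blast
    qed
    from lin_image_span[OF lin_D this V.subspace_span w] show "D k j w \<in> ?S" .
  qed (rule V.subspace_span)
  moreover have "weight_space lam \<subseteq> ?S"
  proof -
    have "weight_space (lam + of_int 0) \<subseteq> (\<Union>n. weight_space (lam + of_int n))" by blast
    then have "weight_space lam \<subseteq> (\<Union>n. weight_space (lam + of_int n))" by simp
    then show ?thesis using V.span_superset by blast
  qed
  ultimately show ?thesis using weight V.subspace_0[OF weight_subspace[of lam]] by blast
qed

text \<open>Action of d_k times t^i p(t): the separate shift \<open>i\<close> reaches all Laurent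
  polynomials while the argument stays a polynomial.\<close>

definition R :: "int \<Rightarrow> int \<Rightarrow> complex poly \<Rightarrow> 'v \<Rightarrow> 'v" where
  "R k i = ev (\<lambda>j. D k (i + j))"

definition zeta :: "int \<Rightarrow> complex poly \<Rightarrow> 'v \<Rightarrow> 'v" where
  "zeta i = ev (\<lambda>j. Z (i + j))"

lemma lin_R: "lin (R k i p)" and lin_zeta: "lin (zeta i p)"
  unfolding R_def zeta_def by (rule ev_lin, rule lin_D, rule ev_lin, rule lin_Z)

lemma R_monom: "R k i (monom c j) v = c *s D k (i + int j) v"
  and zeta_monom: "zeta i (monom c j) v = c *s Z (i + int j) v"
  by (simp_all add: R_def zeta_def ev_monom)

lemma R_add: "R k i (p + q) v = R k i p v + R k i q v" and R_smult: "R k i (smult c p) v = c *s R k i p v"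
  and zeta_add: "zeta i (p + q) v = zeta i p v + zeta i q v" and zeta_smult: "zeta i (smult c p) v = c *s zeta i p v"
  by (simp_all add: R_def zeta_def ev_add ev_smult)

lemma R_bracket: "R k i p (R l j q v) - R l j q (R k i p v) = of_int (l - k) *s R (k + l) (i + j) (p * q) v
    + (if k + l = 0 then (of_int (k ^ 3 - k) / 12) *s zeta (i + j) (p * q) v else 0)"
proof (induction p arbitrary: v rule: poly_additive_induct)
  case (1 c m)
  show ?case
  proof (induction q rule: poly_additive_induct)
    case (1 c' m')
    have e: "i + int m + (j + int m') = i + j + int (m + m')" by simp
    have "R k i (monom c m) (R l j (monom c' m') v) - R l j (monom c' m') (R k i (monom c m) v) =
        (c * c') *s (D k (i + int m) (D l (j + int m') v) - D l (j + int m') (D k (i + int m) v))"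
      by (simp add: R_monom lin_simps[OF lin_D] V.scale_right_diff_distrib mult.commute)
    then show ?case
      unfolding D_bracket e mult_monom R_monom zeta_monom
      by (simp add: V.scale_right_distrib mult.commute mult.left_commute del: of_nat_add)
  next
    case (2 p q)
    then show ?case
      by (auto simp: R_add zeta_add lin_simps[OF lin_R] distrib_left V.scale_right_distrib algebra_simps split: if_splits)
  qed
next
  case (2 p1 p2)
  have "R k i (p1 + p2) (R l j q v) - R l j q (R k i (p1 + p2) v) =
      (R k i p1 (R l j q v) - R l j q (R k i p1 v)) + (R k i p2 (R l j q v) - R l j q (R k i p2 v))"
    by (simp add: R_add lin_simps[OF lin_R])
  also have "\<dots> = of_int (l - k) *s R (k + l) (i + j) ((p1 + p2) * q) v
    + (if k + l = 0 then (of_int (k ^ 3 - k) / 12) *s zeta (i + j) ((p1 + p2) * q) v else 0)"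
    unfolding 2 distrib_right R_add zeta_add V.scale_right_distrib by simp
  finally show ?case .
qed

lemma zeta_R: "zeta i p (R l j q v) = R l j q (zeta i p v)"
proof (induction p arbitrary: v rule: poly_additive_induct)
  case (1 c m)
  show ?case
  proof (induction q rule: poly_additive_induct)
    case (1 c' m')
    show ?case by (simp add: R_monom zeta_monom lin_simps[OF lin_D] lin_simps[OF lin_Z] Z_D mult.commute)
  qed (simp add: R_add lin_simps[OF lin_zeta])
qed (simp add: zeta_add lin_simps[OF lin_R])

lemma R_one: "R k i 1 = D k i"
  using R_monom[of k i 1 0] by (simp add: fun_eq_iff)

text \<open>The brackets of \<open>null_ideal\<close> again, now with a power of t carried by one of
  the factors.\<close>

lemma annihilator_shift:
  assumes q: "\<And>v. R 1 0 q v = 0"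
  shows "R k i q v = 0"
proof -
  have R1: "R 1 i q v = 0" for i v
    using R_bracket[of 0 i 1 1 0 q v] by (simp add: q lin_0[OF lin_R])
  have R2: "R k i q v = 0" if "k \<noteq> 2" for k v
    using R_bracket[of "k - 1" 0 1 1 i q v] that by (auto simp: R1 lin_0[OF lin_R] split: if_splits)
  show ?thesis
  proof (cases "k = 2")
    case True
    have "R 2 0 1 (R 0 i q v) - R 0 i q (R 2 0 1 v) = 0" using R2[of 0] by (simp add: lin_0[OF lin_R])
    then show ?thesis using R_bracket[of 2 0 1 0 i q v] True by simp
  qed (rule R2)
qed

text \<open>As t is invertible, factors t can be cancelled from an annihilating polynomial.\<close>

lemma annihilator_constant_coeff:
  assumes "p \<noteq> 0" "\<And>v. R 1 0 p v = 0"
  shows "\<exists>q. coeff q 0 \<noteq> 0 \<and> (\<forall>v. R 1 0 q v = 0)"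
  using assms
proof (induction p)
  case (pCons a p)
  show ?case
  proof (cases "a = 0")
    case True
    have "R k i (pCons 0 p) v = R k (i + 1) p v" for k i v
    proof (induction p rule: poly_additive_induct)
      case (1 c j)
      have "pCons 0 (monom c j) = monom c (Suc j)" by (simp add: monom_Suc)
      then show ?case by (simp add: R_monom add.assoc)
    next
      case (2 p q)
      have e: "pCons 0 (p + q) = pCons 0 p + pCons 0 q" by simp
      show ?case unfolding e R_add 2 by (rule refl)
    qed
    then have s: "R 1 (- 1) (pCons 0 p) v = R 1 0 p v" for v by simp
    have "R 1 0 p v = 0" for v
      unfolding s[symmetric] using annihilator_shift[OF pCons.prems(2)] True by simp
    moreover have "p \<noteq> 0" using pCons.prems(1) True by auto
    ultimately show ?thesis using pCons.IH by blast
  next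
    case False
    then show ?thesis using pCons.prems(2) by (intro exI[of _ "pCons a p"]) simp
  qed
qed simp

text \<open>Since \<open>q\<close> has a nonzero constant term, its annihilation after
  multiplication by t^i expresses \<open>D k i w\<close> by the \<open>D k (i + j) w\<close> with
  \<open>j \<ge> 1\<close>, so descending induction reaches all negative \<open>i\<close>. It keeps
  the module irreducible over the subalgebra with polynomial coefficients.\<close>

lemma D_negative_invariant:
  assumes q: "coeff q 0 \<noteq> 0" "\<And>v. R 1 0 q v = 0"
    and W: "V.subspace W" "\<And>k p w. w \<in> W \<Longrightarrow> R k 0 p w \<in> W" and w: "w \<in> W"
  shows "D k i w \<in> W"
proof -
  have "\<forall>i\<ge>- int m. D k i w \<in> W" for m
  proof (induction m)
    case 0
    have "D k i w \<in> W" if "i \<ge> 0" for i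
      using W(2)[OF w, of k "monom 1 (nat i)"] that by (simp add: R_monom)
    then show ?case by simp
  next
    case (Suc m)
    have "D k i w \<in> W" if i: "i \<ge> - int (Suc m)" for i
    proof (cases "i \<ge> - int m")
      case False
      have "0 = R k i q w" using annihilator_shift[OF q(2)] by simp
      also have "\<dots> = coeff q 0 *s D k i w + (\<Sum>j\<in>{1..degree q}. coeff q j *s D k (i + int j) w)"
      proof -
        have "{..degree q} = insert 0 {1..degree q}" by auto
        then show ?thesis unfolding R_def ev_def by simp
      qed
      finally have "coeff q 0 *s D k i w = - (\<Sum>j\<in>{1..degree q}. coeff q j *s D k (i + int j) w)"
        by (simp add: eq_neg_iff_add_eq_0)
      also have "\<dots> \<in> W"
        using Suc i by (intro V.subspace_neg[OF W(1)] V.subspace_sum[OF W(1)] V.subspace_scale[OF W(1)]) auto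
      finally have "(1 / coeff q 0) *s (coeff q 0 *s D k i w) \<in> W" by (rule V.subspace_scale[OF W(1)])
      then show ?thesis using q(1) by simp
    qed (use Suc in blast)
    then show ?case by blast
  qed
  from this[of "nat \<bar>i\<bar>"] show ?thesis by simp
qed

theorem weight_space_line:
  assumes u: "u \<in> weight_space lam" "u \<noteq> 0" and v: "v \<in> weight_space lam"
  shows "\<exists>c. v = c *s u"
proof -
  obtain N where N: "\<And>\<mu>. fdim N (weight_space \<mu>)" using weights_fdim by blast
  interpret PV: poly_vir scale "\<lambda>k. R k 0" "zeta 0" lam N
  proof (intro poly_vir.intro poly_vir_axioms.intro complex_vector_space_axioms)
    fix k l p q v and n :: int
    show "R k 0 p (R l 0 q v) - R l 0 q (R k 0 p v) = of_int (l - k) *s R (k + l) 0 (p * q) v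
      + (if k + l = 0 then (of_int (k ^ 3 - k) / 12) *s zeta 0 (p * q) v else 0)"
      using R_bracket[of k 0 p l 0 q v] by simp
    show "fdim N {v. R 0 0 1 v = (lam + of_int n) *s v}"
      using N[of "lam + of_int n"] by (simp add: weight_space_D R_one)
    show "V.span (\<Union>n. {v. R 0 0 1 v = (lam + of_int n) *s v}) = UNIV"
      using weights_span by (simp add: weight_space_D R_one)
  qed (fact lin_R lin_zeta R_add R_smult zeta_add zeta_smult zeta_R)+
  obtain p where "p \<noteq> 0" "\<And>v. R 1 0 p v = 0" using PV.annihilator_exists by (auto simp: PV.null_def)
  then obtain q where q: "coeff q 0 \<noteq> 0" "\<And>v. R 1 0 q v = 0"
    using annihilator_constant_coeff by blast
  interpret PV: irreducible_poly_vir scale "\<lambda>k. R k 0" "zeta 0" lam N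
  proof
    show "W = {0} \<or> W = UNIV" if "V.subspace W" "\<And>k p w. w \<in> W \<Longrightarrow> R k 0 p w \<in> W" for W
      by (rule D_irreducible[OF that(1)]) (rule D_negative_invariant[OF q that])
    show "\<exists>v :: 'v. v \<noteq> 0" using u(2) by blast
  qed
  have "\<not> PV.null 1"
  proof
    assume n: "PV.null 1"
    have "R k i 1 v = 0" for k i v by (rule annihilator_shift) (use n in \<open>simp add: PV.null_def\<close>)
    then show False using D_nonzero by (simp add: R_one)
  qed
  then obtain a where n: "PV.null [:- a, 1:]" using PV.evaluation_point by blast
  have a: "R k i [:- a, 1:] v = 0" for k i v by (rule annihilator_shift) (use n in \<open>simp add: PV.null_def\<close>)
  have Da: "D k (i + 1) v = a *s D k i v" for k i v
  proof -
    have "[:- a, 1:] = monom (- a) 0 + monom 1 1" by (simp add: monom_0 monom_altdef)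
    then have "- a *s D k i v + D k (i + 1) v = 0" using a[of k i v] by (simp add: R_add R_monom)
    then show ?thesis by (simp add: add_eq_0_iff2)
  qed
  have a0: "a \<noteq> 0"
  proof
    assume "a = 0"
    then have "D k i v = 0" for k i v using Da[of k "i - 1" v] by simp
    then show False using D_nonzero by blast
  qed
  \<comment> \<open>The factor is the power of \<open>a\<close> with exponent \<open>i\<close>;
    negative exponents use that \<open>a\<close> is nonzero.\<close>
  have Dc: "\<exists>c. \<forall>k v. D k i v = c *s D k 0 v" for i
  proof (induction i rule: int_induct[where k = 0])
    case base
    show ?case by (intro exI[of _ 1]) simp
  next
    case (step1 i)
    then obtain c where "\<forall>k v. D k i v = c *s D k 0 v" by blast
    then show ?case by (intro exI[of _ "a * c"]) (simp add: Da)
  next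
    case (step2 i)
    then obtain c where c: "\<And>k v. D k i v = c *s D k 0 v" by blast
    have "D k (i - 1) v = (c / a) *s D k 0 v" for k v
    proof -
      have "a *s D k (i - 1) v = c *s D k 0 v" using Da[of k "i - 1" v] c by simp
      then have "(1 / a) *s (a *s D k (i - 1) v) = (1 / a) *s (c *s D k 0 v)" by simp
      then show ?thesis using a0 by simp
    qed
    then show ?case by blast
  qed
  have ZV: "Z 0 v \<in> PV.V n" if "v \<in> PV.V n" for n v
    using that by (simp add: PV.V_def R_one lin_simps[OF lin_Z] flip: Z_D)
  have "\<exists>c. \<forall>v. Z 0 v = c *s v"
  proof (rule PV.schur[OF lin_Z ZV])
    show "Z 0 (R k 0 p v) = R k 0 p (Z 0 v)" for k p v
      using zeta_R[of 0 "monom 1 0" k 0 p v] by (simp only: zeta_monom) simp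
  qed
  then obtain kap where kap: "\<And>v. Z 0 v = kap *s v" by blast
  interpret VM: vir_module scale "\<lambda>k. D k 0" lam kap N
  proof (intro vir_module.intro vir_module_axioms.intro complex_vector_space_axioms)
    fix m n v
    show "D m 0 (D n 0 v) - D n 0 (D m 0 v) = of_int (n - m) *s D (m + n) 0 v
      + (if m + n = 0 then (of_int (m ^ 3 - m) / 12 * kap) *s v else 0)"
      unfolding D_bracket by (simp add: kap)
    show "fdim N {v. D 0 0 v = (lam + of_int n) *s v}"
      using N[of "lam + of_int n"] by (simp add: weight_space_D)
    show "V.span (\<Union>n. {v. D 0 0 v = (lam + of_int n) *s v}) = UNIV"
      using weights_span by (simp add: weight_space_D)
  next
    fix W assume W: "V.subspace W" "\<And>k w. w \<in> W \<Longrightarrow> D k 0 w \<in> W"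
    show "W = {0} \<or> W = UNIV"
    proof (rule D_irreducible[OF W(1)])
      fix k j w assume w: "w \<in> W"
      obtain c where "\<forall>k v. D k j v = c *s D k 0 v" using Dc by blast
      then show "D k j w \<in> W" using V.subspace_scale[OF W(1) W(2)[OF w]] by simp
    qed
  qed (rule lin_D)
  obtain k j w where "D k j w \<noteq> 0" using D_nonzero by blast
  moreover obtain c where "\<forall>k v. D k j v = c *s D k 0 v" using Dc by blast
  ultimately have "D k 0 w \<noteq> 0" by auto
  moreover have "VM.V 0 = weight_space lam" by (simp add: VM.V_def VM.x_def weight_space_D)
  ultimately show ?thesis using VM.dim_le_1[of k w u 0 v] u v by simp
qed

end

theorem theorem4p4:
  fixes scale :: "complex \<Rightarrow> 'v::ab_group_add \<Rightarrow> 'v"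
    and act :: "loop_vir \<Rightarrow> 'v \<Rightarrow> 'v"
  assumes "loop_vir_module scale act"
    and "loop_vir_module.uniformly_bounded scale act"
    and "\<not> lie_module.trivial act"
    and "lie_module.irreducible scale act"
  shows "\<forall>\<mu>. loop_vir_module.weight_space scale act \<mu> \<noteq> {0} \<longrightarrow>
           vector_space.dim scale (loop_vir_module.weight_space scale act \<mu>) = 1"
proof (intro allI impI)
  fix \<mu> assume \<mu>: "loop_vir_module.weight_space scale act \<mu> \<noteq> {0}"
  interpret bounded_loop_module scale act \<mu>
    by (intro bounded_loop_module.intro bounded_loop_module_axioms.intro assms \<mu>)
  obtain u where u: "u \<in> weight_space \<mu>" "u \<noteq> 0"
    using \<mu> V.subspace_0[OF weight_subspace[of \<mu>]] by blast
  have "weight_space \<mu> = V.span {u}"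
  proof
    show "weight_space \<mu> \<subseteq> V.span {u}"
      using weight_space_line[OF u] by (auto simp: V.span_singleton)
    show "V.span {u} \<subseteq> weight_space \<mu>"
      using u(1) weight_subspace by (intro V.span_minimal) auto
  qed
  then show "V.dim (weight_space \<mu>) = 1"
    using V.dim_eq_card_independent[of "{u}"] u(2) by (simp add: V.dim_span)
qed

end
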